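(* Let $p\ge3$ be a prime, $\rho\ge1$, $r=p^\rho$, $\mathcal{Z}=\mathbb{F}_r[Y]$, $\mathcal{Q}=\mathbb{F}_r(Y)$. Let $f=f(Y)\in\mathcal{Z}$ be a monic irreducible polynomial and $q=r^{\deg f}$. Let $m\ge1$ and $i\ge1$ be integers, and for each $n\ge 1$ let $\varpi_n$ and $\mathcal{E}_n=\mathcal{Q}(\varpi_n)$ be as defined in the context. Write the minimal polynomial of $\varpi_{m+i}$ over $\mathcal{E}_m$ as $$\mu_{\varpi_{m+i},\mathcal{E}_m}(X)=\sum_{j=0}^{q^i}a_{i,j}X^j=X^{q^i}+\Big(\sum_{j=1}^{q^i-1}a_{i,j}X^j\Big)-\varpi_m\in\mathcal{Z}_{(f)}[\varpi_m][X],$$ and use the same notation with $i$ replaced by $i+\beta$ (same $m$). For $j\ge1$ let $v_q(j)=\max\{\alpha\ge0: q^\alpha\mid j\}$. Divisibilities and congruences are in the ring $\mathcal{Z}_{(f)}[\varpi_m]$. Then: (i) $f^{\,i-v_q(j)}$ divides $a_{i,j}$ for all $j\in[1,q^i]$. (i$'$) If $j\in[1,q^i]$ and $j<q^i(q-2)/(q-1)$, then $f^{\,i-v_q(j)}\varpi_m$ divides $a_{i,j}$. (ii) $a_{i,j}\equiv a_{i+\beta,\,q^\beta j}\pmod{f^{i+1}}$ for all $j\in[0,q^i]$ and all $\beta\ge1$. (ii$'$) If $j\in[0,q^i]$ and $j<q^i(q-2)/(q-1)$, then $a_{i,j}\equiv a_{i+\beta,\,q^\beta j}\pmod{f^{i+1}\varpi_m}$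 for all $\beta\ge1$. (iii) For all $\beta\in[0,i-1]$, the element $a_{i,\,q^i-(q^i-q^\beta)/(q-1)}\,/\,f^{i-\beta}$ is a unit of $\mathcal{Z}_{(f)}[\varpi_m]$. (iv) If $f=Y$, then $\mu_{\varpi_{m+i},\mathcal{E}_m}(X)\equiv X^{q^i}+YX^{(q-1)q^{i-1}}-\varpi_m\pmod{Y^2}$ (coefficientwise).
   Context: $[a,b]$ denotes the set of integers $c$ with $a\le c\le b$. Fix an algebraic closure $\overline{\mathcal{Q}}$ of $\mathcal{Q}$. The Carlitz module structure is the $\mathcal{Z}$-module structure on $\overline{\mathcal{Q}}$ given by the $\mathbb{F}_r$-algebra homomorphism from $\mathcal{Z}$ to the ring of $\mathbb{F}_r$-linear endomorphisms of $\overline{\mathcal{Q}}$ sending $Y$ to $\xi\mapsto Y\xi+\xi^r$. For $e\in\mathcal{Z}$ let $P_e(X)\in\mathcal{Z}[X]$ be the unique polynomial such that $e$ acts on $\overline{\mathcal{Q}}$ as $\xi\mapsto P_e(\xi)$. The annihilator $\{\xi\in\overline{\mathcal{Q}}:P_{f^n}(\xi)=0\}$ is a $\mathcal{Z}$-module isomorphic to $\mathcal{Z}/f^n$; for each $n\ge1$ let $\theta_n$ be a $\mathcal{Z}$-module generator of it, chosen so that $P_f(\theta_{n+1})=\theta_n$ for all $n\ge1$. Let $\mathcal{F}_n=\mathcal{Q}(\theta_n)$; it is Galois over $\mathcal{Q}$ with group $(\mathcal{Z}/f^n)^*$, where $e$ corresponds to the automorphism $\theta_n\mapsto P_e(\theta_n)$.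 Let $\mathcal{E}_n$ be the fixed field in $\mathcal{F}_n$ of the unique subgroup $C_{q-1}$ of order $q-1$ of $\mathrm{Gal}(\mathcal{F}_n|\mathcal{Q})$, so $[\mathcal{E}_n:\mathcal{Q}]=q^{n-1}$. Put $$\varpi_n=\mathrm{N}_{\mathcal{F}_n|\mathcal{E}_n}(\theta_n)=\prod_{e\in(\mathcal{Z}/f)^*}P_{e^{q^{n-1}}}(\theta_n).$$ Then $\mathcal{E}_n=\mathcal{Q}(\varpi_n)$, $\varpi_1=f$, and $\mathcal{E}_{m+i}=\mathcal{E}_m(\varpi_{m+i})$ with $[\mathcal{E}_{m+i}:\mathcal{E}_m]=q^i$. $\mathcal{Z}_{(f)}$ is the localization of $\mathcal{Z}$ at the prime ideal $(f)$; $\mathcal{Z}_{(f)}[\varpi_n]$ is a discrete valuation ring with maximal ideal generated by $\varpi_n$, totally ramified of degree $q^{n-1}$ over $\mathcal{Z}_{(f)}$. *)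

theory Defs
  imports
    "HOL-Library.Cardinality"
    "HOL-Algebra.Algebraic_Closure_Type"
    "HOL-Algebra.Finite_Extensions"
    "HOL-Algebra.Generated_Fields"
    "HOL-Algebra.Bij"
begin

(* The type 'k is the finite field F_r, so 'k poly is Z = F_r[Y], 'k poly fract is
   Q = F_r(Y), and 'k qbar is an algebraic closure of Q.  Subfields and subrings of the
   closure are sets over the HOL-Algebra ring  ring_of_type_algebra  of the whole type. *)
type_synonym 'k qbar = "'k poly fract alg_closure"

definition emb :: "'k::field poly \<Rightarrow> 'k qbar" where
  "emb a = to_ac (Fraction_Field.Fract a 1)"

definition baseQ :: "'k::field qbar set" where
  "baseQ = range to_ac"


section \<open>Carlitz module\<close>

definition carlitz_Y :: "'k::{field,finite} qbar \<Rightarrow> 'k qbar" where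
  "carlitz_Y \<xi> = emb [:0, 1:] * \<xi> + \<xi> ^ CARD('k)"

(* carlitz_act e is the image of e under the F_r-algebra homomorphism Z -> End with
   Y |-> carlitz_Y, i.e. the evaluation of the polynomial e at the endomorphism carlitz_Y.
   Thus carlitz_act e xi is P_e(xi). *)
definition carlitz_act :: "'k::{field,finite} poly \<Rightarrow> 'k qbar \<Rightarrow> 'k qbar" where
  "carlitz_act e \<xi> =
     (\<Sum>k\<le>Polynomial.degree e. emb [:Polynomial.coeff e k:] * (carlitz_Y ^^ k) \<xi>)"

definition carlitz_annihilator :: "'k::{field,finite} poly \<Rightarrow> 'k qbar set" where
  "carlitz_annihilator g = {\<xi>. carlitz_act g \<xi> = 0}"

(* theta 0 is irrelevant. *)
definition compatible_generators :: "'k::{field,finite} poly \<Rightarrow> (nat \<Rightarrow> 'k qbar) \<Rightarrow> bool" where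
  "compatible_generators f \<theta> \<longleftrightarrow>
     (\<forall>n\<ge>1. carlitz_annihilator (f ^ n) = range (\<lambda>e. carlitz_act e (\<theta> n))) \<and>
     (\<forall>n\<ge>1. carlitz_act f (\<theta> (Suc n)) = \<theta> n)"


section \<open>Galois groups, fixed fields, norms, minimal polynomials\<close>

(* Automorphisms are made extensional on F, as in the library's Bij and AutoGroup. *)
definition galois_group :: "'a::field set \<Rightarrow> 'a set \<Rightarrow> ('a \<Rightarrow> 'a) monoid" where
  "galois_group F K =
     BijGroup F \<lparr>carrier :=
       {\<sigma> \<in> Bij F.
          \<sigma> \<in> ring_hom (ring_of_type_algebra\<lparr>carrier := F\<rparr>) (ring_of_type_algebra\<lparr>carrier := F\<rparr>) \<and>
          (\<forall>x\<in>K. \<sigma> x = x)}\<rparr>"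

definition fixed_field :: "'a::field set \<Rightarrow> ('a \<Rightarrow> 'a) set \<Rightarrow> 'a set" where
  "fixed_field F C = {x \<in> F. \<forall>\<sigma>\<in>C. \<sigma> x = x}"

(* This is the field norm when F | K is finite Galois. *)
definition galois_norm :: "'a::field set \<Rightarrow> 'a set \<Rightarrow> 'a \<Rightarrow> 'a" where
  "galois_norm F K x = (\<Prod>\<sigma>\<in>carrier (galois_group F K). \<sigma> x)"

(* HOL-Algebra polynomials are coefficient lists, leading coefficient first. *)
definition min_poly :: "'a::field set \<Rightarrow> 'a \<Rightarrow> 'a poly" where
  "min_poly K x = Poly (rev (ring.Irr ring_of_type_algebra K x))"


section \<open>The tower\<close>

definition cycF :: "(nat \<Rightarrow> 'k::{field,finite} qbar) \<Rightarrow> nat \<Rightarrow> 'k qbar set" where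
  "cycF \<theta> n = generate_field ring_of_type_algebra (insert (\<theta> n) baseQ)"

definition subgroup_C ::
    "'k::{field,finite} poly \<Rightarrow> (nat \<Rightarrow> 'k qbar) \<Rightarrow> nat \<Rightarrow> ('k qbar \<Rightarrow> 'k qbar) set" where
  "subgroup_C f \<theta> n =
     (THE C. subgroup C (galois_group (cycF \<theta> n) baseQ) \<and>
             card C = CARD('k) ^ Polynomial.degree f - 1)"

definition cycE :: "'k::{field,finite} poly \<Rightarrow> (nat \<Rightarrow> 'k qbar) \<Rightarrow> nat \<Rightarrow> 'k qbar set" where
  "cycE f \<theta> n = fixed_field (cycF \<theta> n) (subgroup_C f \<theta> n)"

definition varpi :: "'k::{field,finite} poly \<Rightarrow> (nat \<Rightarrow> 'k qbar) \<Rightarrow> nat \<Rightarrow> 'k qbar" where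
  "varpi f \<theta> n = galois_norm (cycF \<theta> n) (cycE f \<theta> n) (\<theta> n)"

definition mu ::
    "'k::{field,finite} poly \<Rightarrow> (nat \<Rightarrow> 'k qbar) \<Rightarrow> nat \<Rightarrow> nat \<Rightarrow> 'k qbar poly" where
  "mu f \<theta> m i = min_poly (cycE f \<theta> m) (varpi f \<theta> (m + i))"

definition localized :: "'k::{field,finite} poly \<Rightarrow> 'k qbar set" where
  "localized f = {emb a / emb b | a b. \<not> f dvd b}"

(* The ring Z_(f)[x], in which "divides" and "Units" below are taken. *)
definition localized_adjoin :: "'k::{field,finite} poly \<Rightarrow> 'k qbar \<Rightarrow> 'k qbar ring" where
  "localized_adjoin f x =
     ring_of_type_algebra
       \<lparr>carrier := generate_ring ring_of_type_algebra (insert x (localized f))\<rparr>"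

end

theory Submission
  imports Defs
begin

text \<open>By Zorn's lemma there is a valuation ring \<open>V\<close> of the algebraic closure that contains \<open>\<Z>_(f)\<close> and in
  which \<open>f\<close> is not invertible; it measures all fields of the tower at once. Since \<open>P_f(X) \<equiv> X^q\<close> modulo \<open>f\<close>,
  \<open>\<theta>_(n+1)^q\<close> is associated to \<open>\<theta>_n\<close>, so the powers of \<open>\<theta>_n\<close> have distinct values; this gives the
  degrees, the Galois groups and the integral elements of the tower.

  The minimal polynomial of \<open>\<varpi>_(n+t+1)\<close> over \<open>E_n\<close> is the norm of the one over \<open>E_(n+1)\<close>. For one step,
  \<open>\<varpi>_(n+1)^q\<close> and \<open>\<varpi>_n\<close> agree up to \<open>f \<varpi>_(n+1)^(q-1)\<close>, and Newton's identities then show that the trace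
  from \<open>E_(n+1)\<close> to \<open>E_n\<close> gains a factor \<open>f / \<varpi>_(n+1)\<close>. Inductively, the difference of the minimal
  polynomial of \<open>\<varpi>_(n+t+1)\<close> and that of \<open>\<varpi>_(n+t)\<close> evaluated at \<open>X^q\<close> is highly divisible, because to
  first order the norm changes by a trace. These bounds yield the divisibilities and congruences. They are
  sharp at one coefficient, because the derivative of the minimal polynomial at \<open>\<varpi>_(n+t)\<close> has a value that
  can be computed step by step as the different. For \<open>f = Y\<close> the first minimal polynomial is
  \<open>X (X - Y)^(q-1) - \<varpi>_m\<close>.\<close>

section \<open>Subrings and polynomials over them\<close>

text \<open>Values in E_n are integral multiples of that of \<varpi>_n, so terms whose values have
  different residues cannot cancel; independence, integrality and exact values are all read off in
  this way. The numbers in the theorem come from one bound. In units of \<varpi>_(n+t+1), where f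
  counts q^(n+t) and \<varpi>_n counts q^(t+1), the coefficient at j of the difference of
  consecutive minimal polynomials has value at least (t+1) q^(n+t) + q^(t+1) - dl - j, where dl = 1
  + q + ... + q^t = (q^(t+1) - 1) / (q - 1). Each step of the tower contributes a factor f and loses
  a uniformizer; dl adds up the losses. Since values in E_n are multiples of q^(t+1) and dl <
  q^(t+1), for j < q^(t+1) the bound rounds up to f^(t+1), and even to f^(t+1) \<varpi>_n if j + dl
  < q^(t+1); this is the origin of q^i (q-2) / (q-1). For such j the bound is itself a multiple of
  q^(t+1) only at j = q^(t+1) - dl, so only there can it be attained; this index times q^\<beta> is
  the one in (iii).\<close>

definition polys :: "'a::zero set \<Rightarrow> 'a poly set" where
  "polys K = {P. \<forall>j. coeff P j \<in> K}"

lemma polysD: "P \<in> polys K \<Longrightarrow> coeff P j \<in> K" by (simp add: polys_def)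
lemma polysI: "(\<And>j. coeff P j \<in> K) \<Longrightarrow> P \<in> polys K" by (simp add: polys_def)
lemma polys_mono: "K \<subseteq> L \<Longrightarrow> polys K \<subseteq> polys L" by (auto simp: polys_def)

text \<open>Subrings are sets in one ambient field, so that \<open>V\<close>,
  \<open>range emb\<close>, the localization and all fields of the tower share their elements, and
  polynomials over them are ordinary polynomials.\<close>

locale subr =
  fixes K :: "'a::field set"
  assumes one_in: "1 \<in> K"
    and diff_in: "x \<in> K \<Longrightarrow> y \<in> K \<Longrightarrow> x - y \<in> K"
    and mult_in: "x \<in> K \<Longrightarrow> y \<in> K \<Longrightarrow> x * y \<in> K"
begin

lemma zero_in [simp]: "0 \<in> K" using diff_in[OF one_in one_in] by simp
lemma uminus_in: "x \<in> K \<Longrightarrow> - x \<in> K" using diff_in[OF zero_in] by fastforce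
lemma add_in: "x \<in> K \<Longrightarrow> y \<in> K \<Longrightarrow> x + y \<in> K" using diff_in[OF _ uminus_in] by fastforce
lemma power_in: "x \<in> K \<Longrightarrow> x ^ n \<in> K" by (induction n) (auto simp: one_in mult_in)
lemma sum_in: "(\<And>x. x \<in> A \<Longrightarrow> g x \<in> K) \<Longrightarrow> sum g A \<in> K"
  by (induction A rule: infinite_finite_induct) (auto intro: add_in)
lemma prod_in: "(\<And>x. x \<in> A \<Longrightarrow> g x \<in> K) \<Longrightarrow> prod g A \<in> K"
  by (induction A rule: infinite_finite_induct) (auto intro: mult_in one_in)
lemma of_nat_in: "of_nat n \<in> K" by (induction n) (auto intro: add_in one_in)

lemma polys_const: "a \<in> K \<Longrightarrow> [:a:] \<in> polys K" by (auto intro!: polysI simp: coeff_pCons split: nat.split)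
lemma polys_0: "0 \<in> polys K" by (simp add: polys_def)
lemma polys_1: "1 \<in> polys K" using polys_const[OF one_in] by (simp add: one_pCons)
lemma polys_pCons: "a \<in> K \<Longrightarrow> P \<in> polys K \<Longrightarrow> pCons a P \<in> polys K"
  by (auto intro!: polysI simp: coeff_pCons polysD split: nat.split)
lemma polys_add: "P \<in> polys K \<Longrightarrow> Q \<in> polys K \<Longrightarrow> P + Q \<in> polys K" by (simp add: polys_def add_in)
lemma polys_diff: "P \<in> polys K \<Longrightarrow> Q \<in> polys K \<Longrightarrow> P - Q \<in> polys K" by (simp add: polys_def diff_in)
lemma polys_mult: "P \<in> polys K \<Longrightarrow> Q \<in> polys K \<Longrightarrow> P * Q \<in> polys K"
  by (simp add: polys_def coeff_mult sum_in mult_in)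
lemma polys_smult: "a \<in> K \<Longrightarrow> P \<in> polys K \<Longrightarrow> smult a P \<in> polys K"
  by (simp add: polys_def mult_in)
lemma polys_power: "P \<in> polys K \<Longrightarrow> P ^ n \<in> polys K" by (induction n) (auto simp: polys_1 polys_mult)
lemma polys_sum: "(\<And>x. x \<in> A \<Longrightarrow> g x \<in> polys K) \<Longrightarrow> sum g A \<in> polys K"
  by (induction A rule: infinite_finite_induct) (auto intro: polys_add polys_0)
lemma polys_prod: "(\<And>x. x \<in> A \<Longrightarrow> g x \<in> polys K) \<Longrightarrow> prod g A \<in> polys K"
  by (induction A rule: infinite_finite_induct) (auto intro: polys_mult polys_1)
lemma polys_monom: "a \<in> K \<Longrightarrow> monom a n \<in> polys K" by (simp add: polys_def)
lemma polys_pcompose: "P \<in> polys K \<Longrightarrow> Q \<in> polys K \<Longrightarrow> pcompose P Q \<in> polys K"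
proof (induction P rule: pCons_induct)
  case (pCons a P)
  have "a \<in> K" "P \<in> polys K" using polysD[OF pCons.prems(1), of 0] polysD[OF pCons.prems(1), of "Suc _"]
    by (auto intro: polysI)
  then show ?case using pCons by (simp add: pcompose_pCons polys_add polys_mult polys_const)
qed (simp add: polys_0)
lemma poly_in: "P \<in> polys K \<Longrightarrow> x \<in> K \<Longrightarrow> poly P x \<in> K"
  unfolding poly_altdef by (intro sum_in mult_in power_in) (auto simp: polysD)

end

section \<open>Valuation rings of a field\<close>

locale valring = subr V for V :: "'a::field set" +
  assumes total_V: "x \<notin> V \<Longrightarrow> inverse x \<in> V"
begin

definition "U = {x \<in> V. x \<noteq> 0 \<and> inverse x \<in> V}"
definition "M = V - U"

lemma U_V: "x \<in> U \<Longrightarrow> x \<in> V" and M_V: "x \<in> M \<Longrightarrow> x \<in> V" and U_nz: "x \<in> U \<Longrightarrow> x \<noteq> 0"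
  by (auto simp: U_def M_def)
lemma one_U: "1 \<in> U" by (auto simp: U_def one_in)
lemma zero_M: "0 \<in> M" by (auto simp: U_def M_def)
lemma U_mult: "x \<in> U \<Longrightarrow> y \<in> U \<Longrightarrow> x * y \<in> U" by (auto simp: U_def mult_in)
lemma U_inverse: "x \<in> U \<Longrightarrow> inverse x \<in> U" by (auto simp: U_def)
lemma U_divide: "x \<in> U \<Longrightarrow> y \<in> U \<Longrightarrow> x / y \<in> U" by (simp add: divide_inverse U_mult U_inverse)
lemma U_power: "x \<in> U \<Longrightarrow> x ^ n \<in> U" by (induction n) (auto simp: one_U U_mult)
lemma U_powi: "x \<in> U \<Longrightarrow> x powi n \<in> U" by (auto simp: power_int_def U_power U_inverse)
lemma U_prod: "(\<And>x. x \<in> A \<Longrightarrow> g x \<in> U) \<Longrightarrow> prod g A \<in> U"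
  by (induction A rule: infinite_finite_induct) (auto intro: U_mult one_U)
lemma U_uminus: "x \<in> U \<Longrightarrow> - x \<in> U" by (auto simp: U_def uminus_in)
lemma U_not_M: "x \<in> U \<Longrightarrow> x \<notin> M" by (auto simp: M_def)

lemma V_divide_U: "x \<in> V \<Longrightarrow> y \<in> U \<Longrightarrow> x / y \<in> V"
  by (auto simp: U_def divide_inverse mult_in)

lemma U_factor: assumes "x \<in> V" "y \<in> V" "x * y \<in> U" shows "x \<in> U"
proof -
  have "x \<noteq> 0" "y \<noteq> 0" using U_nz[OF assms(3)] by auto
  then have "inverse x = y * inverse (x * y)" by simp
  also have "\<dots> \<in> V" using assms(2,3) mult_in unfolding U_def by blast
  finally have "inverse x \<in> V" .
  then show ?thesis using assms \<open>x \<noteq> 0\<close> by (auto simp: U_def)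
qed

lemma V_mult_M: assumes "x \<in> V" "y \<in> M" shows "x * y \<in> M"
proof -
  have "x * y \<notin> U" using U_factor[of y x] assms by (auto simp: M_def mult.commute)
  then show ?thesis using assms by (auto simp: M_def mult_in)
qed

lemma M_mult_V: "y \<in> M \<Longrightarrow> x \<in> V \<Longrightarrow> y * x \<in> M" using V_mult_M by (simp add: mult.commute)

lemma M_iff: "x \<noteq> 0 \<Longrightarrow> x \<in> M \<longleftrightarrow> inverse x \<notin> V"
  using total_V[of x] by (auto simp: M_def U_def)

lemma M_add: assumes "x \<in> M" "y \<in> M" shows "x + y \<in> M"
proof -
  have *: "x + y \<in> M" if "x \<in> M" "y \<in> M" "x / y \<in> V" "y \<noteq> 0" for x y
  proof -
    have "x + y = y * (x / y + 1)" using that(4) by (simp add: distrib_left)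
    then show ?thesis using M_mult_V[OF that(2) add_in[OF that(3) one_in]] by simp
  qed
  show ?thesis
  proof (cases "x = 0 \<or> y = 0")
    case False
    then have "x / y \<in> V \<or> y / x \<in> V" using total_V[of "x / y"] by auto
    then show ?thesis using *[of x y] *[of y x] assms False by (auto simp: add.commute)
  qed (use assms in auto)
qed

lemma M_uminus: "x \<in> M \<Longrightarrow> - x \<in> M" using V_mult_M[OF uminus_in[OF one_in]] by fastforce
lemma M_diff: "x \<in> M \<Longrightarrow> y \<in> M \<Longrightarrow> x - y \<in> M" using M_add[OF _ M_uminus] by fastforce
lemma M_sum: "(\<And>x. x \<in> A \<Longrightarrow> g x \<in> M) \<Longrightarrow> sum g A \<in> M"
  by (induction A rule: infinite_finite_induct) (auto intro: M_add zero_M)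
lemma M_power: "x \<in> M \<Longrightarrow> n > 0 \<Longrightarrow> x ^ n \<in> M" by (cases n) (auto simp: M_mult_V power_in M_V)
lemma M_powerD: "x ^ n \<in> M \<Longrightarrow> x \<in> V \<Longrightarrow> x \<in> M" using U_power M_def by auto

lemma U_add_M: assumes "x \<in> U" "y \<in> M" shows "x + y \<in> U"
proof (rule ccontr)
  assume "x + y \<notin> U"
  then have "x + y \<in> M" using assms U_V M_V add_in by (auto simp: M_def)
  then show False using M_diff[OF _ assms(2)] U_not_M[OF assms(1)] by fastforce
qed

lemma U_diff_M: "x \<in> U \<Longrightarrow> y \<in> M \<Longrightarrow> x - y \<in> U" using U_add_M[OF _ M_uminus] by fastforce

text \<open>\<open>V\<close> need not be discrete, so values are compared with integral powers of an element \<open>T\<close>, which will be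
  a uniformizer of one of the fields of the tower.\<close>
definition vge :: "'a \<Rightarrow> int \<Rightarrow> 'a \<Rightarrow> bool" where "vge T L x \<longleftrightarrow> x * T powi (- L) \<in> V"
definition veq :: "'a \<Rightarrow> int \<Rightarrow> 'a \<Rightarrow> bool" where "veq T L x \<longleftrightarrow> x * T powi (- L) \<in> U"

lemma veq_nz: "veq T L x \<Longrightarrow> x \<noteq> 0" using U_nz[of "x * T powi (- L)"] by (auto simp: veq_def)
lemma vge_zero [simp]: "vge T L 0" by (simp add: vge_def)
lemma vge_add: "vge T L x \<Longrightarrow> vge T L y \<Longrightarrow> vge T L (x + y)" by (simp add: vge_def distrib_right add_in)
lemma vge_diff: "vge T L x \<Longrightarrow> vge T L y \<Longrightarrow> vge T L (x - y)" by (simp add: vge_def left_diff_distrib diff_in)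
lemma vge_uminus: "vge T L x \<Longrightarrow> vge T L (- x)" using vge_diff[of T L 0 x] by simp
lemma vge_sum: "(\<And>x. x \<in> A \<Longrightarrow> vge T L (g x)) \<Longrightarrow> vge T L (sum g A)"
  by (induction A rule: infinite_finite_induct) (auto intro: vge_add)
lemma veq_uminus: "veq T L x \<Longrightarrow> veq T L (- x)" using U_uminus by (fastforce simp: veq_def)
lemma vge_0_iff: "vge T 0 x \<longleftrightarrow> x \<in> V" by (simp add: vge_def)
lemma veq_0_iff: "veq T 0 x \<longleftrightarrow> x \<in> U" by (simp add: veq_def)

context
  fixes T assumes T: "T \<in> M" "T \<noteq> 0"
begin

lemma powi_split: "T powi (- (a + b)) = T powi (- a) * T powi (- b)"
  using T by (simp add: power_int_add[symmetric])

lemma vge_mult: "vge T L x \<Longrightarrow> vge T L' y \<Longrightarrow> vge T (L + L') (x * y)"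
  unfolding vge_def powi_split using mult_in[of "x * T powi (- L)" "y * T powi (- L')"] by (simp add: mult_ac)
lemma veq_mult: "veq T L x \<Longrightarrow> veq T L' y \<Longrightarrow> veq T (L + L') (x * y)"
  unfolding veq_def powi_split using U_mult[of "x * T powi (- L)" "y * T powi (- L')"] by (simp add: mult_ac)
lemma veq_one: "veq T 0 1" by (simp add: veq_def one_U)
lemma veq_self: "veq T 1 T" using T by (simp add: veq_def one_U)
lemma veq_power: "veq T L x \<Longrightarrow> veq T (int n * L) (x ^ n)"
  by (induction n) (auto simp: veq_one distrib_right intro: veq_mult)
lemma veq_inverse: "veq T L x \<Longrightarrow> veq T (- L) (inverse x)"
  using U_inverse[of "x * T powi (- L)"] by (simp add: veq_def power_int_minus)
lemma veq_powi: "veq T L x \<Longrightarrow> veq T (n * L) (x powi n)"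
  using veq_power[of L x "nat n"] veq_power[OF veq_inverse, of L x "nat (- n)"]
  by (auto simp: power_int_def)
lemma veq_divide: "veq T L x \<Longrightarrow> veq T L' y \<Longrightarrow> veq T (L - L') (x / y)"
  using veq_mult[OF _ veq_inverse] by (fastforce simp: divide_inverse)
lemma veq_prod: "finite A \<Longrightarrow> (\<And>x. x \<in> A \<Longrightarrow> veq T L (g x)) \<Longrightarrow> veq T (int (card A) * L) (prod g A)"
  by (induction A rule: finite_induct) (auto simp: veq_one distrib_right intro: veq_mult)
lemma veq_imp_vge: "veq T L x \<Longrightarrow> vge T L x" by (simp add: veq_def vge_def U_V)

lemma powi_M: "n > 0 \<Longrightarrow> T powi n \<in> M" using T by (auto simp: power_int_def intro: M_power)
lemma powi_V_iff: "T powi n \<in> V \<longleftrightarrow> n \<ge> 0"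
proof
  assume "T powi n \<in> V"
  show "n \<ge> 0"
  proof (rule ccontr)
    assume "\<not> n \<ge> 0"
    then have "T powi (- n) * T powi n \<in> M" using M_mult_V powi_M \<open>T powi n \<in> V\<close> by simp
    then show False using T one_U U_not_M by (simp add: power_int_add[symmetric])
  qed
next
  assume "n \<ge> 0" then show "T powi n \<in> V" using T M_V power_in by (auto simp: power_int_def)
qed

lemma veq_vge_iff: assumes "veq T k x" shows "vge T L x \<longleftrightarrow> L \<le> k"
proof -
  have "x * T powi (- L) = (x * T powi (- k)) * T powi (k - L)"
    using T by (simp add: power_int_add[symmetric])
  moreover have "u * y \<in> V \<longleftrightarrow> y \<in> V" if "u \<in> U" for u y
    using that V_divide_U[of "u * y" u] by (auto simp: mult_in U_V U_nz)
  ultimately have "vge T L x \<longleftrightarrow> T powi (k - L) \<in> V" using assms unfolding veq_def vge_def by metis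
  then show ?thesis by (simp add: powi_V_iff)
qed

lemma veq_unique: "veq T k x \<Longrightarrow> veq T l x \<Longrightarrow> k = l"
  using veq_vge_iff[of k x k] veq_vge_iff[of k x l] veq_vge_iff[of l x k] veq_vge_iff[of l x l] by linarith

lemma vge_mono: assumes "vge T L x" "L' \<le> L" shows "vge T L' x"
proof -
  have "x * T powi (- L') = (x * T powi (- L)) * T powi (L - L')"
    using T by (simp add: power_int_add[symmetric])
  also have "\<dots> \<in> V"
    using mult_in[OF assms(1)[unfolded vge_def]] assms(2) powi_V_iff[of "L - L'"] by simp
  finally show ?thesis by (simp add: vge_def)
qed

lemma veq_cong: "veq T L x \<Longrightarrow> vge T (L + 1) (y - x) \<Longrightarrow> veq T L y"
proof -
  assume a: "veq T L x" "vge T (L + 1) (y - x)"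
  have "(y - x) * T powi (- L) = ((y - x) * T powi (- (L + 1))) * T powi 1"
    using T by (simp add: mult.assoc power_int_add[symmetric] del: power_int_1_right)
  then have "(y - x) * T powi (- L) \<in> M" using V_mult_M[OF a(2)[unfolded vge_def] powi_M[of 1]] by (metis zero_less_one)
  then have "x * T powi (- L) + (y - x) * T powi (- L) \<in> U" using U_add_M a unfolding veq_def by blast
  then show ?thesis by (simp add: veq_def algebra_simps)
qed

text \<open>Terms of pairwise distinct values cannot cancel. If some term fell below the bound, take
  \<open>l\<close> of least value among the nonzero terms: the sum and all other terms have value
  above \<open>a l\<close>, hence \<open>x l\<close> would too.\<close>

lemma distinct_values:
  assumes "finite K" "\<And>k. k \<in> K \<Longrightarrow> x k \<noteq> 0 \<Longrightarrow> veq T (a k) (x k)"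
    and inj: "\<And>k l. k \<in> K \<Longrightarrow> l \<in> K \<Longrightarrow> x k \<noteq> 0 \<Longrightarrow> x l \<noteq> 0 \<Longrightarrow> a k = a l \<Longrightarrow> k = l"
    and S: "vge T L (\<Sum>k\<in>K. x k)" and k: "k \<in> K"
  shows "vge T L (x k)"
proof (rule ccontr)
  assume n: "\<not> vge T L (x k)"
  define K' where "K' = {k \<in> K. x k \<noteq> 0}"
  have "x k \<noteq> 0" using n by (metis vge_zero)
  then have K': "finite K'" "K' \<noteq> {}" "k \<in> K'" using assms(1) k by (auto simp: K'_def)
  obtain l where l: "l \<in> K'" "\<And>j. j \<in> K' \<Longrightarrow> a l \<le> a j"
    using arg_min_if_finite[OF K'(1,2), of a] by (metis leI)
  have lL: "a l < L" using n l(2)[OF K'(3)] assms(2)[OF k \<open>x k \<noteq> 0\<close>] veq_vge_iff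
    by (metis dual_order.trans leI)
  have o: "vge T (a l + 1) (x j)" if "j \<in> K - {l}" for j
  proof (cases "x j = 0")
    case False
    then have "a l \<noteq> a j" using inj[of l j] that l(1) by (auto simp: K'_def)
    moreover have "a l \<le> a j" using l(2) that False by (auto simp: K'_def)
    ultimately show ?thesis using veq_vge_iff[OF assms(2)] that False by force
  qed auto
  have "(\<Sum>k\<in>K. x k) = x l + (\<Sum>j\<in>K - {l}. x j)" using l(1) assms(1) by (auto simp: K'_def sum.remove)
  then have "x l = (\<Sum>k\<in>K. x k) - (\<Sum>j\<in>K - {l}. x j)" by simp
  moreover have "vge T (a l + 1) (\<Sum>k\<in>K. x k)" using vge_mono[OF S] lL by simp
  ultimately have "vge T (a l + 1) (x l)" using vge_diff vge_sum o by metis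
  then show False using veq_vge_iff[of "a l" "x l"] assms(2)[of l] l(1) by (auto simp: K'_def)
qed

lemma vge_all_zero: assumes "veq T k x \<or> x = 0" "\<And>L. vge T L x" shows "x = 0"
  using assms veq_vge_iff[of k x "k + 1"] by force

lemma distinct_values_zero:
  assumes "finite K" "\<And>k. k \<in> K \<Longrightarrow> x k \<noteq> 0 \<Longrightarrow> veq T (a k) (x k)"
    and inj: "\<And>k l. k \<in> K \<Longrightarrow> l \<in> K \<Longrightarrow> x k \<noteq> 0 \<Longrightarrow> x l \<noteq> 0 \<Longrightarrow> a k = a l \<Longrightarrow> k = l"
    and S: "(\<Sum>k\<in>K. x k) = 0" and k: "k \<in> K"
  shows "x k = 0"
proof (rule vge_all_zero[of "a k"])
  show "vge T L (x k)" for L by (rule distinct_values[where K=K and a=a]) (use assms in auto)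
qed (use assms(2)[OF k] in auto)

text \<open>The term of least value determines the value of the sum. Its index is handed out as
  well, so that a caller who knows the value of the sum can identify the term.\<close>

lemma veq_sum_distinct:
  assumes "finite K" "\<And>k. k \<in> K \<Longrightarrow> x k \<noteq> 0 \<Longrightarrow> veq T (a k) (x k)"
    and inj: "\<And>k l. k \<in> K \<Longrightarrow> l \<in> K \<Longrightarrow> x k \<noteq> 0 \<Longrightarrow> x l \<noteq> 0 \<Longrightarrow> a k = a l \<Longrightarrow> k = l"
    and nz: "(\<Sum>k\<in>K. x k) \<noteq> 0"
  obtains k where "k \<in> K" "x k \<noteq> 0" "veq T (a k) (\<Sum>k\<in>K. x k)"
proof -
  define K' where "K' = {k \<in> K. x k \<noteq> 0}"
  have s: "(\<Sum>k\<in>K. x k) = (\<Sum>k\<in>K'. x k)" using assms(1) by (auto simp: K'_def intro!: sum.mono_neutral_right)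
  have "K' \<noteq> {}"
  proof
    assume "K' = {}" then show False using nz unfolding s by simp
  qed
  then have K': "finite K'" "K' \<noteq> {}" using assms(1) by (simp_all add: K'_def)
  obtain l where l: "l \<in> K'" "\<And>j. j \<in> K' \<Longrightarrow> a l \<le> a j"
    using arg_min_if_finite[OF K'(1,2), of a] by (metis leI)
  have o: "vge T (a l + 1) (x j)" if "j \<in> K' - {l}" for j
  proof -
    have "a l \<noteq> a j" using inj[of l j] that l(1) by (auto simp: K'_def)
    moreover have "a l \<le> a j" using l(2) that by (auto simp: K'_def)
    ultimately show ?thesis using veq_vge_iff[OF assms(2)] that by (force simp: K'_def)
  qed
  have "(\<Sum>k\<in>K'. x k) - x l = (\<Sum>j\<in>K' - {l}. x j)" using l(1) K'(1) by (simp add: sum.remove)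
  then have "vge T (a l + 1) ((\<Sum>k\<in>K'. x k) - x l)" using o vge_sum[of "K' - {l}"] by presburger
  then have "veq T (a l) (\<Sum>k\<in>K. x k)" using veq_cong[of "a l" "x l"] assms(2)[of l] l(1) s by (auto simp: K'_def)
  then show ?thesis using that[of l] l(1) by (auto simp: K'_def)
qed

text \<open>Change of the reference element: \<open>S\<close> counts \<open>k\<close> times as much
  as \<open>T\<close>, so bounds are multiplied by the ramification index \<open>k\<close>.\<close>

lemma vge_trans: assumes "veq T k S" "vge S L x" shows "vge T (k * L) x"
proof -
  have "veq T (- (k * L)) (S powi (- L))" using veq_powi[OF assms(1), of "- L"] by (simp add: mult.commute)
  then have u: "S powi (- L) * T powi (k * L) \<in> U" by (simp add: veq_def)
  have "x * T powi (- (k * L)) = (x * S powi (- L)) / (S powi (- L) * T powi (k * L))"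
    using T veq_nz[OF assms(1)] by (simp add: power_int_minus field_simps)
  then show ?thesis using V_divide_U[OF _ u] assms(2) unfolding vge_def by metis
qed

lemma veq_trans: assumes "veq T k S" "veq S L x" shows "veq T (k * L) x"
proof -
  have "veq T (- (k * L)) (S powi (- L))" using veq_powi[OF assms(1), of "- L"] by (simp add: mult.commute)
  then have u: "S powi (- L) * T powi (k * L) \<in> U" by (simp add: veq_def)
  have "x * T powi (- (k * L)) = (x * S powi (- L)) / (S powi (- L) * T powi (k * L))"
    using T veq_nz[OF assms(1)] by (simp add: power_int_minus field_simps)
  then show ?thesis using U_divide[OF _ u] assms(2) unfolding veq_def by metis
qed

lemma M_iff_vge: "veq T k x \<Longrightarrow> x \<in> M \<longleftrightarrow> k > 0"
  using veq_vge_iff[of k x 0] veq_unique[of k x 0]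
  by (cases "k = 0") (auto simp: vge_0_iff veq_0_iff M_def)

end

end

section \<open>Weighted bounds for the coefficients of a polynomial\<close>

context valring
begin

text \<open>Every term \<open>coeff P j * T ^ j\<close> has value at least that of \<open>T ^ L\<close>.\<close>
definition wt :: "'a \<Rightarrow> int \<Rightarrow> 'a poly \<Rightarrow> bool" where
  "wt T L P \<longleftrightarrow> (\<forall>j. vge T (L - int j) (coeff P j))"

lemma wtD: "wt T L P \<Longrightarrow> vge T (L - int j) (coeff P j)" by (simp add: wt_def)
lemma wt_zero: "wt T L 0" by (simp add: wt_def)
lemma wt_add: "wt T L P \<Longrightarrow> wt T L Q \<Longrightarrow> wt T L (P + Q)" by (simp add: wt_def vge_add)
context
  fixes T assumes T: "T \<in> M" "T \<noteq> 0"
begin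

lemma wt_mono: "wt T L P \<Longrightarrow> L' \<le> L \<Longrightarrow> wt T L' P"
  unfolding wt_def using vge_mono[OF T] by (meson diff_right_mono)
lemma wt_one: "wt T 0 1"
  by (auto simp: wt_def vge_0_iff one_in)
lemma wt_mult: assumes "wt T L P" "wt T L' Q" shows "wt T (L + L') (P * Q)"
  unfolding wt_def coeff_mult
proof (intro allI vge_sum)
  fix n i assume "i \<in> {..n::nat}"
  then have "L + L' - int n = (L - int i) + (L' - int (n - i))" by auto
  then show "vge T (L + L' - int n) (coeff P i * coeff Q (n - i))"
    using vge_mult[OF T wtD[OF assms(1), of i] wtD[OF assms(2), of "n - i"]] by presburger
qed
lemma wt_prod: "finite A \<Longrightarrow> (\<And>a. a \<in> A \<Longrightarrow> wt T L (g a)) \<Longrightarrow> wt T (int (card A) * L) (prod g A)"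
  by (induction A rule: finite_induct) (auto simp: wt_one distrib_right intro: wt_mult)

text \<open>After the linear part is removed, every remaining term contains at least two factors
  \<open>h\<close>, each of which gains \<open>e\<close>. Both bounds are proved in one induction,
  since the bound on the linear part is needed to control \<open>?P - ?Y\<close>.\<close>

lemma wt_prod_expand:
  assumes "finite A" "e \<ge> 0" "\<And>a. a \<in> A \<Longrightarrow> wt T W (y a)" "\<And>a. a \<in> A \<Longrightarrow> wt T (W + e) (h a)"
  shows "wt T (int (card A) * W + 2 * e)
     ((\<Prod>a\<in>A. y a + h a) - (\<Prod>a\<in>A. y a) - (\<Sum>a\<in>A. h a * (\<Prod>b\<in>A - {a}. y b)))"
    and "wt T (int (card A) * W + e) (\<Sum>a\<in>A. h a * (\<Prod>b\<in>A - {a}. y b))"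
  using assms(1,3,4)
proof (induction A rule: finite_induct)
  case empty
  { case 1 then show ?case by (simp add: wt_zero) }
  { case 2 then show ?case by (simp add: wt_zero) }
next
  case (insert x A)
  let ?P = "\<Prod>a\<in>A. y a + h a" and ?Y = "\<Prod>a\<in>A. y a"
  let ?L = "\<Sum>a\<in>A. h a * (\<Prod>b\<in>A - {a}. y b)"
  have L: "(\<Sum>a\<in>insert x A. h a * (\<Prod>b\<in>insert x A - {a}. y b)) = h x * ?Y + y x * ?L"
  proof -
    have "(\<Prod>b\<in>insert x A - {a}. y b) = y x * (\<Prod>b\<in>A - {a}. y b)" if "a \<in> A" for a
    proof -
      have "insert x A - {a} = insert x (A - {a})" using that insert.hyps by auto
      then show ?thesis using insert.hyps by simp
    qed
    then show ?thesis using insert.hyps by (simp add: sum_distrib_left mult_ac)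
  qed
  { case 1
    have w: "wt T W (y x)" "wt T (W + e) (h x)"
      and y: "\<And>a. a \<in> A \<Longrightarrow> wt T W (y a)" and h: "\<And>a. a \<in> A \<Longrightarrow> wt T (W + e) (h a)" using 1 by auto
    note I = insert.IH(1)[OF y h, simplified] and I2 = insert.IH(2)[OF y h, simplified]
    have "wt T (int (card A) * W + e) (?P - ?Y)"
      using wt_add[OF wt_mono[OF I, of "int (card A) * W + e"] I2] assms(2) by simp
    note a = wt_mult[OF w(2) this] and b = wt_mult[OF w(1) I]
    have "(\<Prod>a\<in>insert x A. y a + h a) - (\<Prod>a\<in>insert x A. y a)
        - (\<Sum>a\<in>insert x A. h a * (\<Prod>b\<in>insert x A - {a}. y b))
      = h x * (?P - ?Y) + y x * (?P - ?Y - ?L)"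
      unfolding L using insert.hyps by (simp add: algebra_simps)
    moreover have "int (card (insert x A)) * W + 2 * e = W + e + (int (card A) * W + e)"
      "W + (int (card A) * W + 2 * e) = W + e + (int (card A) * W + e)"
      using insert.hyps by (auto simp: algebra_simps)
    ultimately show ?case using wt_add[OF a] b by presburger }
  { case 2
    have w: "wt T W (y x)" "wt T (W + e) (h x)"
      and y: "\<And>a. a \<in> A \<Longrightarrow> wt T W (y a)" and h: "\<And>a. a \<in> A \<Longrightarrow> wt T (W + e) (h a)" using 2 by auto
    note I2 = insert.IH(2)[OF y h, simplified]
    have "wt T (int (card A) * W) ?Y" by (rule wt_prod[OF insert.hyps(1) y])
    note a = wt_mult[OF w(2) this] and b = wt_mult[OF w(1) I2]
    have "int (card (insert x A)) * W + e = W + e + int (card A) * W"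
      "W + (int (card A) * W + e) = W + e + int (card A) * W"
      using insert.hyps by (auto simp: algebra_simps)
    then show ?case unfolding L using wt_add[OF a] b by presburger }
qed

end

end

section \<open>Existence of dominating valuation rings\<close>

context subr
begin

text \<open>Says that \<open>inverse g\<close> lies in K[x], with a bound \<open>s\<close> on the
  degree; this bound is what the descent below decreases.\<close>

definition inv_combination :: "'a \<Rightarrow> 'a \<Rightarrow> nat \<Rightarrow> bool" where
  "inv_combination g x s \<longleftrightarrow> (\<exists>c. (\<forall>k. c k \<in> K) \<and> 1 = g * (\<Sum>k\<le>s. c k * x ^ k))"

text \<open>The relation for \<open>inverse x\<close>, multiplied by \<open>x ^ s\<close>, gives
  \<open>x ^ s\<close> the coefficient \<open>1 - g * d 0\<close>, which is invertible in
  \<open>K\<close>. So \<open>x ^ s\<close> is \<open>g\<close> times a combination of lower powers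
  and can be eliminated from the relation for \<open>x\<close>; \<open>t \<le> s\<close> keeps the
  exponents nonnegative.\<close>

lemma inv_combination_reduce:
  assumes g: "g \<in> K" and u: "\<And>b. b \<in> K \<Longrightarrow> inverse (1 - g * b) \<in> K \<and> 1 - g * b \<noteq> 0"
    and "x \<noteq> 0" "inv_combination g x s" "inv_combination g (inverse x) t" "t \<ge> 1" "t \<le> s"
  shows "inv_combination g x (s - 1)"
proof -
  obtain c where c: "\<And>k. c k \<in> K" "1 = g * (\<Sum>k\<le>s. c k * x ^ k)" using assms(4) by (auto simp: inv_combination_def)
  obtain d where d: "\<And>k. d k \<in> K" "1 = g * (\<Sum>k\<le>t. d k * inverse x ^ k)" using assms(5) by (auto simp: inv_combination_def)
  define w where "w = inverse (1 - g * d 0)"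
  have w: "w \<in> K" "w * (1 - g * d 0) = 1" using u[OF d(1)] by (auto simp: w_def)
  have "(\<Sum>k\<le>t. d k * inverse x ^ k) = d 0 + (\<Sum>k\<in>{1..t}. d k * inverse x ^ k)"
    by (subst sum.remove[of _ 0]) (auto intro: sum.cong)
  then have "1 - g * d 0 = g * (\<Sum>k\<in>{1..t}. d k * inverse x ^ k)" using d(2) by (simp add: algebra_simps)
  then have 1: "1 = w * g * (\<Sum>k\<in>{1..t}. d k * inverse x ^ k)" using w(2) by (simp add: mult.assoc)
  have "x ^ s = w * g * (\<Sum>k\<in>{1..t}. d k * (inverse x ^ k * x ^ s))"
    using arg_cong[OF 1, of "\<lambda>y. y * x ^ s"] by (simp add: sum_distrib_left sum_distrib_right mult_ac)
  also have "(\<Sum>k\<in>{1..t}. d k * (inverse x ^ k * x ^ s)) = (\<Sum>k\<in>{1..t}. d k * x ^ (s - k))"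
    using \<open>x \<noteq> 0\<close> \<open>t \<le> s\<close> by (intro sum.cong) (auto simp: power_diff field_simps)
  also have "\<dots> = (\<Sum>j\<in>{s - t..s - 1}. d (s - j) * x ^ j)"
    by (rule sum.reindex_bij_witness[of _ "\<lambda>j. s - j" "\<lambda>k. s - k"]) (use \<open>t \<ge> 1\<close> \<open>t \<le> s\<close> in auto)
  also have "\<dots> = (\<Sum>j\<le>s - 1. (if j \<ge> s - t then d (s - j) else 0) * x ^ j)"
    by (rule sum.mono_neutral_cong_left) auto
  finally have xs: "x ^ s = w * g * (\<Sum>j\<le>s - 1. (if j \<ge> s - t then d (s - j) else 0) * x ^ j)" .
  define c' where "c' k = c k + c s * w * g * (if k \<ge> s - t then d (s - k) else 0)" for k
  have "(\<Sum>k\<le>s. c k * x ^ k) = (\<Sum>k\<le>s - 1. c k * x ^ k) + c s * x ^ s"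
    using \<open>t \<ge> 1\<close> \<open>t \<le> s\<close> by (cases s) auto
  also have "\<dots> = (\<Sum>k\<le>s - 1. c' k * x ^ k)"
    unfolding xs sum_distrib_left sum.distrib[symmetric]
    by (intro sum.cong) (simp_all add: c'_def algebra_simps)
  finally have "1 = g * (\<Sum>k\<le>s - 1. c' k * x ^ k)" using c(2) by simp
  moreover have "c' k \<in> K" for k unfolding c'_def using c d w g by (auto intro!: add_in mult_in)
  ultimately show ?thesis by (auto simp: inv_combination_def)
qed

text \<open>Descent on \<open>s + t\<close>: the longer relation is shortened by means of the other
  one, until one of them has degree 0 and puts \<open>inverse g\<close> into
  \<open>K\<close>.\<close>

lemma inv_combination_contradiction:
  assumes g: "g \<in> K" "inverse g \<notin> K" and u: "\<And>b. b \<in> K \<Longrightarrow> inverse (1 - g * b) \<in> K \<and> 1 - g * b \<noteq> 0"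
    and "x \<noteq> 0" "inv_combination g x s" "inv_combination g (inverse x) t"
  shows False
  using assms(4-6)
proof (induction "s + t" arbitrary: s t x rule: less_induct)
  case less
  have no0: False if y: "inv_combination g y 0" for y
  proof -
    obtain c where "c 0 \<in> K" "1 = g * (c (0::nat) :: 'a)" using y by (auto simp: inv_combination_def)
    then have "inverse g = c 0" by (metis inverse_unique)
    then show False using g(2) \<open>c 0 \<in> K\<close> by simp
  qed
  then have st: "s \<ge> 1" "t \<ge> 1" using less.prems by (metis less_one not_le)+
  show ?case
  proof (cases "t \<le> s")
    case True
    show ?thesis
      using less.hyps[of "s - 1" t x] less.prems inv_combination_reduce[OF g(1) u less.prems st(2) True] st by simp
  next
    case False
    have "inv_combination g (inverse (inverse x)) s" "inverse x \<noteq> 0" using less.prems by auto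
    then show ?thesis
      using less.hyps[of "s" "t - 1" "x"] less.prems False st
        inv_combination_reduce[OF g(1) u, of "inverse x" t s] by simp
  qed
qed

lemma adjoin_subr: "subr {poly P x | P. P \<in> polys K}"
proof
  show "1 \<in> {poly P x | P. P \<in> polys K}" using polys_1 by (force intro: exI[of _ 1])
next
  fix a b assume "a \<in> {poly P x | P. P \<in> polys K}" "b \<in> {poly P x | P. P \<in> polys K}"
  then obtain P Q where PQ: "a = poly P x" "b = poly Q x" "P \<in> polys K" "Q \<in> polys K" by auto
  show "a - b \<in> {poly P x | P. P \<in> polys K}" using PQ polys_diff[of P Q] by (force intro: exI[of _ "P - Q"])
  show "a * b \<in> {poly P x | P. P \<in> polys K}" using PQ polys_mult[of P Q] by (force intro: exI[of _ "P * Q"])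
qed

lemma adjoin_supset: "K \<subseteq> {poly P x | P. P \<in> polys K}" "x \<in> {poly P x | P. P \<in> polys K}"
proof -
  show "K \<subseteq> {poly P x | P. P \<in> polys K}"
  proof
    fix a assume "a \<in> K" then show "a \<in> {poly P x | P. P \<in> polys K}" using polys_const[of a]
      by (auto intro!: exI[of _ "[:a:]"])
  qed
  have "[:0, 1:] \<in> polys K" by (intro polys_pCons polys_const) (auto simp: one_in)
  then show "x \<in> {poly P x | P. P \<in> polys K}" by (auto intro!: exI[of _ "[:0, 1:]"])
qed

text \<open>If neither \<open>x\<close> nor \<open>inverse x\<close> lay in \<open>K\<close>, then
  by maximality adjoining either of them would produce \<open>inverse g\<close>, and the two
  resulting relations contradict each other.\<close>

lemma maximal_valring:
  assumes g: "g \<in> K" "inverse g \<notin> K"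
    and max: "\<And>L. subr L \<Longrightarrow> K \<subseteq> L \<Longrightarrow> inverse g \<notin> L \<Longrightarrow> L = K"
  shows "valring K"
proof
  have g0: "g \<noteq> 0" using g by auto
  have ad: "x \<in> K \<or> inverse g \<in> {poly P x | P. P \<in> polys K}" for x
    using max[OF adjoin_subr adjoin_supset(1), of x] adjoin_supset(2)[of x] by auto
  \<comment> \<open>If \<open>inverse u\<close> were missing from \<open>K\<close>, then
    \<open>inverse g\<close> would be a polynomial in \<open>inverse u\<close>. Clearing
    denominators makes \<open>u ^ n\<close> a multiple of \<open>g\<close>, while \<open>u\<close>
    and its powers are 1 modulo \<open>g\<close>; so \<open>g\<close> would be invertible in
    \<open>K\<close>.\<close>
  have u: "inverse (1 - g * b) \<in> K \<and> 1 - g * b \<noteq> 0" if b: "b \<in> K" for b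
  proof -
    define u where "u = 1 - g * b"
    have "g * b \<noteq> 1" using g b by (metis inverse_unique)
    then have u0: "u \<noteq> 0" by (simp add: u_def)
    have uK: "u \<in> K" using b g by (auto simp: u_def intro!: diff_in mult_in one_in)
    have "inverse g \<notin> {poly P (inverse u) | P. P \<in> polys K}"
    proof
      assume "inverse g \<in> {poly P (inverse u) | P. P \<in> polys K}"
      then obtain P where P: "P \<in> polys K" "inverse g = poly P (inverse u)" by auto
      define n where "n = degree P"
      have "u ^ n = g * (u ^ n * poly P (inverse u))" using P(2) g0 by (metis mult.left_commute mult.right_neutral right_inverse)
      also have "u ^ n * poly P (inverse u) = (\<Sum>k\<le>n. coeff P k * u ^ (n - k))"
        unfolding poly_altdef n_def sum_distrib_left
        by (intro sum.cong) (use u0 in \<open>auto simp: power_diff field_simps\<close>)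
      finally have "u ^ n = g * (\<Sum>k\<le>n. coeff P k * u ^ (n - k))" .
      moreover have "(\<Sum>k\<le>n. coeff P k * u ^ (n - k)) \<in> K" using P(1) uK
        by (auto intro!: sum_in mult_in power_in polysD)
      moreover have "\<exists>z\<in>K. u ^ n = 1 - g * z" for n
      proof (induction n)
        case 0 then show ?case by (auto intro: bexI[of _ 0])
      next
        case (Suc n)
        then obtain z where z: "z \<in> K" "u ^ n = 1 - g * z" by auto
        have "u ^ Suc n = 1 - g * (b + z - g * b * z)" using z(2) by (simp add: u_def right_diff_distrib left_diff_distrib distrib_left mult_ac)
        moreover have "b + z - g * b * z \<in> K" using b z g by (auto intro!: diff_in add_in mult_in)
        ultimately show ?case by blast
      qed
      ultimately obtain y z where "y \<in> K" "z \<in> K" "g * y = 1 - g * z" by metis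
      then have "g * (y + z) = 1" "y + z \<in> K" by (auto simp: algebra_simps add_in)
      then show False using g by (metis inverse_unique)
    qed
    then show ?thesis using ad[of "inverse u"] u0 by (auto simp: u_def)
  qed
  have comb: "\<exists>s. inv_combination g x s" if i: "inverse g \<in> {poly P x | P. P \<in> polys K}" for x
  proof -
    obtain P where P: "P \<in> polys K" "inverse g = poly P x" using i by auto
    then have "1 = g * (\<Sum>k\<le>degree P. coeff P k * x ^ k)" using g0 by (simp add: poly_altdef[symmetric] flip: P(2))
    then show ?thesis unfolding inv_combination_def using P(1) polysD by blast
  qed
  fix x assume x: "x \<notin> K"
  show "inverse x \<in> K"
  proof (rule ccontr)
    assume ix: "inverse x \<notin> K"
    have "x \<noteq> 0" using x by auto
    obtain s t where "inv_combination g x s" "inv_combination g (inverse x) t"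
      using comb[of x] comb[of "inverse x"] ad[of x] ad[of "inverse x"] x ix by blast
    then show False using inv_combination_contradiction[OF g u \<open>x \<noteq> 0\<close>] by blast
  qed
qed

lemma exists_dominating_valring:
  assumes g: "g \<in> K" "inverse g \<notin> K"
  shows "\<exists>V. valring V \<and> K \<subseteq> V \<and> inverse g \<notin> V"
proof -
  define \<A> where "\<A> = {L. subr L \<and> K \<subseteq> L \<and> inverse g \<notin> L}"
  have "K \<in> \<A>" using g subr_axioms by (auto simp: \<A>_def)
  have "\<exists>N\<in>\<A>. \<forall>B\<in>\<A>. N \<subseteq> B \<longrightarrow> B = N"
  proof (rule subset_Zorn_nonempty)
    fix \<C> assume C: "\<C> \<noteq> {}" "subset.chain \<A> \<C>"
    have sub: "\<And>L. L \<in> \<C> \<Longrightarrow> subr L \<and> K \<subseteq> L \<and> inverse g \<notin> L" using C(2) by (auto simp: subset.chain_def \<A>_def)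
    have two: "\<exists>L\<in>\<C>. x \<in> L \<and> y \<in> L" if xy: "x \<in> \<Union>\<C>" "y \<in> \<Union>\<C>" for x y
    proof -
      obtain L1 L2 where L: "L1 \<in> \<C>" "L2 \<in> \<C>" "x \<in> L1" "y \<in> L2" using xy by auto
      then have "L1 \<subseteq> L2 \<or> L2 \<subseteq> L1" using C(2) by (auto simp: subset.chain_def)
      then show ?thesis using L by blast
    qed
    have "subr (\<Union>\<C>)"
    proof
      show "1 \<in> \<Union>\<C>" using C(1) sub subr.one_in by blast
      show "x - y \<in> \<Union>\<C>" if "x \<in> \<Union>\<C>" "y \<in> \<Union>\<C>" for x y
        using two[OF that] sub subr.diff_in by blast
      show "x * y \<in> \<Union>\<C>" if "x \<in> \<Union>\<C>" "y \<in> \<Union>\<C>" for x y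
        using two[OF that] sub subr.mult_in by blast
    qed
    then show "\<Union>\<C> \<in> \<A>" using sub C(1) by (auto simp: \<A>_def)
  qed (use \<open>K \<in> \<A>\<close> in auto)
  then obtain V where V: "V \<in> \<A>" "\<And>B. B \<in> \<A> \<Longrightarrow> V \<subseteq> B \<Longrightarrow> B = V" by auto
  then interpret V: subr V by (simp add: \<A>_def)
  have "valring V" by (rule V.maximal_valring[of g]) (use V g in \<open>auto simp: \<A>_def\<close>)
  then show ?thesis using V(1) by (auto simp: \<A>_def)
qed

end

section \<open>The Carlitz module\<close>

lemma finite_field_power_card:
  fixes x :: "'a :: {field, finite}"
  shows "x ^ CARD('a) = x"
proof (cases "x = 0")
  case False
  have "(\<Prod>y\<in>UNIV - {0}. x * y) = (\<Prod>y\<in>UNIV - {0}. y)"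
    by (rule prod.reindex_bij_witness[of _ "\<lambda>y. y / x" "\<lambda>y. x * y"]) (use False in auto)
  then have "x ^ card (UNIV - {0::'a}) = 1" by (simp add: prod.distrib)
  moreover have "CARD('a) = Suc (card (UNIV - {0::'a}))" by (rule card.remove) auto
  ultimately show ?thesis by (metis power_Suc mult.right_neutral)
qed simp

lemma freshman_power:
  fixes x y :: "'a :: comm_ring_1"
  assumes "Factorial_Ring.prime p" "of_nat p = (0::'a)"
  shows "(x + y) ^ (p ^ k) = x ^ (p ^ k) + y ^ (p ^ k)"
proof -
  have "CHAR('a) dvd p" using assms(2) by (simp add: of_nat_eq_0_iff_char_dvd)
  then have "CHAR('a) = p" using assms(1) CHAR_not_1 by (auto simp: prime_nat_iff)
  then show ?thesis using freshmans_dream'[of "p ^ k" k x y] assms by simp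
qed

lemma emb_0 [simp]: "emb 0 = 0" by (simp add: emb_def Zero_fract_def[symmetric])
lemma emb_1 [simp]: "emb 1 = 1" by (simp add: emb_def One_fract_def[symmetric])
lemma emb_add [simp]: "emb (a + b) = emb a + emb b" by (simp add: emb_def to_ac_add[symmetric] del: to_ac_add)
lemma emb_mult [simp]: "emb (a * b) = emb a * emb b" by (simp add: emb_def to_ac_mult[symmetric] del: to_ac_mult)
lemma emb_diff [simp]: "emb (a - b) = emb a - emb b" by (simp add: emb_def to_ac_diff[symmetric] del: to_ac_diff)
lemma emb_power [simp]: "emb (a ^ n) = emb a ^ n" by (induction n) auto
lemma emb_of_nat [simp]: "emb (of_nat n) = of_nat n" by (induction n) auto
lemma emb_eq_iff [simp]: "emb a = emb b \<longleftrightarrow> a = b" by (simp add: emb_def eq_fract)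
lemma emb_eq_0_iff [simp]: "emb a = 0 \<longleftrightarrow> a = 0" using emb_eq_iff[of a 0] by (simp del: emb_eq_iff)
lemma to_ac_Fract: "b \<noteq> 0 \<Longrightarrow> to_ac (Fraction_Field.Fract a b) = emb a / emb b"
  by (simp add: emb_def flip: to_ac_divide)

lemma subr_baseQ: "subr (baseQ :: 'k::field qbar set)"
  by standard (auto simp: baseQ_def image_iff simp flip: to_ac_1 to_ac_diff to_ac_mult)

lemma emb_baseQ: "emb a \<in> baseQ" by (simp add: emb_def baseQ_def)
lemma subr_emb: "subr (range emb)"
  by standard (auto simp: image_iff simp flip: emb_1 emb_diff emb_mult)

lemma baseQ_cases: assumes "x \<in> baseQ" obtains a b where "b \<noteq> 0" "x = emb a / emb b"
proof -
  obtain z where "x = to_ac z" using assms by (auto simp: baseQ_def)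
  moreover obtain a b where "z = Fraction_Field.Fract a b" "b \<noteq> 0" by (cases z) auto
  ultimately show ?thesis using that to_ac_Fract by blast
qed

definition CY :: "'k::{field,finite} qbar poly" where
  "CY = [:0, emb [:0, 1:]:] + monom 1 (CARD('k))"

text \<open>The polynomial P_e of the statement; \<open>carlitz_act\<close> only knows its values,
  whereas degrees and coefficients are needed below.\<close>

definition carlitz_poly :: "'k::{field,finite} poly \<Rightarrow> 'k qbar poly" where
  "carlitz_poly e = (\<Sum>k\<le>degree e. smult (emb [:coeff e k:]) ((pcompose CY ^^ k) [:0, 1:]))"

lemma poly_CY_iter: "poly ((pcompose CY ^^ k) [:0, 1:]) \<xi> = (carlitz_Y ^^ k) \<xi>"
  by (induction k) (auto simp: poly_pcompose CY_def carlitz_Y_def poly_monom mult.commute)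

lemma poly_carlitz_poly: "poly (carlitz_poly e) \<xi> = carlitz_act e \<xi>"
  by (simp add: carlitz_poly_def carlitz_act_def poly_sum poly_CY_iter)

lemma CY_iter_emb: "(pcompose CY ^^ k) [:0, 1:] \<in> polys (range emb)"
proof -
  interpret subr "range emb" by (rule subr_emb)
  have "CY \<in> polys (range (emb :: 'a poly \<Rightarrow> _))" unfolding CY_def
    by (intro polys_add polys_pCons polys_monom polys_0) (auto simp: one_in)
  moreover have "[:0, 1:] \<in> polys (range (emb :: 'a poly \<Rightarrow> _))" by (intro polys_pCons polys_0) (auto simp: one_in)
  ultimately show ?thesis by (induction k) (auto intro: polys_pcompose)
qed

lemma carlitz_poly_emb: "carlitz_poly e \<in> polys (range emb)"
  unfolding carlitz_poly_def
  by (intro subr.polys_sum subr.polys_smult subr_emb CY_iter_emb) auto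

lemma card_UNIV_ge_2: "CARD('k::{field,finite}) \<ge> 2"
proof -
  have "card {0, 1::'k} \<le> CARD('k)" by (intro card_mono) auto
  then show ?thesis by simp
qed

lemma degree_CY: "degree (CY :: 'k::{field,finite} qbar poly) = CARD('k)"
  and lead_coeff_CY: "lead_coeff (CY :: 'k::{field,finite} qbar poly) = 1"
proof -
  have "degree [:0, emb [:0, 1:] :: 'k qbar:] < degree (monom (1::'k qbar) (CARD('k)))"
    using card_UNIV_ge_2[where 'k='k] by (simp add: degree_monom_eq)
  then show "degree (CY :: 'k qbar poly) = CARD('k)" "lead_coeff (CY :: 'k qbar poly) = 1"
    unfolding CY_def
    by (simp_all add: degree_add_eq_right lead_coeff_add_le degree_monom_eq coeff_eq_0)
qed

lemma degree_CY_iter: "degree ((pcompose CY ^^ k) [:0, 1:] :: 'k::{field,finite} qbar poly) = CARD('k) ^ k"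
  by (induction k) (auto simp: degree_pcompose degree_CY)

lemma lead_coeff_CY_iter: "lead_coeff ((pcompose CY ^^ k) [:0, 1:] :: 'k::{field,finite} qbar poly) = 1"
proof (induction k)
  case (Suc k)
  have "degree ((pcompose CY ^^ k) [:0, 1:] :: 'k qbar poly) > 0"
    unfolding degree_CY_iter using card_UNIV_ge_2[where 'k='k] by simp
  then show ?case using Suc by (simp add: lead_coeff_comp lead_coeff_CY)
qed simp

lemma carlitz_act_bound:
  assumes "degree e \<le> n"
  shows "carlitz_act e \<xi> = (\<Sum>k\<le>n. emb [:coeff e k:] * (carlitz_Y ^^ k) \<xi>)"
  unfolding carlitz_act_def
  by (rule sum.mono_neutral_left) (use assms in \<open>auto simp: coeff_eq_0\<close>)

lemma carlitz_act_0 [simp]: "carlitz_act 0 \<xi> = 0" by (simp add: carlitz_act_def)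
lemma carlitz_act_add: "carlitz_act (a + b) \<xi> = carlitz_act a \<xi> + carlitz_act b \<xi>"
proof -
  let ?n = "max (degree a) (degree b)"
  have "emb [:coeff (a + b) k:] = emb [:coeff a k:] + emb [:coeff b k:]" for k
    by (simp flip: emb_add)
  then show ?thesis
    using carlitz_act_bound[of a ?n \<xi>] carlitz_act_bound[of b ?n \<xi>] carlitz_act_bound[of "a + b" ?n \<xi>]
    by (simp add: degree_add_le_max sum.distrib distrib_right)
qed
lemma carlitz_act_smult: "carlitz_act (Polynomial.smult c a) \<xi> = emb [:c:] * carlitz_act a \<xi>"
proof -
  have "emb [:coeff (Polynomial.smult c a) k:] = emb [:c:] * emb [:coeff a k:]" for k
    by (simp flip: emb_mult)
  then show ?thesis
    using carlitz_act_bound[of "Polynomial.smult c a" "degree a" \<xi>]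
    by (simp add: carlitz_act_def sum_distrib_left mult.assoc degree_smult_le)
qed
lemma carlitz_act_uminus: "carlitz_act (- a) \<xi> = - carlitz_act a \<xi>"
  using carlitz_act_add[of a "- a" \<xi>] by (simp add: eq_neg_iff_add_eq_0 add.commute)
lemma carlitz_act_diff: "carlitz_act (a - b) \<xi> = carlitz_act a \<xi> - carlitz_act b \<xi>"
  using carlitz_act_add[of a "- b" \<xi>] carlitz_act_uminus[of b] by simp
lemma carlitz_act_const: "carlitz_act [:c:] \<xi> = emb [:c:] * \<xi>" by (simp add: carlitz_act_def)
lemma carlitz_act_1: "carlitz_act 1 \<xi> = \<xi>" by (simp add: carlitz_act_def one_pCons[symmetric])

lemma emb_const_power_card: "emb [:c::'k::{field,finite}:] ^ CARD('k) = emb [:c:]"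
proof -
  have "[:c:] ^ n = [:c ^ n:]" for n by (induction n) (auto simp: one_pCons)
  then show ?thesis by (simp add: finite_field_power_card flip: emb_power)
qed

lemma carlitz_Y_scale: "carlitz_Y (emb [:c::'k::{field,finite}:] * \<xi>) = emb [:c:] * carlitz_Y \<xi>"
  by (simp add: carlitz_Y_def power_mult_distrib emb_const_power_card distrib_left)

locale finite_char =
  fixes p \<rho> :: nat and ty :: "'k::{field,finite} itself"
  assumes p_prime: "Factorial_Ring.prime p" and card_k: "CARD('k) = p ^ \<rho>" and rho: "\<rho> \<ge> 1"
begin

text \<open>Translation by 1 permutes the field, so summing over all elements shows that
  \<open>CARD('k)\<close>, a power of \<open>p\<close>, is zero in it.\<close>

lemma of_nat_p_k: "of_nat p = (0::'k)"
proof -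
  have "(\<Sum>x\<in>UNIV. x + 1) = (\<Sum>x\<in>UNIV. x :: 'k)"
    by (rule sum.reindex_bij_witness[of _ "\<lambda>x. x - 1" "\<lambda>x. x + 1"]) auto
  then have "of_nat (CARD('k)) = (0::'k)" by (simp add: sum.distrib)
  then have "(of_nat p :: 'k) ^ \<rho> = 0" by (simp add: card_k)
  then show ?thesis by simp
qed

lemma of_nat_p_poly: "of_nat p = (0::'k poly)"
  using of_nat_p_k by (simp add: of_nat_poly)

lemma of_nat_p_qbar: "of_nat p = (0::'k qbar)"
  using arg_cong[OF of_nat_p_poly, of emb] by simp

lemma frob_poly: "(a + b :: 'k poly) ^ (p ^ k) = a ^ (p ^ k) + b ^ (p ^ k)"
  by (rule freshman_power[OF p_prime of_nat_p_poly])
lemma frob_qbar: "(a + b :: 'k qbar) ^ (p ^ k) = a ^ (p ^ k) + b ^ (p ^ k)"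
  by (rule freshman_power[OF p_prime of_nat_p_qbar])

lemma carlitz_Y_add: "carlitz_Y (x + y :: 'k qbar) = carlitz_Y x + carlitz_Y y"
  by (simp add: carlitz_Y_def card_k frob_qbar distrib_left)
lemma carlitz_Y_0: "carlitz_Y (0 :: 'k qbar) = 0"
  using carlitz_Y_add[of 0 0] by (metis add_0_right add_left_cancel)
lemma carlitz_Y_sum: "carlitz_Y (\<Sum>a\<in>A. g a :: 'k qbar) = (\<Sum>a\<in>A. carlitz_Y (g a))"
  by (induction A rule: infinite_finite_induct) (auto simp: carlitz_Y_0 carlitz_Y_add)
lemma carlitz_Y_iter_add: "(carlitz_Y ^^ n) (x + y :: 'k qbar) = (carlitz_Y ^^ n) x + (carlitz_Y ^^ n) y"
  by (induction n) (auto simp: carlitz_Y_add)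

lemma act_add: "carlitz_act e (x + y :: 'k qbar) = carlitz_act e x + carlitz_act e y"
  by (simp add: carlitz_act_def carlitz_Y_iter_add distrib_left sum.distrib)
lemma act_zero [simp]: "carlitz_act e (0 :: 'k qbar) = 0"
  using act_add[of e 0 0] by (metis add_0_right add_left_cancel)
lemma act_pCons_0: "carlitz_act (pCons 0 e) (x :: 'k qbar) = carlitz_Y (carlitz_act e x)"
proof -
  have "carlitz_act (pCons 0 e) x = (\<Sum>k\<le>Suc (degree e). emb [:coeff (pCons 0 e) k:] * (carlitz_Y ^^ k) x)"
    by (rule carlitz_act_bound) (simp add: degree_pCons_le)
  also have "\<dots> = (\<Sum>k\<le>degree e. emb [:coeff e k:] * (carlitz_Y ^^ Suc k) x)"
    by (subst sum.atMost_Suc_shift) simp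
  also have "\<dots> = carlitz_Y (carlitz_act e x)"
    by (simp add: carlitz_act_def carlitz_Y_sum carlitz_Y_scale)
  finally show ?thesis .
qed

lemma pCons_split: "pCons a e = [:a:] + pCons 0 (e :: 'k poly)" by simp

lemma act_mult: "carlitz_act (a * b) (x :: 'k qbar) = carlitz_act a (carlitz_act b x)"
proof (induction a)
  case (pCons c a)
  have "pCons c a * b = Polynomial.smult c b + pCons 0 (a * b)" by simp
  then show ?case using pCons
    by (simp only: carlitz_act_add carlitz_act_smult act_pCons_0) (subst (2) pCons_split,
       simp only: carlitz_act_add carlitz_act_const act_pCons_0)
qed simp

end

lemma card_coeffs_zero_from:
  "finite {c :: 'k::{field,finite} poly. \<forall>j\<ge>n. coeff c j = 0} \<and>
   card {c :: 'k poly. \<forall>j\<ge>n. coeff c j = 0} = CARD('k) ^ n"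
proof (induction n)
  case 0
  have "{c :: 'k poly. \<forall>j\<ge>0. coeff c j = 0} = {0}" by (auto intro: poly_eqI)
  then show ?case by simp
next
  case (Suc n)
  let ?R = "\<lambda>n. {c :: 'k poly. \<forall>j\<ge>n. coeff c j = 0}"
  have "?R (Suc n) = (\<lambda>(a, c). pCons a c) ` (UNIV \<times> ?R n)"
  proof (intro equalityI subsetI)
    fix c :: "'k poly" assume c: "c \<in> ?R (Suc n)"
    obtain a c' where "c = pCons a c'" by (cases c)
    moreover then have "c' \<in> ?R n" using c by auto
    ultimately show "c \<in> (\<lambda>(a, c). pCons a c) ` (UNIV \<times> ?R n)" by auto
  qed (auto simp: coeff_pCons split: nat.split)
  moreover have "inj_on (\<lambda>(a, c). pCons a c) (UNIV \<times> ?R n)" by (auto simp: inj_on_def)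
  ultimately show ?case using Suc by (simp add: card_image card_cartesian_product)
qed

lemma poly_prod_eqI:
  fixes P :: "'a::field poly"
  assumes "finite A" "inj_on g A" "degree P = card A" "lead_coeff P = 1" "\<And>a. a \<in> A \<Longrightarrow> poly P (g a) = 0"
  shows "P = (\<Prod>a\<in>A. [:- g a, 1:])"
proof (rule poly_eqI_degree_lead_coeff[where n = "card A" and A = "g ` A"])
  have d: "degree (\<Prod>a\<in>A. [:- g a, 1:]) = card A" by (subst degree_prod_eq_sum_degree) auto
  have "lead_coeff (\<Prod>a\<in>A. [:- g a, 1:]) = 1" by (simp add: lead_coeff_prod)
  then show "coeff P (card A) = coeff (\<Prod>a\<in>A. [:- g a, 1:]) (card A)" using assms(3,4) d by metis
  show "degree (\<Prod>a\<in>A. [:- g a, 1:]) \<le> card A" using d by simp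
  show "card A \<le> card (g ` A)" using assms by (simp add: card_image)
  show "degree P \<le> card A" using assms by simp
  show "poly P z = poly (\<Prod>a\<in>A. [:- g a, 1:]) z" if "z \<in> g ` A" for z
    using that assms by (auto simp: poly_prod prod_zero_iff)
qed

context subr
begin

lemma polys_pCons_iff: "pCons a P \<in> polys K \<longleftrightarrow> a \<in> K \<and> P \<in> polys K"
proof
  assume *: "pCons a P \<in> polys K"
  show "a \<in> K \<and> P \<in> polys K" using polysD[OF *, of 0] polysD[OF *, of "Suc _"] by (auto intro: polysI)
qed (auto intro: polys_pCons)

lemma monic_division:
  assumes "D \<in> polys K" "lead_coeff D = 1" "P \<in> polys K"
  shows "\<exists>S R. S \<in> polys K \<and> R \<in> polys K \<and> P = D * S + R \<and> (degree R < degree D \<or> R = 0)"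
  using assms(3)
proof (induction "degree P" arbitrary: P rule: less_induct)
  case less
  show ?case
  proof (cases "degree P < degree D")
    case True then show ?thesis using less.prems by (intro exI[of _ 0] exI[of _ P]) (auto simp: polys_0)
  next
    case False
    define T where "T = monom (lead_coeff P) (degree P - degree D)"
    define P' where "P' = P - D * T"
    have T: "T \<in> polys K" using less.prems by (simp add: T_def polys_monom polysD)
    have P': "P' \<in> polys K" using less.prems assms T by (simp add: P'_def polys_diff polys_mult)
    show ?thesis
    proof (cases "P' = 0")
      case True then show ?thesis using T by (intro exI[of _ T] exI[of _ 0]) (auto simp: P'_def polys_0)
    next
      case nz: False
      have "D \<noteq> 0" using assms(2) by auto
      have "P \<noteq> 0" using nz by (auto simp: P'_def T_def)
      have "degree (D * T) = degree P" using False \<open>P \<noteq> 0\<close> \<open>D \<noteq> 0\<close>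
        by (simp add: T_def degree_mult_eq degree_monom_eq)
      moreover have "lead_coeff (D * T) = lead_coeff P" using assms(2) using \<open>P \<noteq> 0\<close>
        by (simp add: T_def lead_coeff_mult degree_monom_eq)
      ultimately have "degree P' \<le> degree P" "coeff P' (degree P) = 0"
        by (auto simp: P'_def intro: degree_diff_le)
      then have "degree P' < degree P" using nz by (metis leading_coeff_0_iff le_neq_implies_less)
      then obtain S R where "S \<in> polys K" "R \<in> polys K" "P' = D * S + R" "degree R < degree D \<or> R = 0"
        using less.hyps P' by blast
      then show ?thesis using T
        by (intro exI[of _ "S + T"] exI[of _ R]) (auto simp: P'_def polys_add algebra_simps)
    qed
  qed
qed

end

context valring
begin

text \<open>If \<open>x\<close> were outside \<open>V\<close>, then \<open>inverse x\<close> would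
  lie in \<open>M\<close>, and the equation divided by the leading power of \<open>x\<close> would
  put 1 into \<open>M\<close>.\<close>

lemma integral_closed:
  assumes "P \<in> polys V" "lead_coeff P = 1" "poly P x = 0"
  shows "x \<in> V"
proof (rule ccontr)
  assume x: "x \<notin> V"
  then have x0: "x \<noteq> 0" and ix: "inverse x \<in> M" using total_V[of x] by (auto simp: M_def U_def)
  define n where "n = degree P"
  have "0 = inverse x ^ n * poly P x" using assms by simp
  also have "\<dots> = (\<Sum>k\<le>n. coeff P k * inverse x ^ (n - k))"
    unfolding poly_altdef n_def sum_distrib_left
    by (intro sum.cong) (use x0 in \<open>auto simp: power_diff field_simps\<close>)
  also have "\<dots> = 1 + (\<Sum>k\<in>{..<n}. coeff P k * inverse x ^ (n - k))"
    using assms(2) by (simp add: n_def lessThan_Suc_atMost[symmetric] add.commute)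
  finally have "(1::'a) = - (\<Sum>k\<in>{..<n}. coeff P k * inverse x ^ (n - k))" by (simp add: eq_neg_iff_add_eq_0)
  also have "\<dots> \<in> M" using assms(1) ix by (intro M_uminus M_sum V_mult_M M_power) (auto simp: polysD)
  finally show False using one_U U_not_M by blast
qed

lemma prod_roots_M:
  assumes "finite A" "\<And>a. a \<in> A \<Longrightarrow> g a \<in> M"
  shows "(\<Prod>a\<in>A. [:- g a, 1:]) - monom 1 (card A) \<in> polys M"
  using assms
proof (induction A rule: finite_induct)
  case empty then show ?case by (simp add: polys_def zero_M monom_eq_1)
next
  case (insert x A)
  let ?P = "\<Prod>a\<in>A. [:- g a, 1:]"
  have "?P \<in> polys V" using insert by (intro polys_prod polys_pCons polys_0) (auto intro: uminus_in one_in M_V)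
  moreover have "(\<Prod>a\<in>insert x A. [:- g a, 1:]) - monom 1 (card (insert x A))
    = pCons 0 (?P - monom 1 (card A)) - Polynomial.smult (g x) ?P"
    using insert.hyps by (simp add: monom_Suc algebra_simps)
  moreover have "coeff (pCons 0 (?P - monom 1 (card A)) - Polynomial.smult (g x) ?P) j \<in> M" for j
  proof -
    have "coeff (pCons 0 (?P - monom 1 (card A))) j \<in> M"
      using insert by (cases j) (auto simp: zero_M polysD simp del: coeff_diff)
    moreover have "g x * coeff ?P j \<in> M" using M_mult_V[OF _ polysD[OF \<open>?P \<in> polys V\<close>]] insert by simp
    ultimately show ?thesis using M_diff by simp
  qed
  ultimately show ?case by (metis polysI)
qed

end

section \<open>Residues modulo f, torsion points and their values\<close>

locale carlitz_tower = finite_char p \<rho> "TYPE('k)" + valring V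
  for p \<rho> :: nat and V :: "'k::{field,finite} qbar set" +
  fixes f :: "'k poly" and \<theta> :: "nat \<Rightarrow> 'k qbar" and q :: nat
  assumes p_ge_3: "p \<ge> 3"
    and irr: "Factorial_Ring.irreducible f" and monic: "lead_coeff f = 1"
    and q_def: "q = CARD('k) ^ degree f"
    and gens: "compatible_generators f \<theta>"
    and loc_V: "localized f \<subseteq> V" and f_not_unit: "inverse (emb f) \<notin> V"
begin

text \<open>Representatives of the residue classes modulo \<open>f\<close>. They form an additive
  group, which is used to shift and to negate the indices of products.\<close>

definition R :: "'k poly set" where "R = {c. degree c < degree f}"

lemma degree_f: "degree f > 0"
proof (rule ccontr)
  assume "\<not> degree f > 0"
  then have "is_unit f" using irr is_unit_iff_degree[of f] by (auto simp: irreducible_def)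
  then show False using irr by (simp add: irreducible_def)
qed

lemma f_nz: "f \<noteq> 0" using degree_f by auto
lemma prime_f: "prime_elem f" using field_poly_irreducible_imp_prime[OF irr] .

lemma R_alt: "R = {c. \<forall>j\<ge>degree f. coeff c j = 0}"
proof (intro equalityI subsetI)
  fix c :: "'k poly" assume c: "c \<in> {c. \<forall>j\<ge>degree f. coeff c j = 0}"
  show "c \<in> R"
  proof (rule ccontr)
    assume "c \<notin> R"
    then have "lead_coeff c = 0" using c by (auto simp: R_def)
    then show False using \<open>c \<notin> R\<close> degree_f by (auto simp: R_def)
  qed
qed (auto simp: R_def coeff_eq_0)

lemma finite_R: "finite R" and card_R: "card R = q"
  using card_coeffs_zero_from[of "degree f", where 'k='k] unfolding R_alt q_def by blast+
lemma zero_R: "0 \<in> R" using degree_f by (simp add: R_def)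
lemma R_diff: "a \<in> R \<Longrightarrow> b \<in> R \<Longrightarrow> a - b \<in> R" and R_add: "a \<in> R \<Longrightarrow> b \<in> R \<Longrightarrow> a + b \<in> R"
  by (auto simp: R_alt)
lemma mod_R: "a mod f \<in> R" using degree_mod_less'[of f a] f_nz degree_f
  by (cases "a mod f = 0") (auto simp: R_def)
lemma R_dvd: "c \<in> R \<Longrightarrow> f dvd c \<Longrightarrow> c = 0" using dvd_imp_degree_le[of f c] by (force simp: R_def)
lemma R_dvd_diff: "a \<in> R \<Longrightarrow> b \<in> R \<Longrightarrow> f dvd a - b \<Longrightarrow> a = b" using R_dvd[OF R_diff] by force

lemma q_power: "q = p ^ (\<rho> * degree f)" by (simp add: q_def card_k power_mult)
lemma odd_q: "odd q" using p_prime p_ge_3 prime_odd_nat[of p] by (simp add: q_power)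
lemma q_ge_3: "q \<ge> 3"
proof -
  have "\<rho> * degree f \<ge> 1" using degree_f rho by (simp add: Suc_le_eq)
  then have "p ^ 1 \<le> q" unfolding q_power using p_ge_3 by (intro power_increasing) auto
  then show ?thesis using p_ge_3 by simp
qed
lemma of_nat_q [simp]: "of_nat q = (0 :: 'k qbar)"
  using of_nat_p_qbar degree_f rho by (simp add: q_power)
lemma frob_q_poly: "(a + b :: 'k poly) ^ (q ^ k) = a ^ (q ^ k) + b ^ (q ^ k)"
  unfolding q_power power_mult[symmetric] by (rule frob_poly)
lemma frob_q_poly_diff: "(a - b :: 'k poly) ^ (q ^ k) = a ^ (q ^ k) - b ^ (q ^ k)"
  using frob_q_poly[of "a - b" b k] by simp

lemma inverse_mod: assumes "\<not> f dvd e" obtains e' where "f dvd e' * e - 1"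
proof -
  have "inj_on (\<lambda>c. (c * e) mod f) R"
  proof (rule inj_onI)
    fix a b assume ab: "a \<in> R" "b \<in> R" "(a * e) mod f = (b * e) mod f"
    then have "f dvd (a - b) * e" by (simp add: mod_eq_dvd_iff left_diff_distrib)
    then have "f dvd a - b" using prime_f assms prime_elem_dvd_mult_iff by blast
    then show "a = b" using R_dvd_diff ab by blast
  qed
  then have "(\<lambda>c. (c * e) mod f) ` R = R" by (intro endo_inj_surj finite_R) (auto simp: mod_R)
  moreover have "1 \<in> R" using degree_f by (simp add: R_def)
  ultimately have "1 \<in> (\<lambda>c. (c * e) mod f) ` R" by simp
  then obtain c where "(c * e) mod f = 1" by auto
  then have "(c * e) mod f = 1 mod f" using degree_f by (simp add: mod_poly_less)
  then show ?thesis using that[of c] by (simp add: mod_eq_dvd_iff)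
qed

lemma prime_dvd_power_f: "f dvd a ^ n \<Longrightarrow> f dvd a" using prime_f prime_elem_dvd_power by blast

lemma emb_V: "emb a \<in> V"
proof -
  have "emb a = emb a / emb 1" by simp
  moreover have "\<not> f dvd 1" using irr by (auto simp: irreducible_def)
  ultimately have "emb a \<in> localized f" unfolding localized_def by blast
  then show ?thesis using loc_V by auto
qed
lemma emb_U: assumes "\<not> f dvd e" shows "emb e \<in> U"
proof -
  have "inverse (emb e) = emb 1 / emb e" by (simp add: field_simps)
  then have "inverse (emb e) \<in> localized f" unfolding localized_def using assms by fast
  then show ?thesis using loc_V emb_V assms by (auto simp: U_def)
qed
lemma f_M: "emb f \<in> M" using f_not_unit emb_V f_nz M_iff by auto
lemma emb_f_nz: "emb f \<noteq> 0" using f_nz by simp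
lemma emb_M: "f dvd e \<Longrightarrow> emb e \<in> M" using M_mult_V[OF f_M emb_V] by auto
lemma emb_M_iff: "emb e \<in> M \<longleftrightarrow> f dvd e"
  using emb_M[of e] emb_U[of e] U_not_M[of "emb e"] by argo

lemma f_power_decompose: "a \<noteq> 0 \<Longrightarrow> \<exists>n a'. a = f ^ n * a' \<and> \<not> f dvd a'"
proof (induction "degree a" arbitrary: a rule: less_induct)
  case less
  show ?case
  proof (cases "f dvd a")
    case True
    then obtain b where b: "a = f * b" by blast
    then have "degree b < degree a" "b \<noteq> 0" using less.prems degree_f f_nz by (auto simp: degree_mult_eq)
    then obtain n a' where "b = f ^ n * a'" "\<not> f dvd a'" using less.hyps by blast
    then show ?thesis using b by (intro exI[of _ "Suc n"] exI[of _ a']) simp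
  qed (auto intro: exI[of _ 0])
qed

lemma emb_veq: "\<not> f dvd a \<Longrightarrow> veq (emb f) (int n) (emb (f ^ n * a))"
proof -
  assume a: "\<not> f dvd a"
  have "veq (emb f) (int n * 1 + 0) (emb f ^ n * emb a)"
    by (intro veq_mult veq_power veq_self f_M emb_f_nz) (use a emb_U in \<open>auto simp: veq_0_iff\<close>)
  then show ?thesis by simp
qed

text \<open>On the base field every value is an integral multiple of that of \<open>f\<close>; all
  later arguments with residues of values rest on this.\<close>

lemma baseQ_veq: assumes "x \<in> baseQ" "x \<noteq> 0" obtains k where "veq (emb f) k x"
proof -
  have *: "\<exists>k. veq (emb f) k (emb a)" if "a \<noteq> 0" for a
    using f_power_decompose[OF that] emb_veq by blast
  obtain a b where ab: "b \<noteq> 0" "x = emb a / emb b" using baseQ_cases assms(1) by blast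
  then have "a \<noteq> 0" using assms(2) by auto
  then show ?thesis using that * ab veq_divide[OF f_M emb_f_nz] by metis
qed

lemma carlitz_poly_V: "carlitz_poly e \<in> polys V"
  using carlitz_poly_emb[of e] polys_mono[of "range emb" V] emb_V by auto

lemma carlitz_poly_baseQ: "carlitz_poly e \<in> polys baseQ"
  using carlitz_poly_emb[of e] polys_mono[of "range emb" baseQ] emb_baseQ by auto

lemma act_V: "x \<in> V \<Longrightarrow> carlitz_act e x \<in> V"
  using poly_in[OF carlitz_poly_V] by (simp add: poly_carlitz_poly)

lemma CY_iter_linear_part: "\<exists>Q\<in>polys (range emb). (pcompose CY ^^ k) [:0, 1:] = pCons 0 (Q :: 'k qbar poly) \<and> coeff Q 0 = emb ([:0, 1:] ^ k)"
proof (induction k)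
  case 0
  interpret E: subr "range (emb :: 'k poly \<Rightarrow> _)" by (rule subr_emb)
  show ?case by (intro bexI[of _ 1]) (auto simp: E.polys_1 one_pCons[symmetric])
next
  case (Suc k)
  interpret E: subr "range (emb :: 'k poly \<Rightarrow> _)" by (rule subr_emb)
  obtain Q where Q: "Q \<in> polys (range emb)" "(pcompose CY ^^ k) [:0, 1:] = pCons 0 (Q :: 'k qbar poly)"
    "coeff Q 0 = emb ([:0, 1:] ^ k)" using Suc by blast
  define Q' where "Q' = Polynomial.smult (emb [:0, 1:]) Q + pCons 0 Q ^ (CARD('k) - 1) * Q"
  have r: "CARD('k) = Suc (CARD('k) - 1)" "CARD('k) - 1 > 0" using card_UNIV_ge_2[where 'k='k] by auto
  have "pcompose (monom 1 n) (P::'k qbar poly) = P ^ n" for n P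
    by (induction n) (auto simp: monom_Suc pcompose_pCons pcompose_1)
  then have "pcompose CY (pCons 0 Q) = pCons 0 Q * [:emb [:0, 1:]:] + pCons 0 Q ^ CARD('k)"
    by (simp add: CY_def pcompose_add pcompose_pCons)
  also have "pCons 0 Q ^ CARD('k) = pCons 0 Q ^ (CARD('k) - 1) * pCons 0 Q"
    by (subst r(1)) (simp only: power_Suc mult.commute)
  also have "pCons 0 Q * [:emb [:0, 1:]:] + pCons 0 Q ^ (CARD('k) - 1) * pCons 0 Q = pCons 0 Q'"
    by (simp add: Q'_def)
  finally have "(pcompose CY ^^ Suc k) [:0, 1:] = pCons 0 Q'" using Q(2) by simp
  moreover have "Q' \<in> polys (range emb)" unfolding Q'_def using Q(1)
    by (intro E.polys_add E.polys_smult E.polys_mult E.polys_power E.polys_pCons) auto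
  moreover have "emb ([:0, 1:] ^ Suc k) = emb [:0, 1:] * emb ([:0, 1 :: 'k:] ^ k)"
    by (simp only: power_Suc emb_mult)
  then have "coeff Q' 0 = emb ([:0, 1:] ^ Suc k)" using Q(3) r(2)
    by (simp add: Q'_def coeff_mult_0 coeff_0_power zero_power)
  ultimately show ?case by blast
qed

lemma carlitz_poly_linear_part:
  fixes e :: "'k poly"
  obtains Q where "Q \<in> polys (range emb)" "carlitz_poly e = pCons 0 Q" "coeff Q 0 = emb e"
proof -
  interpret E: subr "range (emb :: 'k poly \<Rightarrow> _)" by (rule subr_emb)
  obtain Q where Q: "\<And>k. Q k \<in> polys (range emb)"
    "\<And>k. (pcompose CY ^^ k) [:0, 1:] = pCons 0 (Q k :: 'k qbar poly)" "\<And>k. coeff (Q k) 0 = emb ([:0, 1:] ^ k)"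
    using CY_iter_linear_part by metis
  define S where "S = (\<Sum>k\<le>degree e. Polynomial.smult (emb [:coeff e k:]) (Q k))"
  have "pCons 0 (\<Sum>k\<in>A. g k) = (\<Sum>k\<in>A. pCons 0 (g k))" for A and g :: "nat \<Rightarrow> 'k qbar poly"
    by (rule poly_eqI) (simp add: coeff_sum coeff_pCons split: nat.split)
  then have "carlitz_poly e = pCons 0 S" by (simp add: carlitz_poly_def Q(2) S_def)
  moreover have "S \<in> polys (range emb)" unfolding S_def by (intro E.polys_sum E.polys_smult Q) auto
  moreover have "coeff S 0 = emb e"
  proof -
    have h: "emb (sum g A) = (\<Sum>k\<in>A. emb (g k))" for A and g :: "nat \<Rightarrow> 'k poly"
      by (induction A rule: infinite_finite_induct) auto
    have "coeff S 0 = (\<Sum>k\<le>degree e. emb ([:coeff e k:] * [:0, 1:] ^ k))"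
      by (simp only: S_def coeff_sum coeff_smult Q(3) emb_mult emb_power)
    also have "\<dots> = emb (\<Sum>k\<le>degree e. [:coeff e k:] * [:0, 1:] ^ k)" by (simp add: h)
    also have "(\<Sum>k\<le>degree e. [:coeff e k:] * [:0, 1:] ^ k) = (\<Sum>k\<le>degree e. monom (coeff e k) k)"
      by (simp add: monom_altdef)
    finally show ?thesis by (simp add: poly_as_sum_of_monoms)
  qed
  ultimately show ?thesis using that by blast
qed

text \<open>The linear coefficient of P_e is \<open>e\<close>. For \<open>x\<close> in
  \<open>M\<close> and \<open>e\<close> prime to \<open>f\<close> the second factor is a unit, so
  \<open>x\<close> and its image have the same value.\<close>

lemma act_expand: assumes "x \<in> V" obtains z where "z \<in> V" "carlitz_act e x = x * (emb e + x * z)"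
proof -
  obtain Q where Q: "Q \<in> polys (range emb)" "carlitz_poly e = pCons 0 Q" "coeff Q 0 = emb e"
    using carlitz_poly_linear_part .
  obtain a Q' where Q': "Q = pCons a Q'" by (cases Q)
  have "Q \<in> polys V" using Q(1) polys_mono[of "range emb" V] emb_V by auto
  then have "Q' \<in> polys V" using Q' polys_pCons_iff by simp
  then show ?thesis using that[of "poly Q' x"] Q Q' assms poly_in by (simp flip: poly_carlitz_poly)
qed

lemma degree_carlitz_poly_f: "degree (carlitz_poly f) = q"
  and lead_coeff_carlitz_poly_f: "lead_coeff (carlitz_poly f) = 1"
proof -
  define L where "L = (\<Sum>k<degree f. Polynomial.smult (emb [:coeff f k:]) ((pcompose CY ^^ k) [:0, 1:] :: 'k qbar poly))"
  let ?H = "(pcompose CY ^^ degree f) [:0, 1:] :: 'k qbar poly"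
  have c: "carlitz_poly f = L + ?H"
    unfolding carlitz_poly_def L_def using monic
    by (simp add: lessThan_Suc_atMost[symmetric] one_pCons[symmetric])
  have "degree L \<le> CARD('k) ^ (degree f - 1)" unfolding L_def
  proof (rule degree_sum_le)
    fix k assume "k \<in> {..<degree f}"
    then have "CARD('k) ^ k \<le> CARD('k) ^ (degree f - 1)" by (intro power_increasing) (auto simp: Suc_le_eq)
    then show "degree (Polynomial.smult (emb [:coeff f k:]) ((pcompose CY ^^ k) [:0, 1:] :: 'k qbar poly))
      \<le> CARD('k) ^ (degree f - 1)" by (intro order.trans[OF degree_smult_le]) (simp add: degree_CY_iter)
  qed auto
  also have "\<dots> < CARD('k) ^ degree f" using degree_f card_UNIV_ge_2[where 'k='k] by (intro power_strict_increasing) auto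
  finally have d: "degree L < degree ?H" by (simp only: degree_CY_iter)
  then show "degree (carlitz_poly f) = q" unfolding c
    by (simp add: degree_add_eq_right degree_CY_iter q_def)
  show "lead_coeff (carlitz_poly f) = 1" unfolding c using d lead_coeff_CY_iter[of "degree f", where 'k='k]
    by (simp add: degree_add_eq_right coeff_eq_0)
qed

text \<open>\<open>Pf\<close> is \<open>P_f(X) / X\<close>.\<close>
definition Pf :: "'k qbar poly" where "Pf = (THE Q. carlitz_poly f = pCons 0 Q)"

lemma carlitz_poly_f: "carlitz_poly f = pCons 0 Pf" and Pf_emb: "Pf \<in> polys (range emb)"
  and Pf_0: "coeff Pf 0 = emb f"
proof -
  obtain Q where Q: "Q \<in> polys (range emb)" "carlitz_poly f = pCons 0 Q" "coeff Q 0 = emb f"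
    using carlitz_poly_linear_part .
  then have "Pf = Q" by (auto simp: Pf_def)
  then show "carlitz_poly f = pCons 0 Pf" "Pf \<in> polys (range emb)" "coeff Pf 0 = emb f" using Q by auto
qed

lemma act_f: "carlitz_act f x = x * poly Pf x"
  using poly_carlitz_poly[of f x] by (simp add: carlitz_poly_f)
lemma degree_Pf: "degree Pf = q - 1"
proof -
  have "Pf \<noteq> 0" using Pf_0 emb_f_nz by auto
  then show ?thesis using degree_carlitz_poly_f by (simp add: carlitz_poly_f)
qed
lemma lead_coeff_Pf: "lead_coeff Pf = 1"
proof -
  have "Pf \<noteq> 0" using Pf_0 emb_f_nz by auto
  then show ?thesis using lead_coeff_carlitz_poly_f by (simp add: carlitz_poly_f)
qed

lemma gens1: "n \<ge> 1 \<Longrightarrow> carlitz_act (f ^ n) \<xi> = 0 \<longleftrightarrow> \<xi> \<in> range (\<lambda>e. carlitz_act e (\<theta> n))"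
  using gens unfolding compatible_generators_def carlitz_annihilator_def by blast
lemma act_f_theta: "n \<ge> 1 \<Longrightarrow> carlitz_act f (\<theta> (Suc n)) = \<theta> n"
  using gens unfolding compatible_generators_def by blast

lemma torsion_theta: assumes "n \<ge> 1" shows "carlitz_act (f ^ n) (\<theta> n) = 0"
proof -
  have "\<theta> n = carlitz_act 1 (\<theta> n)" by (simp add: carlitz_act_1)
  then show ?thesis using gens1[OF assms] by blast
qed

text \<open>P_f(X) / X has a root in the closure, nonzero because its constant term is
  \<open>f\<close>; so the torsion generated by \<open>\<theta> 1\<close> is not trivial.\<close>

lemma theta_1_nz: "\<theta> 1 \<noteq> 0"
proof
  assume t: "\<theta> 1 = 0"
  have "degree Pf > 0" using q_ge_3 by (simp add: degree_Pf)
  then obtain z where z: "poly Pf z = 0" using alg_closed_imp_poly_has_root by blast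
  then have "z \<noteq> 0" using Pf_0 emb_f_nz by (auto simp: poly_0_coeff_0)
  moreover have "carlitz_act (f ^ 1) z = 0" using z by (simp add: act_f)
  then have "z = 0" using gens1[of 1 z] t by auto
  ultimately show False by simp
qed

lemma act_f_power_theta: "n \<ge> 1 \<Longrightarrow> carlitz_act (f ^ k) (\<theta> (n + k)) = \<theta> n"
proof (induction k)
  case (Suc k)
  then show ?case using act_f_theta[of "n + k"] by (simp add: act_mult mult.commute[of f])
qed (simp add: carlitz_act_1)

lemma act_coprime_nz: assumes "\<not> f dvd e" "x \<noteq> 0" "carlitz_act f x = 0" shows "carlitz_act e x \<noteq> 0"
proof
  assume e: "carlitz_act e x = 0"
  obtain e' k where "e' * e - 1 = f * k" using inverse_mod[OF assms(1)] by blast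
  then have "1 = e' * e - k * f" by (simp add: algebra_simps)
  then have "carlitz_act 1 x = carlitz_act e' (carlitz_act e x) - carlitz_act k (carlitz_act f x)"
    by (metis carlitz_act_diff act_mult)
  then show False using e assms by (simp add: carlitz_act_1)
qed

lemma act_f_theta_1: "carlitz_act f (\<theta> 1) = 0" using torsion_theta[of 1] by simp

text \<open>Factors \<open>f\<close> are split off from \<open>e\<close> one at a time: acting with
  the complementary power of \<open>f\<close> brings \<open>\<theta> n\<close> down to
  \<open>\<theta> 1\<close>, which is not killed by anything prime to \<open>f\<close>.\<close>

lemma act_theta_eq_0_iff: assumes "n \<ge> 1" shows "carlitz_act e (\<theta> n) = 0 \<longleftrightarrow> f ^ n dvd e"
proof
  assume "f ^ n dvd e"
  then obtain k where "e = k * f ^ n" by (auto simp: dvd_def mult.commute)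
  then show "carlitz_act e (\<theta> n) = 0" using torsion_theta[OF assms] by (simp add: act_mult)
next
  assume e: "carlitz_act e (\<theta> n) = 0"
  have "f ^ k dvd e" if "k \<le> n" for k using that
  proof (induction k)
    case (Suc k)
    then obtain e' where e': "e = f ^ k * e'" by auto
    have "carlitz_act (f ^ (n - 1 - k)) (carlitz_act e (\<theta> n)) = 0" using e by simp
    then have "carlitz_act (e' * f ^ (n - 1)) (\<theta> n) = 0" unfolding e'
      using Suc.prems by (simp flip: act_mult power_add add: mult.assoc[symmetric] mult.commute[of e'])
    moreover have "carlitz_act (f ^ (n - 1)) (\<theta> n) = \<theta> 1" using act_f_power_theta[of 1 "n - 1"] assms by simp
    ultimately have "carlitz_act e' (\<theta> 1) = 0" by (simp add: act_mult)
    then have "f dvd e'" using act_coprime_nz[OF _ theta_1_nz act_f_theta_1] by blast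
    then show ?case using e' by (auto simp: mult_dvd_mono mult.commute[of f])
  qed simp
  then show "f ^ n dvd e" by blast
qed

lemma act_theta_eq_iff: "n \<ge> 1 \<Longrightarrow> carlitz_act a (\<theta> n) = carlitz_act b (\<theta> n) \<longleftrightarrow> f ^ n dvd a - b"
  using act_theta_eq_0_iff[of n "a - b"] by (simp add: carlitz_act_diff)

lemma inj_act_theta_1: "inj_on (\<lambda>c. carlitz_act c (\<theta> 1)) R"
  by (rule inj_onI) (use act_theta_eq_iff[of 1] R_dvd_diff in auto)

lemma carlitz_poly_f_prod: "carlitz_poly f = (\<Prod>c\<in>R. [:- carlitz_act c (\<theta> 1), 1:])"
proof (rule poly_prod_eqI[OF finite_R inj_act_theta_1])
  show "poly (carlitz_poly f) (carlitz_act c (\<theta> 1)) = 0" for c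
    using act_f_theta_1 by (simp add: poly_carlitz_poly act_mult[symmetric] mult.commute[of f]) (simp add: act_mult)
qed (auto simp: card_R degree_carlitz_poly_f lead_coeff_carlitz_poly_f[unfolded degree_carlitz_poly_f])

lemma prod_torsion: "carlitz_act f x = (\<Prod>c\<in>R. x + carlitz_act c (\<theta> 1))"
proof -
  have "carlitz_act f x = (\<Prod>c\<in>R. x - carlitz_act c (\<theta> 1))"
    by (simp add: carlitz_poly_f_prod poly_prod flip: poly_carlitz_poly)
  also have "\<dots> = (\<Prod>c\<in>R. x + carlitz_act c (\<theta> 1))"
    by (rule prod.reindex_bij_witness[of _ uminus uminus]) (auto simp: carlitz_act_uminus R_def)
  finally show ?thesis .
qed

lemma Pf_prod: "Pf = (\<Prod>c\<in>R - {0}. [:- carlitz_act c (\<theta> 1), 1:])"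
proof -
  have "pCons 0 Pf = [:0, 1:] * (\<Prod>c\<in>R - {0}. [:- carlitz_act c (\<theta> 1), 1:])"
    using carlitz_poly_f_prod zero_R finite_R by (simp add: carlitz_poly_f prod.remove[of R 0])
  then show ?thesis by simp
qed

lemma theta_1_V: "\<theta> 1 \<in> V"
proof (rule integral_closed[OF carlitz_poly_V[of f] lead_coeff_carlitz_poly_f])
  show "poly (carlitz_poly f) (\<theta> 1) = 0" using act_f_theta_1 by (simp add: poly_carlitz_poly)
qed

lemma not_dvd_R: "c \<in> R - {0} \<Longrightarrow> \<not> f dvd c" using R_dvd by auto

text \<open>The nonzero torsion points are images of one another under the module action, so if
  \<open>\<theta> 1\<close> were a unit of \<open>V\<close>, all of them would be. But the product
  of their negatives is P_f(X) / X at 0, that is \<open>f\<close>, which lies in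
  \<open>M\<close>.\<close>

lemma torsion_M: "carlitz_act c (\<theta> 1) \<in> M"
proof -
  have "\<theta> 1 \<in> M"
  proof (rule ccontr)
    assume "\<theta> 1 \<notin> M"
    then have tU: "\<theta> 1 \<in> U" using theta_1_V by (simp add: M_def)
    have u: "- carlitz_act c (\<theta> 1) \<in> U" if c: "c \<in> R - {0}" for c
    proof (rule ccontr)
      assume "- carlitz_act c (\<theta> 1) \<notin> U"
      then have m: "carlitz_act c (\<theta> 1) \<in> M" using U_uminus act_V[OF theta_1_V] by (auto simp: M_def)
      obtain e' where e': "f dvd e' * c - 1" using inverse_mod not_dvd_R c by blast
      then have "carlitz_act (e' * c) (\<theta> 1) = carlitz_act 1 (\<theta> 1)" using act_theta_eq_iff[of 1] by simp
      then have "\<theta> 1 = carlitz_act e' (carlitz_act c (\<theta> 1))" by (simp add: act_mult carlitz_act_1)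
      moreover obtain z where "z \<in> V" "carlitz_act e' (carlitz_act c (\<theta> 1)) = carlitz_act c (\<theta> 1) * (emb e' + carlitz_act c (\<theta> 1) * z)"
        using act_expand[OF act_V[OF theta_1_V]] by metis
      ultimately have "\<theta> 1 \<in> M" using M_mult_V[OF m] add_in mult_in emb_V act_V[OF theta_1_V] by metis
      then show False using tU U_not_M by blast
    qed
    have "emb f = poly Pf 0" by (simp add: poly_0_coeff_0 Pf_0)
    also have "\<dots> = (\<Prod>c\<in>R - {0}. - carlitz_act c (\<theta> 1))" by (simp add: Pf_prod poly_prod)
    also have "\<dots> \<in> U" by (rule U_prod) (rule u)
    finally have "emb f \<in> U" .
    then show False using f_M U_not_M by blast
  qed
  then show ?thesis using act_expand[OF theta_1_V, of c] M_mult_V[of "\<theta> 1"] emb_V theta_1_V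
    by (metis add_in mult_in)
qed

text \<open>All nonzero \<open>f\<close>-torsion points lie in \<open>M\<close>, so the coefficients of \<open>P_f(X) / X\<close>, a product of factors
  \<open>X - \<lambda>\<close>, below the leading one lie in \<open>M\<close> and hence are divisible by \<open>f\<close>.\<close>
lemma Pf_form: obtains s where "s \<in> polys V" "Pf = monom 1 (q - 1) + Polynomial.smult (emb f) s" "coeff s 0 = 1"
proof -
  have "card (R - {0}) = q - 1" using card_R zero_R finite_R by simp
  then have m: "Pf - monom 1 (q - 1) \<in> polys M"
    using prod_roots_M[of "R - {0}" "\<lambda>c. carlitz_act c (\<theta> 1)"] finite_R torsion_M by (simp add: Pf_prod)
  interpret E: subr "range (emb :: 'k poly \<Rightarrow> _)" by (rule subr_emb)
  have e: "Pf - monom 1 (q - 1) \<in> polys (range emb)" by (intro E.polys_diff E.polys_monom Pf_emb E.one_in)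
  define s where "s = Polynomial.smult (inverse (emb f)) (Pf - monom 1 (q - 1))"
  have "coeff s j \<in> V" for j
  proof -
    obtain a where a: "coeff (Pf - monom 1 (q - 1)) j = emb a" using polysD[OF e] by blast
    then have "f dvd a" using polysD[OF m, of j] emb_M_iff by simp
    then obtain b where "a = f * b" by blast
    then have "coeff s j = emb b" using a emb_f_nz by (simp add: s_def del: coeff_diff)
    then show ?thesis using emb_V by simp
  qed
  then have "s \<in> polys V" by (rule polysI)
  moreover have "Pf = monom 1 (q - 1) + Polynomial.smult (emb f) s" using emb_f_nz by (simp add: s_def)
  moreover have "coeff s 0 = 1" using q_ge_3 Pf_0 emb_f_nz by (simp add: s_def)
  ultimately show ?thesis using that by blast
qed

text \<open>The factor s(x) in P_f(x) = x^q + f x s(x). By \<open>Pf_form\<close>, s is a polynomial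
  over \<open>V\<close> with constant term 1, hence a unit on \<open>M\<close>.\<close>

definition sf :: "'k qbar \<Rightarrow> 'k qbar" where
  "sf x = (poly Pf x - x ^ (q - 1)) / emb f"

lemma act_f_sf: "carlitz_act f x = x ^ q + emb f * x * sf x"
proof -
  have "x ^ q = x * x ^ (q - 1)" using q_ge_3 by (simp flip: power_Suc)
  then show ?thesis using emb_f_nz by (simp add: act_f sf_def algebra_simps)
qed

lemma sf_M: assumes "x \<in> M" shows "sf x - 1 \<in> M"
proof -
  obtain s where s: "s \<in> polys V" "Pf = monom 1 (q - 1) + Polynomial.smult (emb f) s" "coeff s 0 = 1"
    using Pf_form .
  obtain a s' where s': "s = pCons a s'" by (cases s)
  have "sf x = poly s x" using emb_f_nz by (simp add: sf_def s(2) poly_monom)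
  then have "sf x - 1 = x * poly s' x" using s' s(3) by simp
  moreover have "poly s' x \<in> V" using s(1) s' polys_pCons_iff poly_in M_V assms by simp
  ultimately show ?thesis using M_mult_V assms by simp
qed

lemma sf_U: "x \<in> M \<Longrightarrow> sf x \<in> U" using U_add_M[OF one_U sf_M] by force

text \<open>For positive \<open>n\<close> the number of units modulo \<open>f ^ n\<close>, which is
  to be both the degree of the field of \<open>\<theta> n\<close> and its ramification index at
  \<open>f\<close>.\<close>

definition N :: "nat \<Rightarrow> nat" where "N n = (q - 1) * q ^ (n - 1)"

lemma N_Suc: "n \<ge> 1 \<Longrightarrow> N (Suc n) = q * N n" by (cases n) (auto simp: N_def)
lemma N_pos: "N n > 0" using q_ge_3 by (simp add: N_def)
lemma theta_base: "\<theta> 1 \<in> M \<and> veq (\<theta> 1) (int (N 1)) (emb f)"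
proof -
  have tM: "\<theta> 1 \<in> M" using torsion_M[of 1] by (simp add: carlitz_act_1)
  have "poly Pf (\<theta> 1) = 0" using act_f_theta_1 theta_1_nz by (simp add: act_f)
  then have "emb f * sf (\<theta> 1) = - (\<theta> 1 ^ (q - 1))" using emb_f_nz by (simp add: sf_def)
  then have "emb f = - (\<theta> 1 ^ (q - 1)) / sf (\<theta> 1)" using sf_U[OF tM] U_nz by (metis nonzero_mult_div_cancel_right)
  moreover have "veq (\<theta> 1) (int (q - 1) * 1 - 0) (- (\<theta> 1 ^ (q - 1)) / sf (\<theta> 1))"
    using sf_U[OF tM] by (intro veq_divide veq_uminus veq_power veq_self tM theta_1_nz) (auto simp: veq_0_iff)
  ultimately show ?thesis using tM by (simp add: N_def)
qed

text \<open>In P_f(x) = x^q + f x s(x) with x = \<open>\<theta> (Suc n)\<close>, the second term has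
  higher value than \<open>\<theta> n\<close>: the factor \<open>f\<close> is divisible by
  \<open>\<theta> n\<close>, and x turns out to lie in \<open>M\<close>.\<close>

lemma theta_step:
  assumes n: "n \<ge> 1" and t: "\<theta> n \<in> M" "\<theta> n \<noteq> 0" and v: "veq (\<theta> n) (int (N n)) (emb f)"
  shows "\<theta> (Suc n) \<in> M \<and> \<theta> (Suc n) \<noteq> 0 \<and> veq (\<theta> (Suc n)) (int q) (\<theta> n)"
proof -
  let ?t = "\<theta> (Suc n)"
  have eq: "?t ^ q + emb f * ?t * sf ?t = \<theta> n" using act_f_theta[OF n] by (simp add: act_f_sf)
  have nz: "?t \<noteq> 0" using act_f_theta[OF n] t by auto
  have "carlitz_poly f - [:\<theta> n:] \<in> polys V" by (intro polys_diff carlitz_poly_V polys_const M_V t)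
  moreover have "lead_coeff (carlitz_poly f - [:\<theta> n:]) = 1"
  proof -
    have "degree (carlitz_poly f - [:\<theta> n:]) = q"
      unfolding diff_conv_add_uminus
      using degree_add_eq_left[of "- [:\<theta> n:]" "carlitz_poly f"] degree_carlitz_poly_f q_ge_3 by simp
    then show ?thesis using lead_coeff_carlitz_poly_f degree_carlitz_poly_f q_ge_3
      by (simp add: coeff_pCons split: nat.split)
  qed
  moreover have "poly (carlitz_poly f - [:\<theta> n:]) ?t = 0" using act_f_theta[OF n] by (simp add: poly_carlitz_poly)
  ultimately have tV: "?t \<in> V" by (rule integral_closed)
  have "s \<in> V" if "s = sf ?t" for s
  proof -
    obtain s' where s': "s' \<in> polys V" "Pf = monom 1 (q - 1) + Polynomial.smult (emb f) s'" using Pf_form .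
    then have "sf ?t = poly s' ?t" using emb_f_nz by (simp add: sf_def poly_monom)
    then show ?thesis using that s' poly_in tV by simp
  qed
  then have "?t ^ q \<in> M" using M_diff[OF t(1) M_mult_V[OF M_mult_V[OF f_M tV], of "sf ?t"]] eq
    by (simp add: eq_diff_eq[symmetric])
  then have tM: "?t \<in> M" using M_powerD tV by blast
  define u where "u = 1 - emb f / \<theta> n * (?t * sf ?t)"
  have fV: "emb f / \<theta> n \<in> V"
  proof -
    have "veq (\<theta> n) (int (N n) - 1) (emb f / \<theta> n)" by (rule veq_divide[OF t v veq_self[OF t]])
    then have "vge (\<theta> n) 0 (emb f / \<theta> n)" using veq_vge_iff[OF t] N_pos[of n] by force
    then show ?thesis by (simp add: vge_0_iff)
  qed
  have uU: "u \<in> U" unfolding u_def using fV tM sf_U[OF tM]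
    by (intro U_diff_M one_U V_mult_M M_mult_V) (auto intro: U_V)
  have "?t ^ q = \<theta> n * u" using eq t by (simp add: u_def field_simps)
  then have "\<theta> n = ?t ^ q / u" using uU U_nz by (metis nonzero_mult_div_cancel_right)
  moreover have "veq ?t (int q * 1 - 0) (?t ^ q / u)"
    by (intro veq_divide veq_power veq_self tM nz) (use uU in \<open>auto simp: veq_0_iff\<close>)
  ultimately show ?thesis using tM nz by simp
qed

lemma theta_all: "n \<ge> 1 \<Longrightarrow> \<theta> n \<in> M \<and> \<theta> n \<noteq> 0 \<and> veq (\<theta> n) (int (N n)) (emb f)"
proof (induction n rule: nat_induct_at_least)
  case base then show ?case using theta_base theta_1_nz by simp
next
  case (Suc n)
  then have s: "\<theta> (Suc n) \<in> M" "\<theta> (Suc n) \<noteq> 0" "veq (\<theta> (Suc n)) (int q) (\<theta> n)" using theta_step by auto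
  have "veq (\<theta> (Suc n)) (int q * int (N n)) (emb f)" using veq_trans[OF s(1,2,3)] Suc by blast
  then show ?case using s N_Suc[of n] Suc.hyps by simp
qed

lemma theta_M: "n \<ge> 1 \<Longrightarrow> \<theta> n \<in> M" and theta_nz: "n \<ge> 1 \<Longrightarrow> \<theta> n \<noteq> 0"
  and theta_f: "n \<ge> 1 \<Longrightarrow> veq (\<theta> n) (int (N n)) (emb f)"
  using theta_all by auto
lemma theta_V: "n \<ge> 1 \<Longrightarrow> \<theta> n \<in> V" using theta_M M_V by blast
lemma theta_Suc: "n \<ge> 1 \<Longrightarrow> veq (\<theta> (Suc n)) (int q) (\<theta> n)"
  using theta_step theta_M theta_nz theta_f by blast

text \<open>Both \<open>\<theta> 1\<close> and its image \<open>l\<close> under \<open>e\<close> are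
  nonzero \<open>f\<close>-torsion points, so their powers with exponent \<open>q - 1\<close> are
  \<open>- emb f\<close> times values of \<open>sf\<close>, which are 1 modulo \<open>M\<close>. As
  \<open>l / \<theta> 1\<close> is \<open>e\<close> modulo \<open>M\<close>, the power of
  \<open>e\<close> is 1 modulo \<open>M\<close>, hence modulo \<open>f\<close>.\<close>

lemma fermat: assumes "\<not> f dvd e" shows "f dvd e ^ (q - 1) - 1"
proof -
  let ?t = "\<theta> 1"
  have t: "?t \<in> M" "?t \<noteq> 0" using theta_M theta_nz by auto
  define l where "l = carlitz_act e ?t"
  have l: "l \<in> M" "l \<noteq> 0" unfolding l_def using torsion_M act_coprime_nz[OF assms theta_1_nz act_f_theta_1] by auto
  have "carlitz_act f l = 0" using act_f_theta_1 unfolding l_def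
    by (simp add: act_mult[symmetric] mult.commute[of f]) (simp add: act_mult)
  have p: "x ^ (q - 1) = - emb f * sf x" if "x \<noteq> 0" "carlitz_act f x = 0" for x
    using that emb_f_nz by (simp add: sf_def act_f)
  obtain z where z: "z \<in> V" "l = ?t * (emb e + ?t * z)" using act_expand[OF theta_1_V] l_def by metis
  have "(emb e + ?t * z) ^ (q - 1) = (l / ?t) ^ (q - 1)" using z t by simp
  also have "\<dots> = sf l / sf ?t" using p[OF l(2) \<open>carlitz_act f l = 0\<close>] p[OF t(2) act_f_theta_1] emb_f_nz
    by (simp add: power_divide)
  finally have 1: "(emb e + ?t * z) ^ (q - 1) = sf l / sf ?t" .
  have "sf l / sf ?t - 1 = ((sf l - 1) - (sf ?t - 1)) * inverse (sf ?t)"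
    using sf_U[OF t(1)] U_nz by (simp add: field_simps)
  also have "\<dots> \<in> M" using M_mult_V[OF M_diff[OF sf_M sf_M]] l t U_inverse[OF sf_U] U_V by blast
  finally have 2: "sf l / sf ?t - 1 \<in> M" .
  have "(a + m) ^ n - a ^ n \<in> M" if "a \<in> V" "m \<in> M" for a m n
  proof (induction n)
    case (Suc n)
    have "(a + m) ^ Suc n - a ^ Suc n = (a + m) * ((a + m) ^ n - a ^ n) + m * a ^ n" by (simp add: algebra_simps)
    then show ?case using Suc that M_add[OF V_mult_M M_mult_V] add_in M_V power_in by metis
  qed (simp add: zero_M)
  then have "(emb e + ?t * z) ^ (q - 1) - emb e ^ (q - 1) \<in> M" using emb_V M_mult_V t z by blast
  then have "sf l / sf ?t - 1 - ((emb e + ?t * z) ^ (q - 1) - emb e ^ (q - 1)) \<in> M" using M_diff 2 by blast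
  then have "emb e ^ (q - 1) - 1 \<in> M" unfolding 1 by (simp add: algebra_simps)
  then have "emb (e ^ (q - 1) - 1) \<in> M" by simp
  then show ?thesis using emb_M_iff by blast
qed

text \<open>In characteristic \<open>p\<close> the difference of the powers is the power of the
  difference.\<close>

lemma dvd_power_diff: assumes "f dvd a - b" "q ^ k \<ge> n" shows "f ^ n dvd a ^ (q ^ k) - b ^ (q ^ k)"
proof -
  have "f ^ n dvd f ^ (q ^ k)" using assms(2) by (rule le_imp_power_dvd)
  also have "f ^ (q ^ k) dvd (a - b) ^ (q ^ k)" using assms(1) by (rule dvd_power_same)
  finally show ?thesis by (simp add: frob_q_poly_diff)
qed

lemma q_power_ge: "q ^ k > k" using q_ge_3 by (intro power_gt_expt) auto

end

section \<open>The fields generated by torsion points\<close>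

text \<open>Steinitz exchange: an independent family inside the span of at most as many elements
  spans the same space. It turns families whose independence is seen from values into bases.\<close>

lemma baseQ_dimension:
  fixes x :: "'b \<Rightarrow> 'k::field qbar" and y :: "'c \<Rightarrow> 'k qbar"
  assumes fin: "finite K" "finite L" and card: "card L \<le> card K"
    and indep: "\<And>c. (\<And>k. c k \<in> baseQ) \<Longrightarrow> (\<Sum>k\<in>K. c k * x k) = 0 \<Longrightarrow> \<forall>k\<in>K. c k = 0"
    and W: "\<And>k. k \<in> K \<Longrightarrow> \<exists>c. (\<forall>l. c l \<in> baseQ) \<and> x k = (\<Sum>l\<in>L. c l * y l)"
    and w: "\<exists>c. (\<forall>l. c l \<in> baseQ) \<and> w = (\<Sum>l\<in>L. c l * y l)"
  shows "\<exists>c. (\<forall>k. c k \<in> baseQ) \<and> w = (\<Sum>k\<in>K. c k * x k)"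
proof -
  interpret vs: vector_space "\<lambda>(a::'k poly fract) x. to_ac a * x"
    by unfold_locales (auto simp: algebra_simps)
  have inj: "inj_on x K"
  proof (rule inj_onI, rule ccontr)
    fix k l assume kl: "k \<in> K" "l \<in> K" "x k = x l" "k \<noteq> l"
    define c where "c j = (if j = k then 1 else if j = l then -1 else 0 :: 'k qbar)" for j
    interpret Q: subr "baseQ :: 'k qbar set" by (rule subr_baseQ)
    have "(\<Sum>j\<in>K. c j * x j) = (\<Sum>j\<in>{k, l}. c j * x j)"
      by (rule sum.mono_neutral_right) (use fin kl in \<open>auto simp: c_def\<close>)
    also have "\<dots> = 0" using kl by (simp add: c_def)
    finally have "\<forall>k\<in>K. c k = 0" by (intro indep) (auto simp: c_def Q.one_in Q.uminus_in)
    then show False using kl by (auto simp: c_def)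
  qed
  have ind: "vs.independent (x ` K)"
  proof
    assume "vs.dependent (x ` K)"
    then obtain u where u: "\<exists>v\<in>x ` K. u v \<noteq> 0" "(\<Sum>v\<in>x ` K. to_ac (u v) * v) = 0"
      using vs.dependent_finite[of "x ` K"] fin by auto
    have "(\<Sum>k\<in>K. to_ac (u (x k)) * x k) = 0" using u(2) by (simp add: sum.reindex[OF inj])
    then have "\<forall>k\<in>K. to_ac (u (x k)) = 0" by (intro indep) (auto simp: baseQ_def)
    then show False using u(1) by auto
  qed
  have sp: "(\<Sum>l\<in>L. c l * y l) \<in> vs.span (y ` L)" if bQ: "\<And>l. c l \<in> baseQ" for c
  proof (rule vs.span_sum)
    fix l assume "l \<in> L"
    obtain a where "c l = to_ac a" using bQ[of l] by (auto simp: baseQ_def)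
    then show "c l * y l \<in> vs.span (y ` L)" using vs.span_scale[OF vs.span_base] \<open>l \<in> L\<close> by auto
  qed
  have "x ` K \<subseteq> vs.span (y ` L)"
  proof (rule image_subsetI)
    fix k assume "k \<in> K"
    then obtain c where "\<And>l. c l \<in> baseQ" "x k = (\<Sum>l\<in>L. c l * y l)" using W by blast
    then show "x k \<in> vs.span (y ` L)" using sp[of c] by simp
  qed
  moreover obtain c where "\<And>l. c l \<in> baseQ" "w = (\<Sum>l\<in>L. c l * y l)" using w by blast
  then have "w \<in> vs.span (y ` L)" using sp[of c] by simp
  ultimately have sub: "insert w (x ` K) \<subseteq> vs.span (y ` L)" by simp
  have "w \<in> vs.span (x ` K)"
  proof (rule ccontr)
    assume *: "w \<notin> vs.span (x ` K)"
    then have "vs.independent (insert w (x ` K))" using ind vs.independent_insertI by blast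
    then have "card (insert w (x ` K)) \<le> card (y ` L)" using vs.independent_span_bound sub fin by blast
    moreover have "w \<notin> x ` K" using * vs.span_base by blast
    ultimately have "Suc (card K) \<le> card (y ` L)" using fin inj by (simp add: card_image)
    then show False using card_image_le[OF fin(2), of y] card by simp
  qed
  then obtain u where "w = (\<Sum>v\<in>x ` K. to_ac (u v) * v)" using vs.span_finite[of "x ` K"] fin by auto
  then have "w = (\<Sum>k\<in>K. to_ac (u (x k)) * x k)" by (simp add: sum.reindex[OF inj])
  then show ?thesis by (intro exI[of _ "\<lambda>k. to_ac (u (x k))"]) (auto simp: baseQ_def)
qed

context carlitz_tower
begin

sublocale Q: subr "baseQ :: 'k qbar set" by (rule subr_baseQ)

text \<open>Coefficients in the base field have values divisible by \<open>N'\<close>, and the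
  \<open>y k\<close> have distinct values in the range from 0 to \<open>N' - 1\<close>; so the
  values of the terms differ already modulo \<open>N'\<close>.\<close>

lemma baseQ_sum_values:
  assumes T: "T \<in> M" "T \<noteq> 0" and TN: "veq T (int N') (emb f)" "N' > 0"
    and K: "finite K" and y: "\<And>k. k \<in> K \<Longrightarrow> veq T (int (b k)) (y k)"
    and b: "\<And>k l. k \<in> K \<Longrightarrow> l \<in> K \<Longrightarrow> b k = b l \<Longrightarrow> k = l" "\<And>k. k \<in> K \<Longrightarrow> b k < N'"
    and c: "\<And>k. k \<in> K \<Longrightarrow> c k \<in> baseQ"
  shows "vge T L (\<Sum>k\<in>K. c k * y k) \<Longrightarrow> k \<in> K \<Longrightarrow> vge T L (c k * y k)"
    and "(\<Sum>k\<in>K. c k * y k) = 0 \<Longrightarrow> k \<in> K \<Longrightarrow> c k = 0"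
    and "(\<Sum>k\<in>K. c k * y k) \<noteq> 0 \<Longrightarrow> \<exists>k\<in>K. \<exists>n. c k \<noteq> 0 \<and> veq T (int N' * n + int (b k)) (\<Sum>k\<in>K. c k * y k)"
proof -
  have "\<exists>n. veq T (int N' * n) (c k)" if kK: "k \<in> K" "c k \<noteq> 0" for k
  proof -
    obtain n where "veq (emb f) n (c k)" using baseQ_veq[OF c[OF kK(1)] kK(2)] .
    then show ?thesis using veq_trans[OF T TN(1)] by blast
  qed
  then obtain n where n: "\<And>k. k \<in> K \<Longrightarrow> c k \<noteq> 0 \<Longrightarrow> veq T (int N' * n k) (c k)" by metis
  let ?a = "\<lambda>k. int N' * n k + int (b k)"
  have v: "veq T (?a k) (c k * y k)" if "k \<in> K" "c k * y k \<noteq> 0" for k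
    using veq_mult[OF T n y] that by auto
  have inj: "k = l" if "k \<in> K" "l \<in> K" "?a k = ?a l" for k l
  proof -
    have "?a k mod int N' = int (b k)" if "k \<in> K" for k using b(2)[OF that] by simp
    then show ?thesis using that b(1) by (metis of_nat_eq_iff)
  qed
  show "vge T L (c k * y k)" if "vge T L (\<Sum>k\<in>K. c k * y k)" "k \<in> K"
    by (rule distinct_values[OF T K v _ that]) (use inj in auto)
  show "c k = 0" if "(\<Sum>k\<in>K. c k * y k) = 0" "k \<in> K"
  proof -
    have "c k * y k = 0" by (rule distinct_values_zero[OF T K v _ that]) (use inj in auto)
    then show ?thesis using veq_nz[OF y[OF that(2)]] by simp
  qed
  show "\<exists>k\<in>K. \<exists>n. c k \<noteq> 0 \<and> veq T (int N' * n + int (b k)) (\<Sum>k\<in>K. c k * y k)" if "(\<Sum>k\<in>K. c k * y k) \<noteq> 0"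
  proof (rule veq_sum_distinct[OF T K v _ that])
    fix k assume "k \<in> K" "c k * y k \<noteq> 0" "veq T (?a k) (\<Sum>k\<in>K. c k * y k)"
    then show ?thesis by (intro bexI[of _ k] exI[of _ "n k"]) auto
  qed (use inj in auto)
qed

definition QF :: "nat \<Rightarrow> 'k qbar set" where "QF n = {poly P (\<theta> n) | P. P \<in> polys baseQ}"

lemma QF_subr: "subr (QF n)" unfolding QF_def by (rule Q.adjoin_subr)
lemma QF_baseQ: "baseQ \<subseteq> QF n" and QF_theta: "\<theta> n \<in> QF n"
  unfolding QF_def using Q.adjoin_supset by blast+
lemma QF_poly: "P \<in> polys baseQ \<Longrightarrow> x \<in> QF n \<Longrightarrow> poly P x \<in> QF n"
  using subr.poly_in[OF QF_subr] polys_mono[OF QF_baseQ] by blast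
lemma QF_act: "x \<in> QF n \<Longrightarrow> carlitz_act e x \<in> QF n"
  using QF_poly[OF carlitz_poly_baseQ] by (simp add: poly_carlitz_poly)

text \<open>The quotient of P_(f^n) by P_(f^(n-1)), the analogue of a cyclotomic polynomial.
  Composing on the right with P_f lets degree and leading coefficient follow by induction.\<close>

definition Phi :: "nat \<Rightarrow> 'k qbar poly" where
  "Phi n = ((\<lambda>P. pcompose P (carlitz_poly f)) ^^ (n - 1)) Pf"

lemma Phi_1: "Phi (Suc 0) = Pf" by (simp add: Phi_def)
lemma Phi_Suc: "n \<ge> 1 \<Longrightarrow> Phi (Suc n) = pcompose (Phi n) (carlitz_poly f)"
  by (cases n) (auto simp: Phi_def)
lemma Pf_baseQ: "Pf \<in> polys baseQ"
  using Pf_emb polys_mono[of "range emb" baseQ] emb_baseQ by auto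
lemma Phi_props: "n \<ge> 1 \<Longrightarrow> Phi n \<in> polys baseQ \<and> degree (Phi n) = N n \<and> lead_coeff (Phi n) = 1"
proof (induction n rule: nat_induct_at_least)
  case base
  then show ?case using Pf_baseQ lead_coeff_Pf by (simp add: Phi_1 degree_Pf N_def)
next
  case (Suc n)
  have "lead_coeff (pcompose (Phi n) (carlitz_poly f)) = 1"
  proof -
    have "lead_coeff (pcompose (Phi n) (carlitz_poly f)) = lead_coeff (Phi n) * lead_coeff (carlitz_poly f) ^ degree (Phi n)"
      by (rule lead_coeff_comp) (use degree_carlitz_poly_f q_ge_3 in simp)
    then show ?thesis using Suc.IH lead_coeff_carlitz_poly_f by (metis mult_1 power_one)
  qed
  moreover have "degree (pcompose (Phi n) (carlitz_poly f)) = N (Suc n)"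
    using Suc by (simp add: degree_pcompose degree_carlitz_poly_f N_Suc)
  ultimately show ?case using Suc by (simp add: Phi_Suc Q.polys_pcompose carlitz_poly_baseQ)
qed
lemma poly_Phi: "n \<ge> 1 \<Longrightarrow> poly (Phi n) \<xi> = poly Pf (carlitz_act (f ^ (n - 1)) \<xi>)"
proof (induction n arbitrary: \<xi> rule: nat_induct_at_least)
  case base then show ?case by (simp add: Phi_1 carlitz_act_1)
next
  case (Suc n)
  then obtain m where m: "n = Suc m" by (cases n) auto
  show ?case using Suc by (simp add: m Phi_Suc poly_pcompose poly_carlitz_poly act_mult[symmetric] mult.commute[of f])
qed

lemma Phi_conj: assumes "n \<ge> 1" "\<not> f dvd e" shows "poly (Phi n) (carlitz_act e (\<theta> n)) = 0"
proof -
  have "carlitz_act (f ^ (n - 1)) (carlitz_act e (\<theta> n)) = carlitz_act e (carlitz_act (f ^ (n - 1)) (\<theta> n))"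
    by (simp add: act_mult[symmetric] mult.commute)
  also have "\<dots> = carlitz_act e (\<theta> 1)" using act_f_power_theta[of 1 "n - 1"] assms by simp
  finally have 1: "carlitz_act (f ^ (n - 1)) (carlitz_act e (\<theta> n)) = carlitz_act e (\<theta> 1)" .
  have "carlitz_act f (carlitz_act e (\<theta> 1)) = 0" using torsion_theta[of 1]
    by (simp add: act_mult[symmetric] mult.commute[of f]) (simp add: act_mult)
  then have "poly Pf (carlitz_act e (\<theta> 1)) = 0"
    using act_coprime_nz[OF assms(2) theta_1_nz act_f_theta_1] by (simp add: act_f)
  then show ?thesis using assms 1 by (simp add: poly_Phi)
qed

lemma not_f_dvd_1: "\<not> f dvd 1" using irr by (simp add: irreducible_def)
lemma Phi_theta: "n \<ge> 1 \<Longrightarrow> poly (Phi n) (\<theta> n) = 0"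
  using Phi_conj[of n 1] not_f_dvd_1 by (simp add: carlitz_act_1)

lemma theta_indep:
  assumes n: "n \<ge> 1" and c: "\<And>k. c k \<in> baseQ" and s: "(\<Sum>k<N n. c k * \<theta> n ^ k) = 0" and k: "k < N n"
  shows "c k = 0"
proof (rule baseQ_sum_values(2)[OF theta_M[OF n] theta_nz[OF n] theta_f[OF n] N_pos, where K="{..<N n}" and b="\<lambda>k. k"])
  show "veq (\<theta> n) (int k) (\<theta> n ^ k)" for k
    using veq_power[OF theta_M[OF n] theta_nz[OF n] veq_self[OF theta_M[OF n] theta_nz[OF n]]] by simp
qed (use assms in auto)

lemma Phi_division:
  assumes n: "n \<ge> 1" and P: "P \<in> polys baseQ"
  obtains S r where "S \<in> polys baseQ" "r \<in> polys baseQ" "P = Phi n * S + r" "degree r < N n"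
proof -
  obtain S r where "S \<in> polys baseQ" "r \<in> polys baseQ" "P = Phi n * S + r" "degree r < N n \<or> r = 0"
    using Q.monic_division[of "Phi n" P] Phi_props[OF n] P by auto
  then show ?thesis using that N_pos[of n] by force
qed

lemma poly_conv_sum: "degree P < n \<Longrightarrow> poly P x = (\<Sum>k<n. coeff P k * x ^ k)"
  for P :: "'a::comm_semiring_1 poly"
  unfolding poly_altdef by (rule sum.mono_neutral_left) (auto simp: coeff_eq_0)

text \<open>The remainder of \<open>P\<close> modulo \<open>Phi n\<close> vanishes at
  \<open>\<theta> n\<close> and has degree below \<open>N n\<close>, so it is zero by independence
  of the powers of \<open>\<theta> n\<close>; and \<open>Phi n\<close> vanishes at all
  conjugates.\<close>

lemma poly_zero_conj:
  assumes n: "n \<ge> 1" and P: "P \<in> polys baseQ" "poly P (\<theta> n) = 0" and e: "\<not> f dvd e"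
  shows "poly P (carlitz_act e (\<theta> n)) = 0"
proof -
  obtain S r where r: "r \<in> polys baseQ" "P = Phi n * S + r" "degree r < N n" using Phi_division[OF n P(1)] .
  have "poly r (\<theta> n) = 0" using P(2) r(2) Phi_theta[OF n] by simp
  then have "(\<Sum>k<N n. coeff r k * \<theta> n ^ k) = 0" using poly_conv_sum r(3) by metis
  then have "coeff r k = 0" if "k < N n" for k using theta_indep[OF n _ _ that] polysD[OF r(1)] by blast
  then have "coeff r (degree r) = 0" using r(3) by blast
  then have "r = 0" by simp
  then show ?thesis using r(2) Phi_conj[OF n e] by simp
qed

lemma QF_span: assumes "n \<ge> 1" "x \<in> QF n"
  shows "\<exists>c. (\<forall>k. c k \<in> baseQ) \<and> x = (\<Sum>k<N n. c k * \<theta> n ^ k)"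
proof -
  obtain P where P: "P \<in> polys baseQ" "x = poly P (\<theta> n)" using assms(2) by (auto simp: QF_def)
  obtain S r where r: "r \<in> polys baseQ" "P = Phi n * S + r" "degree r < N n" using Phi_division[OF assms(1) P(1)] .
  have "x = poly r (\<theta> n)" using P(2) r(2) Phi_theta[OF assms(1)] by simp
  then have "x = (\<Sum>k<N n. coeff r k * \<theta> n ^ k)" using poly_conv_sum r(3) by metis
  then show ?thesis using polysD[OF r(1)] by blast
qed

lemma QF_sum: assumes "\<And>k. c k \<in> baseQ" shows "(\<Sum>k<m. c k * \<theta> n ^ k) \<in> QF n"
proof -
  interpret F: subr "QF n" by (rule QF_subr)
  show ?thesis using assms QF_baseQ QF_theta by (intro F.sum_in F.mult_in F.power_in) auto
qed

text \<open>Multiplication by \<open>x\<close> is injective on a space of finite dimension, so 1 is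
  in its image.\<close>

lemma QF_inverse: assumes "n \<ge> 1" "x \<in> QF n" shows "inverse x \<in> QF n"
proof (cases "x = 0")
  case False
  interpret F: subr "QF n" by (rule QF_subr)
  have "\<exists>c. (\<forall>k. c k \<in> baseQ) \<and> 1 = (\<Sum>k<N n. c k * (x * \<theta> n ^ k))"
  proof (rule baseQ_dimension[where y = "\<lambda>k. \<theta> n ^ k" and L = "{..<N n}"])
    fix c assume c: "\<And>k. c k \<in> baseQ" "(\<Sum>k<N n. c k * (x * \<theta> n ^ k)) = 0"
    then have "x * (\<Sum>k<N n. c k * \<theta> n ^ k) = 0" by (simp add: sum_distrib_left mult_ac)
    then have s: "(\<Sum>k<N n. c k * \<theta> n ^ k) = 0" using False by simp
    show "\<forall>k\<in>{..<N n}. c k = 0"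
      by (rule ballI) (rule theta_indep[of n c, OF assms(1) c(1) s], simp)
  next
    show "\<exists>c. (\<forall>l. c l \<in> baseQ) \<and> x * \<theta> n ^ k = (\<Sum>l<N n. c l * \<theta> n ^ l)" for k
      by (intro QF_span assms F.mult_in F.power_in QF_theta)
    show "\<exists>c. (\<forall>l. c l \<in> baseQ) \<and> 1 = (\<Sum>l<N n. c l * \<theta> n ^ l)"
      by (intro QF_span assms F.one_in)
  qed auto
  then obtain c where c: "\<And>k. c k \<in> baseQ" "1 = (\<Sum>k<N n. c k * (x * \<theta> n ^ k))" by blast
  have "x * (\<Sum>k<N n. c k * \<theta> n ^ k) = 1" using c(2) by (simp add: sum_distrib_left mult_ac)
  then have "inverse x = (\<Sum>k<N n. c k * \<theta> n ^ k)" by (rule inverse_unique)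
  then show ?thesis using QF_sum c by simp
qed (use subr.zero_in[OF QF_subr] in auto)

lemma QF_powi: "n \<ge> 1 \<Longrightarrow> x \<in> QF n \<Longrightarrow> x powi k \<in> QF n"
  unfolding power_int_def by (auto intro!: subr.power_in[OF QF_subr] QF_inverse)

lemma QF_veq: assumes n: "n \<ge> 1" and x: "x \<in> QF n" "x \<noteq> 0" obtains k where "veq (\<theta> n) k x"
proof -
  obtain c where c: "\<And>k. c k \<in> baseQ" "x = (\<Sum>k<N n. c k * \<theta> n ^ k)" using QF_span n x by blast
  have "\<exists>k\<in>{..<N n}. \<exists>m. c k \<noteq> 0 \<and> veq (\<theta> n) (int (N n) * m + int k) (\<Sum>k<N n. c k * \<theta> n ^ k)"
  proof (rule baseQ_sum_values(3)[OF theta_M[OF n] theta_nz[OF n] theta_f[OF n] N_pos, where b="\<lambda>k. k"])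
    show "veq (\<theta> n) (int k) (\<theta> n ^ k)" for k
      using veq_power[OF theta_M[OF n] theta_nz[OF n] veq_self[OF theta_M[OF n] theta_nz[OF n]]] by simp
  qed (use x c in auto)
  then show ?thesis using that c by metis
qed

section \<open>Conjugation\<close>

text \<open>The automorphism of \<open>QF n\<close> with \<open>\<theta> n \<mapsto> carlitz_act e (\<theta> n)\<close>; independent of the choice of \<open>P\<close>
  if \<open>f\<close> does not divide \<open>e\<close>.\<close>
definition cj :: "nat \<Rightarrow> 'k poly \<Rightarrow> 'k qbar \<Rightarrow> 'k qbar" where
  "cj n e x = poly (SOME P. P \<in> polys baseQ \<and> poly P (\<theta> n) = x) (carlitz_act e (\<theta> n))"

context
  fixes n :: nat and e :: "'k poly"
  assumes n: "n \<ge> 1" and e: "\<not> f dvd e"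
begin

lemma conj_poly: assumes "P \<in> polys baseQ" shows "cj n e (poly P (\<theta> n)) = poly P (carlitz_act e (\<theta> n))"
proof -
  define P' where "P' = (SOME P'. P' \<in> polys baseQ \<and> poly P' (\<theta> n) = poly P (\<theta> n))"
  have P': "P' \<in> polys baseQ \<and> poly P' (\<theta> n) = poly P (\<theta> n)" unfolding P'_def by (rule someI) (use assms in auto)
  have "poly (P' - P) (carlitz_act e (\<theta> n)) = 0"
    by (rule poly_zero_conj[OF n _ _ e]) (use P' assms in \<open>auto intro: Q.polys_diff\<close>)
  then show ?thesis by (simp add: cj_def P'_def)
qed

lemma conj_QF: assumes "x \<in> QF n" shows "cj n e x \<in> QF n"
proof -
  obtain P where "P \<in> polys baseQ" "x = poly P (\<theta> n)" using assms by (auto simp: QF_def)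
  then show ?thesis using QF_poly QF_act QF_theta by (simp add: conj_poly)
qed

lemma conj_fix: assumes "x \<in> baseQ" shows "cj n e x = x"
  using conj_poly[OF Q.polys_const[OF assms]] by simp

lemma conj_diff: assumes "x \<in> QF n" "y \<in> QF n" shows "cj n e (x - y) = cj n e x - cj n e y"
proof -
  obtain P P' where "P \<in> polys baseQ" "x = poly P (\<theta> n)" "P' \<in> polys baseQ" "y = poly P' (\<theta> n)"
    using assms by (auto simp: QF_def)
  then show ?thesis using conj_poly[OF Q.polys_diff[of P P']] by (simp add: conj_poly)
qed
lemma conj_add: assumes "x \<in> QF n" "y \<in> QF n" shows "cj n e (x + y) = cj n e x + cj n e y"
proof -
  obtain P P' where "P \<in> polys baseQ" "x = poly P (\<theta> n)" "P' \<in> polys baseQ" "y = poly P' (\<theta> n)"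
    using assms by (auto simp: QF_def)
  then show ?thesis using conj_poly[OF Q.polys_add[of P P']] by (simp add: conj_poly)
qed
lemma conj_mult: assumes "x \<in> QF n" "y \<in> QF n" shows "cj n e (x * y) = cj n e x * cj n e y"
proof -
  obtain P P' where "P \<in> polys baseQ" "x = poly P (\<theta> n)" "P' \<in> polys baseQ" "y = poly P' (\<theta> n)"
    using assms by (auto simp: QF_def)
  then show ?thesis using conj_poly[OF Q.polys_mult[of P P']] by (simp add: conj_poly)
qed
lemma conj_0 [simp]: "cj n e 0 = 0" and conj_1 [simp]: "cj n e 1 = 1"
  using conj_fix Q.one_in by auto
lemma conj_uminus: "x \<in> QF n \<Longrightarrow> cj n e (- x) = - cj n e x"
  using conj_diff[of 0 x] subr.zero_in[OF QF_subr] by simp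
lemma conj_sum: "(\<And>a. a \<in> A \<Longrightarrow> g a \<in> QF n) \<Longrightarrow> cj n e (\<Sum>a\<in>A. g a) = (\<Sum>a\<in>A. cj n e (g a))"
  by (induction A rule: infinite_finite_induct) (auto simp: conj_add subr.sum_in[OF QF_subr])
lemma conj_prod: "(\<And>a. a \<in> A \<Longrightarrow> g a \<in> QF n) \<Longrightarrow> cj n e (\<Prod>a\<in>A. g a) = (\<Prod>a\<in>A. cj n e (g a))"
  by (induction A rule: infinite_finite_induct) (auto simp: conj_mult subr.prod_in[OF QF_subr])
lemma conj_power: "x \<in> QF n \<Longrightarrow> cj n e (x ^ k) = cj n e x ^ k"
  by (induction k) (auto simp: conj_mult subr.power_in[OF QF_subr])
lemma conj_poly_apply: "P \<in> polys baseQ \<Longrightarrow> x \<in> QF n \<Longrightarrow> cj n e (poly P x) = poly P (cj n e x)"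
  unfolding poly_altdef using QF_baseQ[of n]
  by (subst conj_sum) (auto simp: conj_mult conj_power conj_fix polysD subr.mult_in[OF QF_subr]
      subr.power_in[OF QF_subr] subset_iff)
lemma conj_act: "x \<in> QF n \<Longrightarrow> cj n e (carlitz_act a x) = carlitz_act a (cj n e x)"
  using conj_poly_apply[OF carlitz_poly_baseQ] by (simp add: poly_carlitz_poly)
lemma conj_theta: "cj n e (\<theta> n) = carlitz_act e (\<theta> n)"
  using conj_poly[of "[:0, 1:]"] by (simp add: Q.polys_pCons Q.polys_0 Q.one_in)
lemma conj_nz: assumes "x \<in> QF n" "x \<noteq> 0" shows "cj n e x \<noteq> 0"
  using conj_mult[OF assms(1) QF_inverse[OF n assms(1)]] assms by auto
lemma conj_inverse: assumes "x \<in> QF n" shows "cj n e (inverse x) = inverse (cj n e x)"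
proof (cases "x = 0")
  case False
  then have "cj n e x * cj n e (inverse x) = 1" using conj_mult[OF assms QF_inverse[OF n assms]] by simp
  then show ?thesis by (metis inverse_unique)
qed simp
lemma conj_powi: "x \<in> QF n \<Longrightarrow> cj n e (x powi k) = cj n e x powi k"
  by (auto simp: power_int_def conj_power conj_inverse QF_inverse[OF n] simp del: power_inverse)

lemma conj_theta_U: "carlitz_act e (\<theta> n) / \<theta> n \<in> U"
proof -
  obtain z where z: "z \<in> V" "carlitz_act e (\<theta> n) = \<theta> n * (emb e + \<theta> n * z)"
    using act_expand[OF theta_V[OF n]] .
  then have "carlitz_act e (\<theta> n) / \<theta> n = emb e + \<theta> n * z" using theta_nz[OF n] by simp
  then show ?thesis using U_add_M[OF emb_U[OF e] M_mult_V[OF theta_M[OF n] z(1)]] by simp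
qed

text \<open>The coordinates of an integral \<open>x\<close> in the powers of
  \<open>\<theta> n\<close> are integral, since \<open>N n * m + k \<ge> 0\<close> with
  \<open>k < N n\<close> forces \<open>m \<ge> 0\<close>. Conjugation fixes the coordinates and
  sends the powers into \<open>V\<close>.\<close>

lemma conj_V: assumes "x \<in> QF n" "x \<in> V" shows "cj n e x \<in> V"
proof -
  note T = theta_M[OF n] theta_nz[OF n]
  obtain c where c: "\<And>k. c k \<in> baseQ" "x = (\<Sum>k<N n. c k * \<theta> n ^ k)" using QF_span n assms(1) by blast
  have vt: "veq (\<theta> n) (int k) (\<theta> n ^ k)" for k using veq_power[OF T veq_self[OF T]] by simp
  have cV: "c k \<in> V" if "k < N n" for k
  proof (cases "c k = 0")
    case False
    have "vge (\<theta> n) 0 (c k * \<theta> n ^ k)"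
      by (rule baseQ_sum_values(1)[OF T theta_f[OF n] N_pos, where K="{..<N n}" and b="\<lambda>k. k"])
         (use vt c assms that in \<open>auto simp: vge_0_iff\<close>)
    moreover obtain m where "veq (emb f) m (c k)" using baseQ_veq c False by blast
    then have m: "veq (\<theta> n) (int (N n) * m) (c k)" using veq_trans[OF T theta_f[OF n]] by blast
    ultimately have "0 \<le> int (N n) * m + int k" using veq_vge_iff[OF T veq_mult[OF T m vt]] by blast
    then have "int (N n) * (m + 1) > 0" using that by (simp add: algebra_simps)
    then have "m \<ge> 0" by (simp add: zero_less_mult_iff)
    then have "vge (\<theta> n) 0 (c k)" using veq_vge_iff[OF T m] by simp
    then show ?thesis by (simp add: vge_0_iff)
  qed simp
  have F: "c k * \<theta> n ^ k \<in> QF n" "\<theta> n ^ k \<in> QF n" "c k \<in> QF n" for k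
    using c QF_baseQ QF_theta by (auto intro!: subr.mult_in[OF QF_subr] subr.power_in[OF QF_subr])
  have "cj n e x = (\<Sum>k<N n. c k * carlitz_act e (\<theta> n) ^ k)"
    unfolding c(2) by (subst conj_sum) (use F c QF_theta in \<open>auto simp: conj_mult conj_power conj_fix conj_theta\<close>)
  then show ?thesis using cV act_V[OF theta_V[OF n]] by (auto intro!: sum_in mult_in power_in)
qed

lemma conj_U: assumes "x \<in> QF n" "x \<in> U" shows "cj n e x \<in> U"
proof -
  have "cj n e x \<in> V" "cj n e (inverse x) \<in> V" using conj_V assms QF_inverse n by (auto simp: U_def)
  then show ?thesis using conj_inverse conj_nz assms by (auto simp: U_def)
qed

text \<open>An element is a unit times a power of \<open>\<theta> n\<close>, and conjugation changes
  both factors by units only. So conjugates have equal values, without a uniqueness theorem for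
  extensions of valuations.\<close>

lemma conj_ratio: assumes "x \<in> QF n" "x \<noteq> 0" shows "cj n e x / x \<in> U"
proof -
  obtain k where k: "veq (\<theta> n) k x" using QF_veq[OF n assms] .
  define u where "u = x * \<theta> n powi (- k)"
  have u: "u \<in> U" "u \<in> QF n" "u \<noteq> 0" using k assms
    by (auto simp: u_def veq_def intro!: subr.mult_in[OF QF_subr] QF_powi n QF_theta dest: U_nz)
  have x: "x = u * \<theta> n powi k" using theta_nz[OF n] by (simp add: u_def power_int_minus)
  have "cj n e x = cj n e u * carlitz_act e (\<theta> n) powi k"
    unfolding x by (subst conj_mult) (use u n in \<open>simp_all add: QF_powi QF_theta conj_powi conj_theta\<close>)
  then have "cj n e x / x = (cj n e u / u) * (carlitz_act e (\<theta> n) / \<theta> n) powi k"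
    by (simp add: x power_int_divide_distrib)
  then show ?thesis using U_mult[OF U_divide[OF conj_U[OF u(2,1)] u(1)] U_powi[OF conj_theta_U]] by simp
qed

lemma conj_vge: assumes "x \<in> QF n" "vge T L x" shows "vge T L (cj n e x)"
proof (cases "x = 0")
  case False
  then have "cj n e x * T powi (- L) = (cj n e x / x) * (x * T powi (- L))" by simp
  also have "\<dots> \<in> V" using mult_in[OF U_V[OF conj_ratio[OF assms(1) False]] assms(2)[unfolded vge_def]] .
  finally show ?thesis by (simp add: vge_def)
qed simp

end

lemma conj_conj: assumes n: "n \<ge> 1" and e: "\<not> f dvd e" "\<not> f dvd e'" and x: "x \<in> QF n"
  shows "cj n e (cj n e' x) = cj n (e' * e) x"
proof -
  have e2: "\<not> f dvd e' * e" using e prime_f by (simp add: prime_elem_dvd_mult_iff)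
  obtain P where P: "P \<in> polys baseQ" "x = poly P (\<theta> n)" using x by (auto simp: QF_def)
  have "cj n e (cj n e' x) = cj n e (poly P (carlitz_act e' (\<theta> n)))" using P conj_poly[OF n e(2)] by simp
  also have "\<dots> = poly P (carlitz_act e' (carlitz_act e (\<theta> n)))"
    using conj_poly_apply[OF n e(1) P(1) QF_act[OF QF_theta]] conj_act[OF n e(1) QF_theta] conj_theta[OF n e(1)] by simp
  also have "\<dots> = cj n (e' * e) x" using P conj_poly[OF n e2 P(1)] by (simp add: act_mult)
  finally show ?thesis .
qed

lemma conj_cong: assumes "n \<ge> 1" "f ^ n dvd e - e'" shows "cj n e = cj n e'"
proof -
  have "carlitz_act e (\<theta> n) = carlitz_act e' (\<theta> n)" using act_theta_eq_iff[OF assms(1)] assms(2) by blast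
  then show ?thesis by (simp add: cj_def fun_eq_iff)
qed

lemma conj_one: assumes "n \<ge> 1" "x \<in> QF n" shows "cj n 1 x = x"
  using assms conj_poly[OF assms(1) not_f_dvd_1] by (auto simp: QF_def carlitz_act_1)

lemma QF_Suc: assumes "n \<ge> 1" shows "QF n \<subseteq> QF (Suc n)"
proof
  fix x assume "x \<in> QF n"
  then obtain P where P: "P \<in> polys baseQ" "x = poly P (\<theta> n)" by (auto simp: QF_def)
  then have "x = poly (pcompose P (carlitz_poly f)) (\<theta> (Suc n))"
    using act_f_theta[OF assms] by (simp add: poly_pcompose poly_carlitz_poly)
  then show "x \<in> QF (Suc n)" using Q.polys_pcompose[OF P(1) carlitz_poly_baseQ] by (auto simp: QF_def)
qed

lemma conj_Suc: assumes "n \<ge> 1" "\<not> f dvd e" "x \<in> QF n" shows "cj (Suc n) e x = cj n e x"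
proof -
  have n': "Suc n \<ge> 1" by simp
  obtain P where P: "P \<in> polys baseQ" "x = poly P (\<theta> n)" using assms by (auto simp: QF_def)
  have t: "\<theta> n = carlitz_act f (\<theta> (Suc n))" using act_f_theta[OF assms(1)] by simp
  have "cj (Suc n) e x = poly P (cj (Suc n) e (\<theta> n))"
    unfolding P(2) by (rule conj_poly_apply[OF n' assms(2) P(1)]) (simp add: t QF_act QF_theta)
  also have "cj (Suc n) e (\<theta> n) = carlitz_act f (carlitz_act e (\<theta> (Suc n)))"
    unfolding t using conj_act[OF n' assms(2) QF_theta] conj_theta[OF n' assms(2)] by simp
  also have "\<dots> = carlitz_act e (\<theta> n)" unfolding t by (simp add: act_mult[symmetric] mult.commute)
  finally show ?thesis using P conj_poly[OF assms(1,2)] by simp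
qed

end

section \<open>Galois groups and the tower of subfields\<close>

lemma rta_simps [simp]:
  "carrier (ring_of_type_algebra :: 'a::field ring) = UNIV"
  "x \<otimes>\<^bsub>ring_of_type_algebra\<^esub> y = x * y" "x \<oplus>\<^bsub>ring_of_type_algebra\<^esub> y = x + y"
  "\<one>\<^bsub>ring_of_type_algebra\<^esub> = (1::'a)" "\<zero>\<^bsub>ring_of_type_algebra\<^esub> = (0::'a)"
  by (simp_all add: ring_of_type_algebra_def)

lemma rta_a_inv [simp]: "\<ominus>\<^bsub>ring_of_type_algebra\<^esub> (x::'a::field) = - x"
proof -
  interpret ring "ring_of_type_algebra :: 'a ring" by (rule ring_from_type_algebra)
  show ?thesis by (rule minus_equality) auto
qed

lemma rta_m_inv: "x \<noteq> 0 \<Longrightarrow> inv\<^bsub>ring_of_type_algebra\<^esub> (x::'a::field) = inverse x"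
proof -
  assume "x \<noteq> 0"
  interpret cring "ring_of_type_algebra :: 'a ring" by (rule cring_from_type_algebra)
  show ?thesis by (rule comm_inv_char) (use \<open>x \<noteq> 0\<close> in auto)
qed

context carlitz_tower
begin

lemma cycF_eq: assumes n: "n \<ge> 1" shows "cycF \<theta> n = QF n"
proof
  show "cycF \<theta> n \<subseteq> QF n"
  proof
    fix x assume "x \<in> cycF \<theta> n"
    then show "x \<in> QF n" unfolding cycF_def
    proof (induction rule: generate_field.induct)
      case (m_inv h) then show ?case using QF_inverse n by (simp add: rta_m_inv)
    qed (use QF_theta QF_baseQ subr.one_in[OF QF_subr] subr.uminus_in[OF QF_subr] subr.add_in[OF QF_subr]
        subr.mult_in[OF QF_subr] in auto)
  qed
  let ?G = "generate_field ring_of_type_algebra (insert (\<theta> n) baseQ)"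
  interpret G: subr ?G
  proof
    show "1 \<in> ?G" using generate_field.one[of "ring_of_type_algebra :: 'k qbar ring"] by simp
    show "x - y \<in> ?G" if "x \<in> ?G" "y \<in> ?G" for x y
      using generate_field.eng_add[OF that(1) generate_field.a_inv[OF that(2)]] by simp
    show "x * y \<in> ?G" if "x \<in> ?G" "y \<in> ?G" for x y
      using generate_field.eng_mult[OF that] by simp
  qed
  show "QF n \<subseteq> cycF \<theta> n"
  proof
    fix x assume "x \<in> QF n"
    then obtain P where P: "P \<in> polys baseQ" "x = poly P (\<theta> n)" by (auto simp: QF_def)
    have "baseQ \<subseteq> ?G" "\<theta> n \<in> ?G" by (auto intro: generate_field.incl)
    then show "x \<in> cycF \<theta> n" unfolding cycF_def P(2) using polys_mono P(1) by (intro G.poly_in) auto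
  qed
qed

text \<open>If \<open>a * e\<close> is 1 modulo \<open>f\<close>, its power with exponent
  \<open>q ^ n\<close> is 1 modulo \<open>f ^ n\<close>.\<close>

lemma inverse_mod_power: assumes "\<not> f dvd e" obtains e' where "f ^ n dvd e' * e - 1"
proof -
  obtain a where "f dvd a * e - 1" using inverse_mod assms by blast
  then have "f ^ n dvd (a * e) ^ (q ^ n) - 1 ^ (q ^ n)"
    using q_power_ge[of n] by (intro dvd_power_diff) auto
  moreover have "e ^ (q ^ n) = e ^ (q ^ n - 1) * e" using q_ge_3 by (intro power_minus_mult[symmetric]) simp
  then have "(a * e) ^ (q ^ n) = (a ^ (q ^ n) * e ^ (q ^ n - 1)) * e"
    by (simp add: power_mult_distrib mult.assoc)
  ultimately show ?thesis using that[of "a ^ (q ^ n) * e ^ (q ^ n - 1)"] by simp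
qed

lemma unit_mod: assumes "n \<ge> 1" "f ^ n dvd e' * e - 1" shows "\<not> f dvd e'"
proof
  assume "f dvd e'"
  then have a: "f dvd e' * e" by simp
  have "f dvd e' * e - 1" using assms dvd_trans[OF dvd_power[of n f]] by auto
  from dvd_diff[OF a this] show False using not_f_dvd_1 by simp
qed

text \<open>Extensional, to match the encoding of automorphisms in
  \<open>galois_group\<close>.\<close>

definition gal :: "nat \<Rightarrow> 'k poly \<Rightarrow> 'k qbar \<Rightarrow> 'k qbar" where "gal n e = restrict (cj n e) (QF n)"
abbreviation GG :: "nat \<Rightarrow> ('k qbar \<Rightarrow> 'k qbar) monoid" where "GG n \<equiv> galois_group (QF n) baseQ"

lemma gal_cong: "n \<ge> 1 \<Longrightarrow> f ^ n dvd e - e' \<Longrightarrow> gal n e = gal n e'"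
  using conj_cong[of n e e'] by (simp add: gal_def)

lemma gal_eq_iff: assumes "n \<ge> 1" "\<not> f dvd e" "\<not> f dvd e'" shows "gal n e = gal n e' \<longleftrightarrow> f ^ n dvd e - e'"
proof
  assume "gal n e = gal n e'"
  then have "gal n e (\<theta> n) = gal n e' (\<theta> n)" by simp
  then have "carlitz_act e (\<theta> n) = carlitz_act e' (\<theta> n)"
    using assms QF_theta by (simp add: gal_def conj_theta)
  then show "f ^ n dvd e - e'" using act_theta_eq_iff assms by blast
qed (use gal_cong assms in auto)

lemma gal_Bij: assumes n: "n \<ge> 1" and e: "\<not> f dvd e" shows "gal n e \<in> Bij (QF n)"
proof -
  obtain e' where e': "f ^ n dvd e' * e - 1" using inverse_mod_power e by blast
  have ne': "\<not> f dvd e'" using unit_mod[OF n e'] .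
  have 1: "cj n e (cj n e' x) = x" if "x \<in> QF n" for x
    using conj_conj[OF n e ne' that] conj_cong[OF n e'] conj_one[OF n that] by simp
  have 2: "cj n e' (cj n e x) = x" if "x \<in> QF n" for x
    using conj_conj[OF n ne' e that] conj_cong[OF n e'] conj_one[OF n that] by (simp add: mult.commute)
  have "bij_betw (cj n e) (QF n) (QF n)"
    by (rule bij_betw_byWitness[where f' = "cj n e'"]) (use 1 2 conj_QF n e ne' in auto)
  then show ?thesis by (auto simp: Bij_def gal_def cong: bij_betw_cong)
qed

lemma carrier_galois: "carrier (galois_group A K) =
    {\<sigma> \<in> Bij A. \<sigma> \<in> ring_hom (ring_of_type_algebra\<lparr>carrier := A\<rparr>) (ring_of_type_algebra\<lparr>carrier := A\<rparr>) \<and> (\<forall>x\<in>K. \<sigma> x = x)}"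
  by (simp add: galois_group_def)

lemma gal_ring_hom: assumes n: "n \<ge> 1" and e: "\<not> f dvd e"
  shows "gal n e \<in> ring_hom (ring_of_type_algebra\<lparr>carrier := QF n\<rparr>) (ring_of_type_algebra\<lparr>carrier := QF n\<rparr>)"
  using conj_QF[OF n e] conj_mult[OF n e] conj_add[OF n e] conj_1[OF n e]
  by (intro ring_hom_memI) (auto simp: gal_def subr.one_in[OF QF_subr] subr.mult_in[OF QF_subr] subr.add_in[OF QF_subr])

lemma gal_carrier: assumes n: "n \<ge> 1" and e: "\<not> f dvd e" shows "gal n e \<in> carrier (GG n)"
  using gal_Bij[OF n e] gal_ring_hom[OF n e] conj_fix[OF n e] QF_baseQ[of n] by (auto simp: carrier_galois gal_def)

lemma ring_hom_poly:
  assumes s: "\<sigma> \<in> ring_hom (ring_of_type_algebra\<lparr>carrier := QF n\<rparr>) (ring_of_type_algebra\<lparr>carrier := QF n\<rparr>)"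
    and fix_K: "\<forall>x\<in>K. \<sigma> x = x" and P: "P \<in> polys K" and K: "0 \<in> K" "K \<subseteq> QF n" and x: "x \<in> QF n"
  shows "\<sigma> (poly P x) = poly P (\<sigma> x)"
proof -
  interpret F: subr "QF n" by (rule QF_subr)
  have add: "\<sigma> (a + b) = \<sigma> a + \<sigma> b" and mult: "\<sigma> (a * b) = \<sigma> a * \<sigma> b" if "a \<in> QF n" "b \<in> QF n" for a b
    using ring_hom_add[OF s] ring_hom_mult[OF s] that by auto
  show ?thesis using P
  proof (induction P rule: pCons_induct)
    case 0 then show ?case using fix_K K by simp
  next
    case (pCons a P)
    have a: "a \<in> K" "P \<in> polys K" using polysD[OF pCons.prems, of 0] polysD[OF pCons.prems, of "Suc _"] by (auto intro: polysI)
    have "poly P x \<in> QF n" using F.poly_in polys_mono[OF K(2)] a x by auto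
    then show ?case using pCons.IH a K add mult x F.mult_in fix_K by (auto simp: subset_iff)
  qed
qed

text \<open>An automorphism over the base commutes with the module action, so it sends
  \<open>\<theta> n\<close> to a torsion point \<open>carlitz_act e (\<theta> n)\<close>. Were
  \<open>f\<close> to divide \<open>e\<close>, it would kill
  \<open>carlitz_act (f ^ (n - 1)) (\<theta> n)\<close>, which is the nonzero
  \<open>\<theta> 1\<close>.\<close>

lemma galois_is_gal: assumes n: "n \<ge> 1" and s: "\<sigma> \<in> carrier (galois_group (QF n) K)" and K: "baseQ \<subseteq> K"
  obtains e where "\<not> f dvd e" "\<sigma> = gal n e"
proof -
  have s1: "\<sigma> \<in> Bij (QF n)" and s2: "\<sigma> \<in> ring_hom (ring_of_type_algebra\<lparr>carrier := QF n\<rparr>) (ring_of_type_algebra\<lparr>carrier := QF n\<rparr>)"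
    and s3: "\<forall>x\<in>baseQ. \<sigma> x = x" using s K by (auto simp: carrier_galois)
  note hom = ring_hom_poly[OF s2 s3 _ Q.zero_in QF_baseQ]
  have act: "\<sigma> (carlitz_act a (\<theta> n)) = carlitz_act a (\<sigma> (\<theta> n))" for a
    using hom[OF carlitz_poly_baseQ QF_theta] by (simp add: poly_carlitz_poly)
  have s0: "\<sigma> 0 = 0" using s3 by auto
  then have "carlitz_act (f ^ n) (\<sigma> (\<theta> n)) = 0" using act[of "f ^ n"] torsion_theta[OF n] by simp
  then obtain e where e: "\<sigma> (\<theta> n) = carlitz_act e (\<theta> n)" using gens1[OF n] by blast
  have "\<not> f dvd e"
  proof
    assume "f dvd e"
    then have "f ^ n dvd f ^ (n - 1) * e" using n mult_dvd_mono[of "f ^ (n - 1)" "f ^ (n - 1)" f e]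
      by (cases n) (auto simp: mult.commute)
    then have "carlitz_act (f ^ (n - 1)) (\<sigma> (\<theta> n)) = 0"
      unfolding e using act_theta_eq_0_iff[OF n] by (simp add: act_mult[symmetric])
    then have "\<sigma> (carlitz_act (f ^ (n - 1)) (\<theta> n)) = \<sigma> 0" using act s0 by simp
    moreover have "inj_on \<sigma> (QF n)" using s1 by (simp add: Bij_def bij_betw_def)
    ultimately have "carlitz_act (f ^ (n - 1)) (\<theta> n) = 0"
      using QF_act QF_theta subr.zero_in[OF QF_subr] by (meson inj_onD)
    then show False using act_f_power_theta[of 1 "n - 1"] n theta_1_nz by simp
  qed
  moreover have "\<sigma> = gal n e"
  proof
    fix x show "\<sigma> x = gal n e x"
    proof (cases "x \<in> QF n")
      case True
      then obtain P where P: "P \<in> polys baseQ" "x = poly P (\<theta> n)" by (auto simp: QF_def)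
      then have "\<sigma> x = poly P (carlitz_act e (\<theta> n))" using hom[OF P(1) QF_theta] e by simp
      then show ?thesis using conj_poly[OF n \<open>\<not> f dvd e\<close> P(1)] P(2) True by (simp add: gal_def)
    next
      case False
      then show ?thesis using s1 by (simp add: Bij_def gal_def extensional_def)
    qed
  qed
  ultimately show ?thesis using that by blast
qed

lemma not_dvd_mult: "\<not> f dvd a \<Longrightarrow> \<not> f dvd b \<Longrightarrow> \<not> f dvd a * b"
  using prime_f by (simp add: prime_elem_dvd_mult_iff)
lemma not_dvd_power: "\<not> f dvd a \<Longrightarrow> \<not> f dvd a ^ k" using prime_dvd_power_f by blast

lemma gal_mult: assumes n: "n \<ge> 1" and e: "\<not> f dvd a" "\<not> f dvd b"
  shows "gal n a \<otimes>\<^bsub>GG n\<^esub> gal n b = gal n (a * b)"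
proof -
  have "gal n a \<otimes>\<^bsub>GG n\<^esub> gal n b = compose (QF n) (gal n a) (gal n b)"
    using gal_Bij[OF n] e by (simp add: galois_group_def BijGroup_def)
  also have "\<dots> = gal n (a * b)"
    using conj_conj[OF n e] conj_QF[OF n e(2)] by (auto simp: compose_def gal_def fun_eq_iff restrict_def mult.commute)
  finally show ?thesis .
qed

lemma gal_one: "n \<ge> 1 \<Longrightarrow> \<one>\<^bsub>GG n\<^esub> = gal n 1"
  using conj_one by (auto simp: galois_group_def BijGroup_def gal_def fun_eq_iff restrict_def)

lemma galois_group_is_group: assumes n: "n \<ge> 1" shows "group (GG n)"
proof (rule groupI)
  note E = galois_is_gal[OF n _ order.refl]
  show "\<one>\<^bsub>GG n\<^esub> \<in> carrier (GG n)" using gal_one gal_carrier n not_f_dvd_1 by simp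
  fix x assume x: "x \<in> carrier (GG n)"
  obtain a where a: "\<not> f dvd a" "x = gal n a" using E x by blast
  show "\<one>\<^bsub>GG n\<^esub> \<otimes>\<^bsub>GG n\<^esub> x = x" using a gal_mult[OF n not_f_dvd_1 a(1)] gal_one n by simp
  obtain a' where a': "f ^ n dvd a' * a - 1" using inverse_mod_power a by blast
  then have "\<not> f dvd a'" using unit_mod n by blast
  then have "gal n a' \<otimes>\<^bsub>GG n\<^esub> x = \<one>\<^bsub>GG n\<^esub>" using gal_mult[OF n _ a(1)] a(2) gal_cong[OF n a'] gal_one n by simp
  then show "\<exists>y\<in>carrier (GG n). y \<otimes>\<^bsub>GG n\<^esub> x = \<one>\<^bsub>GG n\<^esub>" using gal_carrier[OF n \<open>\<not> f dvd a'\<close>] by blast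
  fix y assume "y \<in> carrier (GG n)"
  then obtain b where b: "\<not> f dvd b" "y = gal n b" using E by blast
  show "x \<otimes>\<^bsub>GG n\<^esub> y \<in> carrier (GG n)" using a b gal_mult n gal_carrier not_dvd_mult by simp
  fix z assume "z \<in> carrier (GG n)"
  then obtain c where c: "\<not> f dvd c" "z = gal n c" using E by blast
  show "x \<otimes>\<^bsub>GG n\<^esub> y \<otimes>\<^bsub>GG n\<^esub> z = x \<otimes>\<^bsub>GG n\<^esub> (y \<otimes>\<^bsub>GG n\<^esub> z)"
    using a b c n by (simp add: gal_mult not_dvd_mult mult.assoc)
qed

lemma gal_pow: assumes n: "n \<ge> 1" and e: "\<not> f dvd e" shows "gal n e [^]\<^bsub>GG n\<^esub> (k::nat) = gal n (e ^ k)"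
proof (induction k)
  case (Suc k)
  then show ?case using gal_mult[OF n not_dvd_power[OF e] e, of k] by (simp add: mult.commute)
qed (use gal_one[OF n] in simp)

text \<open>The multiplicative lift of residue classes modulo \<open>f\<close> to residue classes modulo \<open>f ^ n\<close>.\<close>
definition teich :: "nat \<Rightarrow> 'k poly \<Rightarrow> 'k poly" where "teich n e = e ^ (q ^ (n - 1))"

lemma teich_mult: "teich n (a * b) = teich n a * teich n b" by (simp add: teich_def power_mult_distrib)
lemma teich_not_dvd: "\<not> f dvd e \<Longrightarrow> \<not> f dvd teich n e" by (simp add: teich_def not_dvd_power)
lemma teich_cong: assumes "f dvd a - b" shows "f ^ n dvd teich n a - teich n b"
  unfolding teich_def using q_power_ge[of "n - 1"] by (intro dvd_power_diff assms) auto
lemma fermat_q: "f dvd e ^ q - e"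
proof (cases "f dvd e")
  case True then show ?thesis using q_ge_3 by (intro dvd_diff) (auto intro: dvd_trans[OF _ dvd_power])
next
  case False
  have "e ^ q - e = e * (e ^ (q - 1) - 1)" using q_ge_3 by (simp add: right_diff_distrib flip: power_Suc)
  then show ?thesis using fermat[OF False] by simp
qed
lemma fermat_q_power: "f dvd e ^ (q ^ k) - e"
proof (induction k)
  case (Suc k)
  have "e ^ (q ^ Suc k) - e = ((e ^ (q ^ k)) ^ q - e ^ (q ^ k)) + (e ^ (q ^ k) - e)"
    by (simp add: power_mult[symmetric] mult.commute)
  then show ?case using fermat_q[of "e ^ (q ^ k)"] Suc by (metis dvd_add)
qed simp
lemma teich_mod_f: "f dvd teich n e - e" unfolding teich_def by (rule fermat_q_power)
lemma teich_inj: assumes "n \<ge> 1" "f ^ n dvd teich n a - teich n b" shows "f dvd a - b"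
proof -
  have "f dvd teich n a - teich n b" using assms dvd_trans[OF dvd_power[of n f]] by auto
  then have "f dvd (teich n a - teich n b) - (teich n a - a) + (teich n b - b)"
    using teich_mod_f[of n a] teich_mod_f[of n b] by (meson dvd_add dvd_diff)
  then show ?thesis by simp
qed
lemma teich_Suc: assumes "n \<ge> 1" shows "f ^ n dvd teich (Suc n) e - teich n e"
proof -
  have "teich (Suc n) e = teich n (e ^ q)" using assms by (cases n) (auto simp: teich_def power_mult[symmetric] mult.commute)
  then show ?thesis using teich_cong[OF fermat_q] by simp
qed

definition R1 :: "'k poly set" where "R1 = R - {0}"
lemma finite_R1: "finite R1" and card_R1: "card R1 = q - 1" using finite_R card_R zero_R by (auto simp: R1_def)
lemma R1_not_dvd: "c \<in> R1 \<Longrightarrow> \<not> f dvd c" using not_dvd_R by (simp add: R1_def)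
lemma mod_R1: "\<not> f dvd t \<Longrightarrow> t mod f \<in> R1" using mod_R by (auto simp: R1_def mod_eq_0_iff_dvd)
lemma dvd_mod_diff: "f dvd t - t mod f" by (simp add: minus_mod_eq_mult_div)

definition CC :: "nat \<Rightarrow> ('k qbar \<Rightarrow> 'k qbar) set" where "CC n = (\<lambda>c. gal n (teich n c)) ` R1"

lemma gal_teich_CC: assumes "n \<ge> 1" "\<not> f dvd t" shows "gal n (teich n t) \<in> CC n"
proof -
  have "gal n (teich n t) = gal n (teich n (t mod f))" by (intro gal_cong assms teich_cong dvd_mod_diff)
  then show ?thesis using mod_R1[OF assms(2)] by (auto simp: CC_def)
qed

lemma inj_gal_teich: assumes "n \<ge> 1" shows "inj_on (\<lambda>c. gal n (teich n c)) R1"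
proof (rule inj_onI)
  fix a b assume ab: "a \<in> R1" "b \<in> R1" "gal n (teich n a) = gal n (teich n b)"
  then have "f dvd a - b" using gal_eq_iff teich_inj assms teich_not_dvd R1_not_dvd by metis
  then show "a = b" using R_dvd_diff ab by (auto simp: R1_def)
qed

lemma card_CC: "n \<ge> 1 \<Longrightarrow> card (CC n) = q - 1" using card_image[OF inj_gal_teich] card_R1 by (simp add: CC_def)

lemma CC_subgroup: assumes n: "n \<ge> 1" shows "subgroup (CC n) (GG n)"
proof
  interpret G: group "GG n" using galois_group_is_group[OF n] .
  show "CC n \<subseteq> carrier (GG n)" using gal_carrier[OF n] teich_not_dvd R1_not_dvd by (auto simp: CC_def)
  show "\<one>\<^bsub>GG n\<^esub> \<in> CC n" using gal_teich_CC[OF n not_f_dvd_1] gal_one[OF n] by (simp add: teich_def)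
  fix x assume "x \<in> CC n"
  then obtain a where a: "a \<in> R1" "x = gal n (teich n a)" by (auto simp: CC_def)
  have na: "\<not> f dvd a" using a R1_not_dvd by auto
  obtain a' where a': "f dvd a' * a - 1" using inverse_mod[OF na] .
  then have na': "\<not> f dvd a'" using unit_mod[of 1 a' a] by simp
  have "gal n (teich n a') \<otimes>\<^bsub>GG n\<^esub> x = gal n (teich n (a' * a))"
    using gal_mult[OF n] teich_not_dvd na na' a by (simp add: teich_mult)
  also have "\<dots> = gal n (teich n 1)" by (intro gal_cong n teich_cong a')
  finally have "gal n (teich n a') \<otimes>\<^bsub>GG n\<^esub> x = \<one>\<^bsub>GG n\<^esub>" using gal_one[OF n] by (simp add: teich_def)
  then have "inv\<^bsub>GG n\<^esub> x = gal n (teich n a')"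
    by (rule G.inv_equality) (use gal_carrier n teich_not_dvd na na' a in auto)
  then show "inv\<^bsub>GG n\<^esub> x \<in> CC n" using gal_teich_CC[OF n na'] by simp
  fix y assume "y \<in> CC n"
  then obtain b where b: "b \<in> R1" "y = gal n (teich n b)" by (auto simp: CC_def)
  have "x \<otimes>\<^bsub>GG n\<^esub> y = gal n (teich n (a * b))"
    using gal_mult[OF n] teich_not_dvd R1_not_dvd a b by (simp add: teich_mult)
  then show "x \<otimes>\<^bsub>GG n\<^esub> y \<in> CC n" using gal_teich_CC[OF n not_dvd_mult] R1_not_dvd a b by simp
qed

text \<open>For uniqueness, an element x of a subgroup of order q - 1 satisfies x^q = x, hence
  x^(q^(n-1)) = x; for x = \<open>gal n e\<close> this power is \<open>gal n (teich n e)\<close>, an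
  element of \<open>CC n\<close>.\<close>

lemma subgroup_C_eq: assumes n: "n \<ge> 1" shows "subgroup_C f \<theta> n = CC n"
  unfolding subgroup_C_def cycF_eq[OF n]
proof (rule the_equality)
  show "subgroup (CC n) (GG n) \<and> card (CC n) = CARD('k) ^ degree f - 1"
    using CC_subgroup card_CC n q_def by simp
next
  interpret G: group "GG n" using galois_group_is_group[OF n] .
  fix H assume H: "subgroup H (GG n) \<and> card H = CARD('k) ^ degree f - 1"
  then have cH: "card H = q - 1" by (simp add: q_def)
  then have fin: "finite H" using q_ge_3 by (intro card_ge_0_finite) auto
  have "H \<subseteq> CC n"
  proof
    fix x assume x: "x \<in> H"
    have xG: "x \<in> carrier (GG n)" using H x subgroup.subset by blast
    then obtain e where e: "\<not> f dvd e" "x = gal n e" using galois_is_gal[OF n _ order.refl] by blast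
    interpret H: group "(GG n)\<lparr>carrier := H\<rparr>" using G.subgroup_imp_group H by blast
    have "x [^]\<^bsub>(GG n)\<lparr>carrier := H\<rparr>\<^esub> Coset.order ((GG n)\<lparr>carrier := H\<rparr>) = \<one>\<^bsub>(GG n)\<lparr>carrier := H\<rparr>\<^esub>"
      by (rule H.pow_order_eq_1) (use x in auto)
    then have "x [^]\<^bsub>GG n\<^esub> (q - 1) = \<one>\<^bsub>GG n\<^esub>" using G.nat_pow_consistent cH by (simp add: Coset.order_def)
    then have "x [^]\<^bsub>GG n\<^esub> Suc (q - 1) = x" using xG by simp
    moreover have "Suc (q - 1) = q" using q_ge_3 by simp
    ultimately have xq: "x [^]\<^bsub>GG n\<^esub> q = x" by simp
    have "x [^]\<^bsub>GG n\<^esub> (q ^ k) = x" for k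
    proof (induction k)
      case (Suc k) then show ?case using xq xG by (simp add: G.nat_pow_pow[symmetric] mult.commute)
    qed (use xG in simp)
    then have "x = gal n (teich n e)" using gal_pow[OF n e(1)] e(2) by (simp add: teich_def)
    then show "x \<in> CC n" using gal_teich_CC n e by simp
  qed
  then show "H = CC n" using card_subset_eq[of "CC n" H] cH card_CC[OF n] finite_R1 by (simp add: CC_def)
qed

section \<open>The fields E_n and their generators\<close>

definition EF :: "nat \<Rightarrow> 'k qbar set" where "EF n = {x \<in> QF n. \<forall>c\<in>R1. cj n (teich n c) x = x}"

lemma cycE_eq: "n \<ge> 1 \<Longrightarrow> cycE f \<theta> n = EF n"
  by (auto simp: cycE_def fixed_field_def cycF_eq subgroup_C_eq EF_def CC_def gal_def)

lemma EF_QF: "EF n \<subseteq> QF n" by (auto simp: EF_def)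

lemma EF_fixed: assumes "n \<ge> 1" "x \<in> EF n" "\<not> f dvd t" shows "cj n (teich n t) x = x"
proof -
  have "cj n (teich n t) = cj n (teich n (t mod f))" by (intro conj_cong assms teich_cong dvd_mod_diff)
  then show ?thesis using mod_R1[OF assms(3)] assms by (simp add: EF_def)
qed

lemma EF_subr: assumes "n \<ge> 1" shows "subr (EF n)"
proof -
  interpret F: subr "QF n" by (rule QF_subr)
  show ?thesis
  proof
    show "1 \<in> EF n" using conj_1[OF assms] teich_not_dvd R1_not_dvd F.one_in by (auto simp: EF_def)
    fix x y assume "x \<in> EF n" "y \<in> EF n"
    then show "x - y \<in> EF n" "x * y \<in> EF n"
      using conj_diff[OF assms] conj_mult[OF assms] teich_not_dvd R1_not_dvd F.diff_in F.mult_in by (auto simp: EF_def)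
  qed
qed

lemma EF_inverse: "n \<ge> 1 \<Longrightarrow> x \<in> EF n \<Longrightarrow> inverse x \<in> EF n"
  using conj_inverse teich_not_dvd R1_not_dvd QF_inverse by (auto simp: EF_def)
lemma EF_baseQ: "n \<ge> 1 \<Longrightarrow> baseQ \<subseteq> EF n"
  using conj_fix teich_not_dvd R1_not_dvd QF_baseQ[of n] by (auto simp: EF_def)

lemma EF_Suc: assumes n: "n \<ge> 1" shows "EF n \<subseteq> EF (Suc n)"
proof
  fix x assume x: "x \<in> EF n"
  then have xF: "x \<in> QF n" using EF_QF by auto
  have "cj (Suc n) (teich (Suc n) c) x = x" if "c \<in> R1" for c
  proof -
    have c: "\<not> f dvd c" using R1_not_dvd that by blast
    have "cj (Suc n) (teich (Suc n) c) x = cj n (teich (Suc n) c) x"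
      by (rule conj_Suc[OF n teich_not_dvd[OF c] xF])
    also have "\<dots> = cj n (teich n c) x" using conj_cong[OF n teich_Suc[OF n]] by simp
    finally show ?thesis using EF_fixed[OF n x c] by simp
  qed
  then show "x \<in> EF (Suc n)" using QF_Suc[OF n] xF by (auto simp: EF_def)
qed

definition mp :: "nat \<Rightarrow> 'k poly \<Rightarrow> 'k qbar poly \<Rightarrow> 'k qbar poly" where "mp n e P = map_poly (cj n e) P"

context
  fixes n :: nat and e :: "'k poly"
  assumes n: "n \<ge> 1" and e: "\<not> f dvd e"
begin

lemma coeff_mp: "coeff (mp n e P) j = cj n e (coeff P j)"
  by (simp add: mp_def coeff_map_poly conj_0[OF n e])
lemma mp_mult: "P \<in> polys (QF n) \<Longrightarrow> P' \<in> polys (QF n) \<Longrightarrow> mp n e (P * P') = mp n e P * mp n e P'"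
  by (intro poly_eqI) (simp add: coeff_mp coeff_mult conj_sum[OF n e] conj_mult[OF n e] polysD subr.mult_in[OF QF_subr])
lemma mp_prod: "(\<And>a. a \<in> A \<Longrightarrow> g a \<in> polys (QF n)) \<Longrightarrow> mp n e (\<Prod>a\<in>A. g a) = (\<Prod>a\<in>A. mp n e (g a))"
proof (induction A rule: infinite_finite_induct)
  case (insert x A)
  then show ?case using subr.polys_prod[OF QF_subr, of A g] by (simp add: mp_mult)
qed (auto intro!: poly_eqI simp: coeff_mp conj_1[OF n e] conj_0[OF n e])
lemma mp_linear: "x \<in> QF n \<Longrightarrow> mp n e [:- x, 1:] = [:- cj n e x, 1:]"
  by (intro poly_eqI) (auto simp: coeff_mp coeff_pCons conj_uminus[OF n e] conj_1[OF n e] conj_0[OF n e] split: nat.split)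
end

lemma bij_mult_mod: assumes "\<not> f dvd t" shows "bij_betw (\<lambda>c. (t * c) mod f) R1 R1"
proof -
  have inj: "inj_on (\<lambda>c. (t * c) mod f) R1"
  proof (rule inj_onI)
    fix a b assume ab: "a \<in> R1" "b \<in> R1" "(t * a) mod f = (t * b) mod f"
    then have "f dvd t * (a - b)" by (simp add: mod_eq_dvd_iff right_diff_distrib)
    then have "f dvd a - b" using prime_f assms prime_elem_dvd_mult_iff by blast
    then show "a = b" using R_dvd_diff ab by (auto simp: R1_def)
  qed
  have "(\<lambda>c. (t * c) mod f) ` R1 = R1"
    using mod_R1[OF not_dvd_mult[OF assms R1_not_dvd]] by (intro endo_inj_surj finite_R1 inj) auto
  then show ?thesis using inj by (simp add: bij_betw_def)
qed

lemma prod_teich_reindex: assumes n: "n \<ge> 1" and t: "\<not> f dvd t"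
  shows "(\<Prod>c\<in>R1. g (carlitz_act (teich n t * teich n c) (\<theta> n))) = (\<Prod>c\<in>R1. g (carlitz_act (teich n c) (\<theta> n)))"
proof -
  have "(\<Prod>c\<in>R1. g (carlitz_act (teich n t * teich n c) (\<theta> n))) = (\<Prod>c\<in>R1. g (carlitz_act (teich n ((t * c) mod f)) (\<theta> n)))"
  proof (intro prod.cong refl arg_cong[of _ _ g])
    fix c
    have "f ^ n dvd teich n (t * c) - teich n ((t * c) mod f)" by (intro teich_cong dvd_mod_diff)
    then show "carlitz_act (teich n t * teich n c) (\<theta> n) = carlitz_act (teich n ((t * c) mod f)) (\<theta> n)"
      using act_theta_eq_iff[OF n] by (simp add: teich_mult)
  qed
  also have "\<dots> = (\<Prod>c\<in>R1. g (carlitz_act (teich n c) (\<theta> n)))"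
    by (rule prod.reindex_bij_betw[OF bij_mult_mod[OF t]])
  finally show ?thesis .
qed

definition vp :: "nat \<Rightarrow> 'k qbar" where "vp n = (\<Prod>c\<in>R1. carlitz_act (teich n c) (\<theta> n))"

text \<open>In place of Artin's theorem: the polynomial whose roots are the \<open>q - 1\<close>
  images of \<open>\<theta> n\<close> under \<open>CC n\<close> has coefficients in
  \<open>EF n\<close>, so an automorphism over \<open>EF n\<close> maps \<open>\<theta> n\<close> to
  one of these roots.\<close>

lemma galois_EF: assumes n: "n \<ge> 1" shows "carrier (galois_group (QF n) (EF n)) = CC n"
proof
  show "CC n \<subseteq> carrier (galois_group (QF n) (EF n))"
    using gal_Bij[OF n] gal_ring_hom[OF n] teich_not_dvd R1_not_dvd EF_QF[of n]
    by (auto simp: CC_def carrier_galois gal_def EF_def)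
  show "carrier (galois_group (QF n) (EF n)) \<subseteq> CC n"
  proof
    interpret F: subr "QF n" by (rule QF_subr)
    fix \<sigma> assume s: "\<sigma> \<in> carrier (galois_group (QF n) (EF n))"
    then obtain e where e: "\<not> f dvd e" "\<sigma> = gal n e" using galois_is_gal[OF n _ EF_baseQ[OF n]] by blast
    define P where "P = (\<Prod>c\<in>R1. [:- carlitz_act (teich n c) (\<theta> n), 1:])"
    have lin: "[:- carlitz_act (teich n c) (\<theta> n), 1:] \<in> polys (QF n)" for c
      by (intro F.polys_pCons F.polys_0 F.uminus_in F.one_in QF_act QF_theta)
    have PF: "P \<in> polys (QF n)" unfolding P_def by (intro F.polys_prod lin)
    have "P \<in> polys (EF n)"
    proof (rule polysI)
      fix j
      have "cj n (teich n t) (coeff P j) = coeff P j" if t: "t \<in> R1" for t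
      proof -
        note nt = teich_not_dvd[OF R1_not_dvd[OF t]]
        have "mp n (teich n t) P = (\<Prod>c\<in>R1. [:- carlitz_act (teich n t * teich n c) (\<theta> n), 1:])"
          unfolding P_def using lin
          by (simp add: mp_prod[OF n nt] mp_linear[OF n nt] QF_act QF_theta conj_act[OF n nt] conj_theta[OF n nt])
             (simp add: act_mult[symmetric] mult.commute)
        also have "\<dots> = P" unfolding P_def
          by (rule prod_teich_reindex[OF n R1_not_dvd[OF t], where g = "\<lambda>x. [:- x, 1:]"])
        finally show ?thesis using coeff_mp[OF n nt, where P=P and j=j] by metis
      qed
      then show "coeff P j \<in> EF n" using polysD[OF PF] by (simp add: EF_def)
    qed
    moreover have "poly P (\<theta> n) = 0"
    proof -
      have "1 \<in> R1" using degree_f by (simp add: R1_def R_def)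
      moreover have "carlitz_act (teich n 1) (\<theta> n) = \<theta> n" by (simp add: teich_def carlitz_act_1)
      ultimately show ?thesis using finite_R1 by (auto simp: P_def poly_prod prod_zero_iff intro!: bexI[of _ 1])
    qed
    ultimately have "poly P (\<sigma> (\<theta> n)) = \<sigma> 0"
      using ring_hom_poly[of \<sigma> n "EF n" P "\<theta> n"] s EF_QF subr.zero_in[OF EF_subr[OF n]] QF_theta
      by (auto simp: carrier_galois)
    also have "\<sigma> 0 = 0" using s subr.zero_in[OF EF_subr[OF n]] by (auto simp: carrier_galois)
    finally obtain c where c: "c \<in> R1" "\<sigma> (\<theta> n) = carlitz_act (teich n c) (\<theta> n)"
      using finite_R1 by (auto simp: P_def poly_prod prod_zero_iff)
    then have "carlitz_act e (\<theta> n) = carlitz_act (teich n c) (\<theta> n)"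
      using e QF_theta by (simp add: gal_def conj_theta[OF n])
    then have "\<sigma> = gal n (teich n c)" using act_theta_eq_iff[OF n] gal_cong[OF n] e by simp
    then show "\<sigma> \<in> CC n" using c by (simp add: CC_def)
  qed
qed

lemma varpi_eq: assumes n: "n \<ge> 1" shows "varpi f \<theta> n = vp n"
proof -
  have "varpi f \<theta> n = (\<Prod>\<sigma>\<in>CC n. \<sigma> (\<theta> n))"
    by (simp only: varpi_def galois_norm_def cycF_eq[OF n] cycE_eq[OF n] galois_EF[OF n])
  also have "\<dots> = (\<Prod>c\<in>R1. gal n (teich n c) (\<theta> n))"
    unfolding CC_def by (subst prod.reindex[OF inj_gal_teich[OF n]]) simp
  also have "\<dots> = vp n" unfolding vp_def
    by (intro prod.cong refl) (simp add: gal_def QF_theta conj_theta[OF n] teich_not_dvd R1_not_dvd)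
  finally show ?thesis .
qed

end

section \<open>Values and bases in the fields E_n\<close>

context valring
begin

text \<open>The converse of \<open>veq_trans\<close>: both values are known in units of
  \<open>T\<close>, and \<open>S\<close> becomes the unit.\<close>

lemma veq_rebase:
  assumes T: "T \<in> M" "T \<noteq> 0" and S: "veq T b S" and x: "veq T (k * b) x"
  shows "veq S k x"
proof -
  have "veq T (k * b + (- k) * b) (x * S powi (- k))" by (intro veq_mult T x veq_powi S)
  then show ?thesis by (simp add: veq_def)
qed

text \<open>The error is \<open>e\<close> times an element of \<open>M\<close>, so the value of the
  product minus 1 is that of \<open>e\<close> whenever \<open>of_nat (card A)\<close> is a
  unit.\<close>

lemma prod_one_minus:
  assumes e: "e \<in> M" and A: "finite A" "\<And>a. a \<in> A \<Longrightarrow> w a - 1 \<in> M"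
  shows "\<exists>m\<in>M. (\<Prod>a\<in>A. 1 - e * w a) = 1 - of_nat (card A) * e + e * m"
  using A
proof (induction A rule: finite_induct)
  case empty then show ?case by (intro bexI[of _ 0]) (auto simp: zero_M)
next
  case (insert x A)
  then obtain m where m: "m \<in> M" "(\<Prod>a\<in>A. 1 - e * w a) = 1 - of_nat (card A) * e + e * m" by auto
  define m' where "m' = m - (w x - 1) + e * (w x * (of_nat (card A) - m))"
  have "w x = (w x - 1) + 1" by simp
  then have wV: "w x \<in> V" using insert.prems[of x] M_V add_in one_in by (metis insertI1)
  have "m' \<in> M" unfolding m'_def
    using M_add[OF M_diff[OF m(1) insert.prems[of x]] M_mult_V[OF e mult_in[OF wV diff_in[OF of_nat_in M_V[OF m(1)]]]]]
    by simp
  moreover have "(\<Prod>a\<in>insert x A. 1 - e * w a) = 1 - of_nat (card (insert x A)) * e + e * m'"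
  proof -
    have "(\<Prod>a\<in>insert x A. 1 - e * w a) = (1 - e * w x) * (1 - of_nat (card A) * e + e * m)"
      using insert.hyps m(2) by simp
    then show ?thesis using insert.hyps by (simp add: m'_def algebra_simps)
  qed
  ultimately show ?case by blast
qed

end

context carlitz_tower
begin

lemma EF_veq_theta_factor: assumes n: "n \<ge> 1" and e: "\<not> f dvd e" shows "veq (\<theta> n) 1 (carlitz_act e (\<theta> n))"
  using conj_theta_U[OF n e] by (simp add: veq_def power_int_minus divide_inverse)

lemma vp_theta: assumes n: "n \<ge> 1" shows "veq (\<theta> n) (int (q - 1)) (vp n)"
  using veq_prod[OF theta_M[OF n] theta_nz[OF n] finite_R1 EF_veq_theta_factor[OF n teich_not_dvd[OF R1_not_dvd]]]
  by (simp add: vp_def card_R1)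

lemma vp_nz: "n \<ge> 1 \<Longrightarrow> vp n \<noteq> 0" using veq_nz[OF vp_theta] .
lemma vp_M: assumes n: "n \<ge> 1" shows "vp n \<in> M"
  using M_iff_vge[OF theta_M[OF n] theta_nz[OF n] vp_theta[OF n]] q_ge_3 by simp
text \<open>The ramification index of \<open>EF n\<close> over the base field. It equals the degree,
  so that the powers of \<open>vp n\<close> can serve as a basis.\<close>

lemma vp_f: assumes n: "n \<ge> 1" shows "veq (vp n) (int (q ^ (n - 1))) (emb f)"
proof (rule veq_rebase[OF theta_M[OF n] theta_nz[OF n] vp_theta[OF n]])
  show "veq (\<theta> n) (int (q ^ (n - 1)) * int (q - 1)) (emb f)"
    using theta_f[OF n] by (simp add: N_def mult.commute)
qed

lemma vp_QF: "vp n \<in> QF n"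
  unfolding vp_def by (intro subr.prod_in[OF QF_subr] QF_act QF_theta)

lemma vp_EF: assumes n: "n \<ge> 1" shows "vp n \<in> EF n"
proof -
  have "cj n (teich n t) (vp n) = vp n" if t: "t \<in> R1" for t
  proof -
    note nt = R1_not_dvd[OF t]
    have "cj n (teich n t) (vp n) = (\<Prod>c\<in>R1. carlitz_act (teich n t * teich n c) (\<theta> n))"
      unfolding vp_def
      by (subst conj_prod[OF n teich_not_dvd[OF nt]])
         (simp_all add: QF_act QF_theta conj_act[OF n teich_not_dvd[OF nt]] conj_theta[OF n teich_not_dvd[OF nt]],
          simp add: act_mult[symmetric] mult.commute)
    also have "\<dots> = vp n" unfolding vp_def by (rule prod_teich_reindex[OF n nt])
    finally show ?thesis .
  qed
  then show ?thesis using vp_QF by (auto simp: EF_def)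
qed

lemma vp_Suc: assumes n: "n \<ge> 1" shows "veq (vp (Suc n)) (int q) (vp n)"
proof -
  have n': "Suc n \<ge> 1" by simp
  have "veq (\<theta> (Suc n)) (int q * int (q - 1)) (vp n)"
    by (rule veq_trans[OF theta_M[OF n'] theta_nz[OF n'] theta_Suc[OF n] vp_theta[OF n]])
  then show ?thesis by (rule veq_rebase[OF theta_M[OF n'] theta_nz[OF n'] vp_theta[OF n']])
qed

lemma vp_top: assumes n: "n \<ge> 1" shows "veq (vp (n + k)) (int (q ^ k)) (vp n)"
proof (induction k)
  case 0 then show ?case using veq_self[OF vp_M[OF n] vp_nz[OF n]] by simp
next
  case (Suc k)
  have k: "n + k \<ge> 1" "Suc (n + k) \<ge> 1" using n by auto
  show ?case using veq_trans[OF vp_M[OF k(2)] vp_nz[OF k(2)] vp_Suc[OF k(1)] Suc] by simp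
qed

text \<open>A polynomial of degree below \<open>card A\<close> with the same value at
  \<open>card A\<close> distinct points is constant. This is how an element fixed by a group is
  recognized as lying in the smaller field.\<close>

lemma roots_imp_const:
  assumes A: "finite A" "inj_on g A" and z: "\<And>a. a \<in> A \<Longrightarrow> (\<Sum>l<card A. d l * g a ^ l) = (x::'k qbar)"
    and pos: "card A > 0"
  shows "x = d 0"
proof -
  define P where "P = (\<Sum>l<card A. monom (d l) l) - [:x:]"
  have co: "coeff P j = (if j < card A then d j else 0) - (if j = 0 then x else 0)" for j
    by (simp add: P_def coeff_sum coeff_pCons if_distrib cong: if_cong split: nat.split)
  have "P = 0"
  proof (rule poly_eqI_degree[where A = "g ` A"])
    show "poly P y = poly 0 y" if "y \<in> g ` A" for y
      using that z by (auto simp: P_def poly_sum poly_monom)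
    have "degree P < card A" using co pos by (intro degree_lessI) auto
    then show "degree P < card (g ` A)" "degree (0::'k qbar poly) < card (g ` A)" using A pos by (auto simp: card_image)
  qed
  then show ?thesis using co[of 0] pos by simp
qed

text \<open>The products of powers of \<open>vp n\<close> and \<open>\<theta> n\<close> have the
  values \<open>(q - 1) * k + l\<close>, which run through all numbers below \<open>N n\<close>, so
  they form a basis of \<open>QF n\<close>. Grouped this way, \<open>x\<close> is a polynomial in
  \<open>\<theta> n\<close> of degree below \<open>q - 1\<close> over \<open>EF n\<close>, and
  invariance under \<open>CC n\<close> makes it constant.\<close>

lemma EF_span: assumes n: "n \<ge> 1" and x: "x \<in> EF n"
  shows "\<exists>c. (\<forall>k. c k \<in> baseQ) \<and> x = (\<Sum>k<q ^ (n - 1). c k * vp n ^ k)"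
proof -
  note T = theta_M[OF n] theta_nz[OF n]
  interpret F: subr "QF n" by (rule QF_subr)
  interpret E: subr "EF n" by (rule EF_subr[OF n])
  let ?K = "{..<q ^ (n - 1)} \<times> {..<q - 1}"
  let ?x = "\<lambda>(k, l). vp n ^ k * \<theta> n ^ l"
  have "\<exists>c. (\<forall>k. c k \<in> baseQ) \<and> x = (\<Sum>k\<in>?K. c k * ?x k)"
  proof (rule baseQ_dimension[where y = "\<lambda>k. \<theta> n ^ k" and L = "{..<N n}"])
    show "card {..<N n} \<le> card ?K" by (simp add: N_def card_cartesian_product mult.commute)
    show "\<exists>c. (\<forall>l. c l \<in> baseQ) \<and> x = (\<Sum>l<N n. c l * \<theta> n ^ l)"
      using QF_span[OF n] x EF_QF by blast
    show "\<exists>c. (\<forall>l. c l \<in> baseQ) \<and> ?x k = (\<Sum>l<N n. c l * \<theta> n ^ l)" for k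
      by (rule QF_span[OF n]) (auto simp: case_prod_beta intro!: F.mult_in F.power_in vp_QF QF_theta)
    fix c assume c: "\<And>k. c k \<in> baseQ" "(\<Sum>k\<in>?K. c k * ?x k) = 0"
    show "\<forall>k\<in>?K. c k = 0"
    proof
      fix k assume k: "k \<in> ?K"
      show "c k = 0"
      proof (rule baseQ_sum_values(2)[OF T theta_f[OF n] N_pos, where K = ?K and y = ?x and b = "\<lambda>(k, l). (q - 1) * k + l"])
        fix k assume "k \<in> ?K"
        have "veq (\<theta> n) (int (fst k) * int (q - 1) + int (snd k) * 1) (vp n ^ fst k * \<theta> n ^ snd k)"
          by (intro veq_mult T veq_power vp_theta n veq_self)
        then show "veq (\<theta> n) (int ((\<lambda>(k, l). (q - 1) * k + l) k)) (?x k)"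
          using q_ge_3 by (simp add: case_prod_beta mult.commute of_nat_diff)
      next
        fix k l assume k: "k \<in> ?K" "l \<in> ?K" "(\<lambda>(k, l). (q - 1) * k + l) k = (\<lambda>(k, l). (q - 1) * k + l) l"
        obtain a b a' b' where [simp]: "k = (a, b)" "l = (a', b')" by (cases k, cases l)
        have "((q - 1) * a + b) div (q - 1) = a" "((q - 1) * a' + b') div (q - 1) = a'" using k(1,2) by auto
        moreover have e: "(q - 1) * a + b = (q - 1) * a' + b'" using k(3) by simp
        ultimately have "a = a'" by metis
        then show "k = l" using e by simp
      next
        fix k assume k: "k \<in> ?K"
        obtain a b where ab: "k = (a, b)" by (cases k)
        then have "a + 1 \<le> q ^ (n - 1)" "b < q - 1" using k by auto
        then have "(q - 1) * a + b < (q - 1) * (a + 1)" "(q - 1) * (a + 1) \<le> (q - 1) * q ^ (n - 1)"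
          by (simp, intro mult_le_mono2)
        then show "(\<lambda>(k, l). (q - 1) * k + l) k < N n" unfolding ab N_def by simp
      qed (use c k in auto)
    qed
  qed auto
  then obtain c where c: "\<And>k. c k \<in> baseQ" "x = (\<Sum>k\<in>?K. c k * ?x k)" by blast
  define d where "d l = (\<Sum>k<q ^ (n - 1). c (k, l) * vp n ^ k)" for l
  have cE: "c k \<in> EF n" for k using c(1) EF_baseQ[OF n] by blast
  have dE: "d l \<in> EF n" for l unfolding d_def by (intro E.sum_in E.mult_in E.power_in vp_EF n cE)
  have dF: "d l \<in> QF n" for l using dE EF_QF by blast
  have xd: "x = (\<Sum>l<q - 1. d l * \<theta> n ^ l)"
  proof -
    have "x = (\<Sum>k<q ^ (n - 1). \<Sum>l<q - 1. c (k, l) * (vp n ^ k * \<theta> n ^ l))"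
      unfolding c(2) by (simp add: sum.cartesian_product case_prod_beta)
    also have "\<dots> = (\<Sum>l<q - 1. \<Sum>k<q ^ (n - 1). c (k, l) * (vp n ^ k * \<theta> n ^ l))" by (rule sum.swap)
    finally show ?thesis by (simp add: d_def sum_distrib_right mult.assoc)
  qed
  have "x = d 0"
  proof (rule roots_imp_const[OF finite_R1, where g = "\<lambda>c. carlitz_act (teich n c) (\<theta> n)"])
    show "inj_on (\<lambda>c. carlitz_act (teich n c) (\<theta> n)) R1"
    proof (rule inj_onI)
      fix a b assume ab: "a \<in> R1" "b \<in> R1" "carlitz_act (teich n a) (\<theta> n) = carlitz_act (teich n b) (\<theta> n)"
      then have "f dvd a - b" using teich_inj[OF n] act_theta_eq_iff[OF n] by simp
      then show "a = b" using R_dvd_diff ab by (auto simp: R1_def)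
    qed
    fix a assume a: "a \<in> R1"
    note nt = teich_not_dvd[OF R1_not_dvd[OF a]]
    have "x = cj n (teich n a) x" using x a by (simp add: EF_def)
    also have "\<dots> = (\<Sum>l<q - 1. d l * carlitz_act (teich n a) (\<theta> n) ^ l)"
      unfolding xd using dE a dF QF_theta
      by (subst conj_sum[OF n nt]) (auto simp: conj_mult[OF n nt] conj_power[OF n nt] conj_theta[OF n nt] EF_def
          F.mult_in F.power_in intro!: F.mult_in F.power_in)
    finally show "(\<Sum>l<card R1. d l * carlitz_act (teich n a) (\<theta> n) ^ l) = x" by (simp add: card_R1)
  qed (use card_R1 q_ge_3 in auto)
  then show ?thesis using c(1) by (intro exI[of _ "\<lambda>k. c (k, 0)"]) (simp add: d_def)
qed

lemma vp_power: "n \<ge> 1 \<Longrightarrow> veq (vp n) (int k) (vp n ^ k)"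
  using veq_power[OF vp_M vp_nz veq_self[OF vp_M vp_nz]] by simp

lemma q_pow_pos: "q ^ k > 0" using q_ge_3 by simp

lemma EF_veq: assumes n: "n \<ge> 1" and x: "x \<in> EF n" "x \<noteq> 0" obtains k where "veq (vp n) k x"
proof -
  obtain c where c: "\<And>k. c k \<in> baseQ" "x = (\<Sum>k<q ^ (n - 1). c k * vp n ^ k)" using EF_span n x by blast
  have "\<exists>k\<in>{..<q ^ (n - 1)}. \<exists>m. c k \<noteq> 0 \<and> veq (vp n) (int (q ^ (n - 1)) * m + int k) (\<Sum>k<q ^ (n - 1). c k * vp n ^ k)"
    by (rule baseQ_sum_values(3)[OF vp_M[OF n] vp_nz[OF n] vp_f[OF n] q_pow_pos, where b="\<lambda>k. k"])
       (use vp_power[OF n] x c in auto)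
  then show ?thesis using that c by metis
qed

lemma baseQ_veq_vp: assumes n: "n \<ge> 1" and c: "c \<in> baseQ" "c \<noteq> 0" obtains m where "veq (vp n) (int (q ^ (n - 1)) * m) c"
proof -
  obtain m where "veq (emb f) m c" using baseQ_veq c by blast
  then show ?thesis using that veq_trans[OF vp_M[OF n] vp_nz[OF n] vp_f[OF n]] by blast
qed

lemma EF_span_V: assumes n: "n \<ge> 1" and x: "x \<in> EF n" "x \<in> V"
  shows "\<exists>c. (\<forall>k. c k \<in> baseQ \<inter> V) \<and> x = (\<Sum>k<q ^ (n - 1). c k * vp n ^ k)"
proof -
  note T = vp_M[OF n] vp_nz[OF n]
  obtain c where c: "\<And>k. c k \<in> baseQ" "x = (\<Sum>k<q ^ (n - 1). c k * vp n ^ k)" using EF_span n x by blast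
  have cV: "c k \<in> V" if "k < q ^ (n - 1)" for k
  proof (cases "c k = 0")
    case False
    have "vge (vp n) 0 (c k * vp n ^ k)"
      by (rule baseQ_sum_values(1)[OF T vp_f[OF n] q_pow_pos, where K="{..<q ^ (n - 1)}" and b="\<lambda>k. k"])
         (use vp_power[OF n] c assms that in \<open>auto simp: vge_0_iff\<close>)
    moreover obtain m where m: "veq (vp n) (int (q ^ (n - 1)) * m) (c k)" using baseQ_veq_vp[OF n c(1) False] .
    ultimately have "0 \<le> int (q ^ (n - 1)) * m + int k" using veq_vge_iff[OF T veq_mult[OF T m vp_power[OF n]]] by blast
    moreover have "int k < int (q ^ (n - 1))" using that by simp
    ultimately have "int (q ^ (n - 1)) * (m + 1) > 0" unfolding distrib_left by linarith
    then have "m \<ge> 0" by (simp add: zero_less_mult_iff)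
    then have "vge (vp n) 0 (c k)" using veq_vge_iff[OF T m] by simp
    then show ?thesis by (simp add: vge_0_iff)
  qed simp
  show ?thesis
    by (intro exI[of _ "\<lambda>k. if k < q ^ (n - 1) then c k else 0"]) (use c cV in auto)
qed

text \<open>In units of \<open>vp (Suc n)\<close> the products of powers of \<open>vp n\<close> and
  \<open>vp (Suc n)\<close> have the values \<open>q * k + l\<close>, all numbers below
  \<open>q ^ n\<close>; grouping by \<open>l\<close> gives coefficients in
  \<open>EF n\<close>.\<close>

lemma EF_Suc_span: assumes n: "n \<ge> 1" and x: "x \<in> EF (Suc n)"
  shows "\<exists>c. (\<forall>l. c l \<in> EF n) \<and> x = (\<Sum>l<q. c l * vp (Suc n) ^ l)"
proof -
  have n': "Suc n \<ge> 1" by simp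
  note T = vp_M[OF n'] vp_nz[OF n']
  interpret E: subr "EF n" by (rule EF_subr[OF n])
  interpret E': subr "EF (Suc n)" by (rule EF_subr[OF n'])
  let ?K = "{..<q ^ (n - 1)} \<times> {..<q}"
  let ?x = "\<lambda>(k, l). vp n ^ k * vp (Suc n) ^ l"
  have vf: "veq (vp (Suc n)) (int (q ^ n)) (emb f)" using vp_f[OF n'] by simp
  have qn: "q * q ^ (n - 1) = q ^ n" using n by (cases n) auto
  have "\<exists>c. (\<forall>k. c k \<in> baseQ) \<and> x = (\<Sum>k\<in>?K. c k * ?x k)"
  proof (rule baseQ_dimension[where y = "\<lambda>k. vp (Suc n) ^ k" and L = "{..<q ^ n}"])
    show "card {..<q ^ n} \<le> card ?K" using qn by (simp add: card_cartesian_product mult.commute)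
    show "\<exists>c. (\<forall>l. c l \<in> baseQ) \<and> x = (\<Sum>l<q ^ n. c l * vp (Suc n) ^ l)"
      using EF_span[OF n' x] by simp
    show "\<exists>c. (\<forall>l. c l \<in> baseQ) \<and> ?x k = (\<Sum>l<q ^ n. c l * vp (Suc n) ^ l)" for k
      using EF_span[OF n', of "?x k"] vp_EF n EF_Suc[OF n] by (auto simp: case_prod_beta intro!: E'.mult_in E'.power_in)
    fix c assume c: "\<And>k. c k \<in> baseQ" "(\<Sum>k\<in>?K. c k * ?x k) = 0"
    show "\<forall>k\<in>?K. c k = 0"
    proof
      fix k assume k: "k \<in> ?K"
      show "c k = 0"
      proof (rule baseQ_sum_values(2)[OF T vf q_pow_pos, where K = ?K and y = ?x and b = "\<lambda>(k, l). q * k + l"])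
        fix k assume "k \<in> ?K"
        have "veq (vp (Suc n)) (int (fst k) * int q + int (snd k)) (vp n ^ fst k * vp (Suc n) ^ snd k)"
          by (intro veq_mult T veq_power vp_Suc n vp_power n')
        then show "veq (vp (Suc n)) (int ((\<lambda>(k, l). q * k + l) k)) (?x k)"
          by (simp add: case_prod_beta mult.commute)
      next
        fix k l assume k: "k \<in> ?K" "l \<in> ?K" "(\<lambda>(k, l). q * k + l) k = (\<lambda>(k, l). q * k + l) l"
        obtain a b a' b' where [simp]: "k = (a, b)" "l = (a', b')" by (cases k, cases l)
        have "(q * a + b) div q = a" "(q * a' + b') div q = a'" using k(1,2) by auto
        moreover have e: "q * a + b = q * a' + b'" using k(3) by simp
        ultimately have "a = a'" by metis
        then show "k = l" using e by simp
      next
        fix k assume k: "k \<in> ?K"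
        obtain a b where ab: "k = (a, b)" by (cases k)
        then have "a + 1 \<le> q ^ (n - 1)" "b < q" using k by auto
        then have "q * a + b < q * (a + 1)" "q * (a + 1) \<le> q * q ^ (n - 1)"
          by (simp, intro mult_le_mono2)
        then show "(\<lambda>(k, l). q * k + l) k < q ^ n" unfolding ab qn by simp
      qed (use c k in auto)
    qed
  qed auto
  then obtain c where c: "\<And>k. c k \<in> baseQ" "x = (\<Sum>k\<in>?K. c k * ?x k)" by blast
  define d where "d l = (\<Sum>k<q ^ (n - 1). c (k, l) * vp n ^ k)" for l
  have cE: "c k \<in> EF n" for k using c(1) EF_baseQ[OF n] by blast
  have dE: "d l \<in> EF n" for l unfolding d_def by (intro E.sum_in E.mult_in E.power_in vp_EF n cE)
  have "x = (\<Sum>k<q ^ (n - 1). \<Sum>l<q. c (k, l) * (vp n ^ k * vp (Suc n) ^ l))"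
    unfolding c(2) by (simp add: sum.cartesian_product case_prod_beta)
  also have "\<dots> = (\<Sum>l<q. \<Sum>k<q ^ (n - 1). c (k, l) * (vp n ^ k * vp (Suc n) ^ l))" by (rule sum.swap)
  finally have "x = (\<Sum>l<q. d l * vp (Suc n) ^ l)" by (simp add: d_def sum_distrib_right mult.assoc)
  then show ?thesis using dE by blast
qed

lemma act_f_teich: assumes n: "n \<ge> 1"
  shows "carlitz_act f (carlitz_act (teich (Suc n) c) (\<theta> (Suc n))) = carlitz_act (teich n c) (\<theta> n)"
proof -
  have "carlitz_act f (carlitz_act (teich (Suc n) c) (\<theta> (Suc n))) = carlitz_act (teich (Suc n) c) (\<theta> n)"
    using act_f_theta[OF n] by (metis act_mult mult.commute)
  also have "\<dots> = carlitz_act (teich n c) (\<theta> n)" using act_theta_eq_iff[OF n] teich_Suc[OF n] by blast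
  finally show ?thesis .
qed

text \<open>Corresponding factors of the two products satisfy x^q = y (1 - e w) with w congruent to
  1 and e = f \<theta>_(n+1) / \<theta>_n. Multiplying them, the linear terms add up to q - 1 copies
  of e; as q - 1 is -1 in the field, they do not cancel and the value is exact.\<close>

lemma vp_congruence: assumes n: "n \<ge> 1"
  shows "veq (vp (Suc n)) (int (q ^ n) + int q - 1) (vp n - vp (Suc n) ^ q)"
proof -
  have n': "Suc n \<ge> 1" by simp
  let ?t = "\<theta> (Suc n)" and ?s = "\<theta> n"
  note T = theta_M[OF n'] theta_nz[OF n'] and S = theta_M[OF n] theta_nz[OF n]
  define x where "x c = carlitz_act (teich (Suc n) c) ?t" for c
  define y where "y c = carlitz_act (teich n c) ?s" for c
  define e where "e = emb f * ?t / ?s"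
  define w where "w c = (x c / ?t) / (y c / ?s) * sf (x c)" for c
  have "veq ?t (int (N (Suc n)) + 1 - int q) e" unfolding e_def
    by (intro veq_divide veq_mult T theta_f n' veq_self theta_Suc n)
  moreover have "int (N (Suc n)) + 1 - int q > 0"
  proof -
    have "N (Suc n) = (q - 1) * q ^ n" by (simp add: N_def)
    moreover have "2 * q \<le> (q - 1) * q ^ n" using q_ge_3 n
      by (intro mult_le_mono) (auto intro: self_le_power)
    ultimately have "2 * q \<le> N (Suc n)" by simp
    then show ?thesis by linarith
  qed
  ultimately have ev: "veq ?t (int (N (Suc n)) + 1 - int q) e" and eM: "e \<in> M"
    using M_iff_vge[OF T] by blast+
  have xq: "x c ^ q = y c * (1 - e * w c)" and wM: "w c - 1 \<in> M" if c: "c \<in> R1" for c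
  proof -
    note nc = R1_not_dvd[OF c]
    have y: "y c = x c ^ q + emb f * x c * sf (x c)"
      using act_f_teich[OF n, of c] by (simp add: x_def y_def act_f_sf)
    have ynz: "y c \<noteq> 0" unfolding y_def using act_theta_eq_0_iff[OF n] teich_not_dvd[OF nc]
      by (metis n dvd_trans dvd_power zero_less_one_class.zero_less_one less_le_trans)
    show "x c ^ q = y c * (1 - e * w c)"
    proof -
      have "e * w c = emb f * x c * sf (x c) / y c" using T S by (simp add: e_def w_def)
      then have "y c * (1 - e * w c) = y c - emb f * x c * sf (x c)" using ynz by (simp add: right_diff_distrib)
      then show ?thesis using y by simp
    qed
    obtain z where z: "z \<in> V" "x c = ?t * (emb (teich (Suc n) c) + ?t * z)"
      using act_expand[OF theta_V[OF n']] x_def by metis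
    obtain z' where z': "z' \<in> V" "y c = ?s * (emb (teich n c) + ?s * z')"
      using act_expand[OF theta_V[OF n]] y_def by metis
    define a where "a = x c / ?t"
    define b where "b = y c / ?s"
    have ab: "a = emb (teich (Suc n) c) + ?t * z" "b = emb (teich n c) + ?s * z'"
      using z z' T S by (simp_all add: a_def b_def)
    have bU: "b \<in> U" unfolding ab by (rule U_add_M[OF emb_U[OF teich_not_dvd[OF nc]] M_mult_V[OF S(1) z'(1)]])
    have "f dvd teich (Suc n) c - teich n c" using teich_Suc[OF n, of c] n dvd_trans[OF dvd_power[of n f]] by auto
    then have "emb (teich (Suc n) c) - emb (teich n c) \<in> M" using emb_M by fastforce
    then have "(emb (teich (Suc n) c) - emb (teich n c)) + (?t * z - ?s * z') \<in> M"
      by (rule M_add[OF _ M_diff[OF M_mult_V[OF T(1) z(1)] M_mult_V[OF S(1) z'(1)]]])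
    then have "a - b \<in> M" unfolding ab by (simp add: algebra_simps)
    then have "(a - b) * inverse b \<in> M" by (rule M_mult_V[OF _ U_V[OF U_inverse[OF bU]]])
    then have r: "a / b - 1 \<in> M" using U_nz[OF bU] by (simp add: field_simps)
    have xM: "x c \<in> M" unfolding z(2) by (rule M_mult_V[OF T(1) add_in[OF emb_V mult_in[OF theta_V[OF n'] z(1)]]])
    have "w c - 1 = (a / b - 1) * sf (x c) + (sf (x c) - 1)" by (simp add: w_def a_def b_def algebra_simps)
    then show "w c - 1 \<in> M" using M_add[OF M_mult_V[OF r U_V[OF sf_U[OF xM]]] sf_M[OF xM]] by metis
  qed
  obtain m where m: "m \<in> M" "(\<Prod>c\<in>R1. 1 - e * w c) = 1 - of_nat (card R1) * e + e * m"
    using prod_one_minus[OF eM finite_R1, of w] wM by blast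
  have q1: "of_nat (card R1) = (-1 :: 'k qbar)"
  proof -
    have "q = Suc (q - 1)" using q_ge_3 by simp
    then have "of_nat q = (of_nat (q - 1) + 1 :: 'k qbar)" by (metis of_nat_Suc add.commute)
    then show ?thesis by (simp add: card_R1 eq_neg_iff_add_eq_0)
  qed
  have "vp (Suc n) ^ q = (\<Prod>c\<in>R1. x c ^ q)" by (simp add: vp_def x_def prod_power_distrib)
  also have "\<dots> = vp n * (\<Prod>c\<in>R1. 1 - e * w c)"
    using xq by (simp add: vp_def y_def prod.distrib)
  finally have "vp n - vp (Suc n) ^ q = - (vp n * e * (1 + m))"
    unfolding m(2) q1 by (simp add: algebra_simps)
  moreover have "veq ?t (int q * int (q - 1) + (int (N (Suc n)) + 1 - int q) + 0) (vp n * e * (1 + m))"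
    by (intro veq_mult T ev veq_trans[OF T theta_Suc[OF n] vp_theta[OF n]])
       (use U_add_M[OF one_U m(1)] in \<open>simp add: veq_0_iff\<close>)
  ultimately have "veq ?t (int q * int (q - 1) + (int (N (Suc n)) + 1 - int q) + 0) (vp n - vp (Suc n) ^ q)"
    using veq_uminus by metis
  \<comment> \<open>The left side counts in units of \<open>\<theta> (Suc n)\<close>; as
    \<open>vp (Suc n)\<close> counts \<open>q - 1\<close> there, the first factor on the right is
    the value sought.\<close>
  moreover have "int q * int (q - 1) + (int (N (Suc n)) + 1 - int q) + 0 = (int (q ^ n) + int q - 1) * int (q - 1)"
    using q_ge_3 by (simp add: N_def of_nat_diff algebra_simps)
  ultimately show ?thesis using veq_rebase[OF T vp_theta[OF n']] by metis
qed

end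

section \<open>One step of the tower\<close>

text \<open>Newton's identities, read off from the derivative of \<open>nu\<close>.\<close>
lemma newton_power_sums:
  fixes x :: "'b \<Rightarrow> 'a::field"
  assumes A: "finite A" and nu: "nu = (\<Prod>a\<in>A. [:- x a, 1:])" and l: "l < card A"
  shows "(\<Sum>a\<in>A. x a ^ l) = of_nat (card A - l) * coeff nu (card A - l)
           - (\<Sum>i<l. coeff nu (card A - l + i) * (\<Sum>a\<in>A. x a ^ i))"
proof -
  let ?q = "card A"
  define S where "S a = (\<Prod>b\<in>A - {a}. [:- x b, 1:])" for a
  have nuS: "nu = [:- x a, 1:] * S a" if "a \<in> A" for a unfolding nu S_def using A that by (rule prod.remove)
  have co: "coeff (S a) j = coeff nu (Suc j) + x a * coeff (S a) (Suc j)" if "a \<in> A" for a j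
    by (simp add: nuS[OF that])
  have dS: "degree (S a) = ?q - 1" if "a \<in> A" for a
    unfolding S_def by (subst degree_prod_eq_sum_degree) (use A that in auto)
  have qpos: "?q > 0" using l by simp
  \<comment> \<open>Horner's scheme for dividing \<open>nu\<close> by X - \<open>x a\<close>, read
    from the leading coefficient down.\<close>
  have *: "coeff (S a) (?q - k) = (\<Sum>i<k. coeff nu (?q - k + 1 + i) * x a ^ i)" if a: "a \<in> A" and k: "k \<le> ?q" for a k
    using k
  proof (induction k)
    case 0
    have "degree (S a) < ?q" using dS[OF a] qpos by simp
    then show ?case by (simp add: coeff_eq_0)
  next
    case (Suc k)
    have "Suc (?q - Suc k) = ?q - k" using Suc.prems by simp
    then have "coeff (S a) (?q - Suc k) = coeff nu (?q - k) + x a * (\<Sum>i<k. coeff nu (?q - k + 1 + i) * x a ^ i)"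
      using co[OF a, of "?q - Suc k"] Suc by simp
    also have "\<dots> = (\<Sum>i<Suc k. coeff nu (?q - k + i) * x a ^ i)"
      by (subst sum.lessThan_Suc_shift) (simp add: sum_distrib_left mult_ac)
    also have "\<dots> = (\<Sum>i<Suc k. coeff nu (?q - Suc k + 1 + i) * x a ^ i)"
      using Suc.prems by (simp add: Suc_diff_Suc)
    finally show ?case .
  qed
  define j where "j = ?q - Suc l"
  have j: "Suc j = ?q - l" using l by (simp add: j_def)
  have mon: "coeff nu ?q = 1"
  proof -
    have "degree nu = ?q" unfolding nu by (subst degree_prod_eq_sum_degree) auto
    moreover have "lead_coeff nu = 1" unfolding nu by (simp add: lead_coeff_prod)
    ultimately show ?thesis by simp
  qed
  have "of_nat (Suc j) * coeff nu (Suc j) = coeff (pderiv nu) j" by (simp add: coeff_pderiv)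
  also have "pderiv nu = (\<Sum>a\<in>A. S a)" unfolding nu S_def by (simp add: pderiv_prod pderiv_pCons)
  also have "coeff (\<Sum>a\<in>A. S a) j = (\<Sum>a\<in>A. \<Sum>i<Suc l. coeff nu (Suc j + i) * x a ^ i)"
    unfolding coeff_sum using *[of _ "Suc l"] l by (intro sum.cong refl) (simp add: j_def Suc_diff_Suc)
  also have "\<dots> = (\<Sum>i<Suc l. coeff nu (Suc j + i) * (\<Sum>a\<in>A. x a ^ i))"
    by (subst sum.swap) (simp add: sum_distrib_left)
  also have "\<dots> = (\<Sum>i<l. coeff nu (Suc j + i) * (\<Sum>a\<in>A. x a ^ i)) + coeff nu ?q * (\<Sum>a\<in>A. x a ^ l)"
    using l j by simp
  finally show ?thesis unfolding mon j by simp
qed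

lemma coeff_pcompose_monom:
  fixes P :: "'a::comm_semiring_1 poly"
  assumes "m > 0"
  shows "coeff (pcompose P (monom 1 m)) j = (if m dvd j then coeff P (j div m) else 0)"
proof (induction P arbitrary: j rule: pCons_induct)
  case (pCons a P)
  have "coeff (pcompose (pCons a P) (monom 1 m)) j
      = (if j = 0 then a else 0) + (if j < m then 0 else coeff (pcompose P (monom 1 m)) (j - m))"
    by (simp add: pcompose_pCons coeff_monom_mult coeff_pCons split: nat.split)
  also have "\<dots> = (if m dvd j then coeff (pCons a P) (j div m) else 0)"
  proof (cases "j < m")
    case True
    then show ?thesis using assms by (auto dest: dvd_imp_le)
  next
    case False
    then obtain i where i: "j = m + i" using le_Suc_ex not_less by blast
    then show ?thesis using pCons.IH[of i] assms by (simp add: coeff_pCons)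
  qed
  finally show ?case .
qed simp

context carlitz_tower
begin

text \<open>For \<open>c \<in> R\<close> the maps \<open>An n c\<close> restrict to the automorphisms of \<open>EF (n + 1)\<close> over \<open>EF n\<close>.\<close>
definition An :: "nat \<Rightarrow> 'k poly \<Rightarrow> 'k qbar \<Rightarrow> 'k qbar" where "An n c = cj (Suc n) (1 + f ^ n * c)"
definition Ap :: "nat \<Rightarrow> 'k poly \<Rightarrow> 'k qbar poly \<Rightarrow> 'k qbar poly" where "Ap n c = mp (Suc n) (1 + f ^ n * c)"
definition Nm :: "nat \<Rightarrow> 'k qbar poly \<Rightarrow> 'k qbar poly" where "Nm n P = (\<Prod>c\<in>R. Ap n c P)"
definition Tr :: "nat \<Rightarrow> 'k qbar \<Rightarrow> 'k qbar" where "Tr n b = (\<Sum>c\<in>R. An n c b)"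
abbreviation Xq :: "'k qbar poly \<Rightarrow> 'k qbar poly" where "Xq P \<equiv> pcompose P (monom 1 q)"

lemma q_pos: "q > 0" using q_ge_3 by simp
lemmas coeff_Xq = coeff_pcompose_monom[OF q_pos]

context
  fixes n :: nat
  assumes n: "n \<ge> 1"
begin

lemma n1: "Suc n \<ge> 1" by simp

lemma An_unit: "\<not> f dvd 1 + f ^ n * c"
proof
  assume "f dvd 1 + f ^ n * c"
  moreover have "f dvd f ^ n * c" using n by (simp add: dvd_mult2 dvd_power)
  ultimately show False using not_f_dvd_1 dvd_add_left_iff by blast
qed

lemmas An_mult = conj_mult[OF n1 An_unit, folded An_def]
lemmas An_add = conj_add[OF n1 An_unit, folded An_def]
lemmas An_sum = conj_sum[OF n1 An_unit, folded An_def]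
lemmas An_prod = conj_prod[OF n1 An_unit, folded An_def]
lemmas An_power = conj_power[OF n1 An_unit, folded An_def]
lemmas An_uminus = conj_uminus[OF n1 An_unit, folded An_def]
lemmas An_zero = conj_0[OF n1 An_unit, folded An_def]
lemmas An_one = conj_1[OF n1 An_unit, folded An_def]
lemmas An_base = conj_fix[OF n1 An_unit, folded An_def]
lemmas An_QF = conj_QF[OF n1 An_unit, folded An_def]
lemmas An_V = conj_V[OF n1 An_unit, folded An_def]
lemmas An_vge = conj_vge[OF n1 An_unit, folded An_def]
lemmas coeff_Ap = coeff_mp[OF n1 An_unit, folded An_def Ap_def]
lemmas Ap_mult = mp_mult[OF n1 An_unit, folded Ap_def]
lemmas Ap_prod = mp_prod[OF n1 An_unit, folded Ap_def]
lemmas Ap_linear = mp_linear[OF n1 An_unit, folded Ap_def An_def]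

lemma An_EF: assumes x: "x \<in> EF (Suc n)" shows "An n c x \<in> EF (Suc n)"
proof -
  have xF: "x \<in> QF (Suc n)" using x EF_QF by blast
  have "cj (Suc n) (teich (Suc n) a) (An n c x) = An n c x" if a: "a \<in> R1" for a
  proof -
    note na = teich_not_dvd[OF R1_not_dvd[OF a]]
    have "cj (Suc n) (teich (Suc n) a) (An n c x) = An n c (cj (Suc n) (teich (Suc n) a) x)"
      unfolding An_def using conj_conj[OF n1 na An_unit xF] conj_conj[OF n1 An_unit na xF] by (simp add: mult.commute)
    then show ?thesis using x a by (simp add: EF_def)
  qed
  then show ?thesis using An_QF[OF xF] by (simp add: EF_def)
qed

lemma An_fix: assumes x: "x \<in> EF n" shows "An n c x = x"
proof -
  have xF: "x \<in> QF n" using x EF_QF by blast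
  have "An n c x = cj n (1 + f ^ n * c) x" unfolding An_def by (rule conj_Suc[OF n An_unit xF])
  also have "\<dots> = cj n 1 x" using conj_cong[OF n, of "1 + f ^ n * c" 1] by simp
  finally show ?thesis using conj_one[OF n xF] by simp
qed

text \<open>The product of the two multipliers is \<open>1 + f ^ n * (c' + c)\<close> up to a
  multiple of \<open>f ^ (n + n)\<close>, and \<open>n + n \<ge> Suc n\<close>; so the maps compose
  like the additive group \<open>R\<close>.\<close>

lemma An_An: assumes x: "x \<in> QF (Suc n)" shows "An n c (An n c' x) = An n (c' + c) x"
proof -
  have "f ^ Suc n dvd (1 + f ^ n * c') * (1 + f ^ n * c) - (1 + f ^ n * (c' + c))"
  proof -
    have "(1 + f ^ n * c') * (1 + f ^ n * c) - (1 + f ^ n * (c' + c)) = f ^ (n + n) * (c * c')"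
      by (simp add: algebra_simps power_add)
    moreover have "f ^ Suc n dvd f ^ (n + n)" using n by (intro le_imp_power_dvd) simp
    ultimately show ?thesis using dvd_mult2 by metis
  qed
  then show ?thesis unfolding An_def using conj_conj[OF n1 An_unit An_unit x] conj_cong[OF n1] by metis
qed

lemma An_0: "x \<in> QF (Suc n) \<Longrightarrow> An n 0 x = x" using conj_one[OF n1] by (simp add: An_def)

text \<open>If \<open>d = c - c'\<close> acts trivially on \<open>vp (Suc n)\<close>, it fixes
  \<open>EF (Suc n)\<close>, so its multiplier is a multiplicative lift modulo
  \<open>f ^ Suc n\<close>. Being 1 modulo \<open>f\<close>, this lift is 1, hence \<open>f\<close>
  divides \<open>d\<close>.\<close>

lemma An_inj: assumes c: "c \<in> R" "c' \<in> R" and e: "An n c (vp (Suc n)) = An n c' (vp (Suc n))" shows "c = c'"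
proof -
  let ?v = "vp (Suc n)"
  have vF: "?v \<in> QF (Suc n)" by (rule vp_QF)
  define d where "d = c - c'"
  have dR: "d \<in> R" using c R_diff by (simp add: d_def)
  have "An n (- c') (An n c ?v) = An n (- c') (An n c' ?v)" using e by simp
  then have fix_v: "An n d ?v = ?v" using An_An[OF vF] An_0[OF vF] by (simp add: d_def)
  have fix_E: "An n d x = x" if x: "x \<in> EF (Suc n)" for x
  proof -
    obtain a where a: "\<And>k. a k \<in> baseQ" "x = (\<Sum>k<q ^ n. a k * ?v ^ k)" using EF_span[OF n1 x] by auto
    have aF: "a k \<in> QF (Suc n)" "?v ^ k \<in> QF (Suc n)" for k
      using a(1) QF_baseQ[of "Suc n"] subr.power_in[OF QF_subr vF] by auto
    show ?thesis unfolding a(2)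
      by (subst An_sum) (auto simp: aF An_mult An_power[OF vF] An_base a(1) fix_v subr.mult_in[OF QF_subr])
  qed
  have "gal (Suc n) (1 + f ^ n * d) \<in> carrier (galois_group (QF (Suc n)) (EF (Suc n)))"
    using gal_Bij[OF n1 An_unit] gal_ring_hom[OF n1 An_unit] fix_E EF_QF[of "Suc n"]
    by (auto simp: carrier_galois gal_def An_def)
  then obtain a where a: "a \<in> R1" "gal (Suc n) (1 + f ^ n * d) = gal (Suc n) (teich (Suc n) a)"
    unfolding galois_EF[OF n1] CC_def by blast
  then have dv: "f ^ Suc n dvd (1 + f ^ n * d) - teich (Suc n) a"
    using gal_eq_iff[OF n1 An_unit teich_not_dvd[OF R1_not_dvd[OF a(1)]]] by simp
  have "f dvd (1 + f ^ n * d) - teich (Suc n) a" using dvd_trans[OF _ dv, of f] by simp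
  moreover have "f dvd f ^ n * d" using n by (simp add: dvd_mult2 dvd_power)
  ultimately have "f dvd ((1 + f ^ n * d) - teich (Suc n) a) - f ^ n * d + (teich (Suc n) a - a)"
    by (rule dvd_add[OF dvd_diff teich_mod_f])
  then have "f dvd 1 - a" by simp
  then have "f ^ Suc n dvd teich (Suc n) 1 - teich (Suc n) a" by (rule teich_cong)
  then have "f ^ Suc n dvd 1 - teich (Suc n) a" by (simp add: teich_def)
  from dvd_diff[OF dv this]
  have "f ^ Suc n dvd ((1 + f ^ n * d) - teich (Suc n) a) - (1 - teich (Suc n) a)" .
  then have "f ^ n * f dvd f ^ n * d" by (simp add: mult.commute)
  then have "f dvd d" using f_nz by simp
  then show ?thesis using R_dvd[OF dR] by (simp add: d_def)
qed

lemma bij_add_R: assumes "c \<in> R" shows "bij_betw (\<lambda>b. b + c) R R"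
  by (rule bij_betw_byWitness[where f' = "\<lambda>b. b - c"]) (auto intro: R_add R_diff assms)

lemma An_fixed_imp_EF:
  assumes x: "x \<in> EF (Suc n)" and fx: "\<And>c. c \<in> R \<Longrightarrow> An n c x = x" shows "x \<in> EF n"
proof -
  let ?v = "vp (Suc n)"
  obtain d where d: "\<And>l. d l \<in> EF n" "x = (\<Sum>l<q. d l * ?v ^ l)" using EF_Suc_span[OF n x] by blast
  have dF: "d l \<in> QF (Suc n)" "?v ^ l \<in> QF (Suc n)" for l
    using d(1)[of l] EF_QF[of n] QF_Suc[OF n] subr.power_in[OF QF_subr vp_QF] by auto
  have "x = d 0"
  proof (rule roots_imp_const[OF finite_R, where g = "\<lambda>c. An n c ?v"])
    show "inj_on (\<lambda>c. An n c ?v) R" by (rule inj_onI) (rule An_inj)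
    fix c assume "c \<in> R"
    then have "x = An n c x" using fx by simp
    also have "\<dots> = (\<Sum>l<q. d l * An n c ?v ^ l)" unfolding d(2)
      by (subst An_sum) (auto simp: dF An_mult An_power[OF vp_QF] An_fix d(1) subr.mult_in[OF QF_subr])
    finally show "(\<Sum>l<card R. d l * An n c ?v ^ l) = x" by (simp add: card_R)
  qed (use card_R q_pos in auto)
  then show ?thesis using d(1) by simp
qed

lemma Ap_polys: "P \<in> polys (EF (Suc n)) \<Longrightarrow> Ap n c P \<in> polys (EF (Suc n))"
  by (auto intro!: polysI An_EF simp: coeff_Ap polysD)

lemma EF_QF_polys: "P \<in> polys (EF m) \<Longrightarrow> P \<in> polys (QF m)" using polys_mono[OF EF_QF] by blast

lemma Ap_Ap: "P \<in> polys (EF (Suc n)) \<Longrightarrow> Ap n c (Ap n c' P) = Ap n (c' + c) P"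
  by (intro poly_eqI) (simp add: coeff_Ap An_An polysD[OF EF_QF_polys])
lemma Ap_0: "P \<in> polys (EF (Suc n)) \<Longrightarrow> Ap n 0 P = P"
  by (intro poly_eqI) (simp add: coeff_Ap An_0 polysD[OF EF_QF_polys])

lemma Nm_EF: assumes P: "P \<in> polys (EF (Suc n))" shows "Nm n P \<in> polys (EF n)"
proof (rule polysI, rule An_fixed_imp_EF)
  have NE: "Nm n P \<in> polys (EF (Suc n))" unfolding Nm_def by (intro subr.polys_prod[OF EF_subr[OF n1]] Ap_polys P)
  then show "coeff (Nm n P) j \<in> EF (Suc n)" for j by (rule polysD)
  fix j c assume c: "c \<in> R"
  have "Ap n c (Nm n P) = (\<Prod>b\<in>R. Ap n (b + c) P)" unfolding Nm_def
    by (subst Ap_prod) (simp_all add: EF_QF_polys Ap_polys P Ap_Ap)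
  also have "\<dots> = Nm n P" unfolding Nm_def by (rule prod.reindex_bij_betw[OF bij_add_R[OF c]])
  finally show "An n c (coeff (Nm n P) j) = coeff (Nm n P) j" using coeff_Ap by metis
qed

lemma Ap_V: assumes "P \<in> polys (EF (Suc n))" "P \<in> polys V" shows "Ap n c P \<in> polys V"
  by (rule polysI) (simp add: coeff_Ap An_V polysD[OF EF_QF_polys[OF assms(1)]] polysD[OF assms(2)])
lemma Nm_V: "P \<in> polys (EF (Suc n)) \<Longrightarrow> P \<in> polys V \<Longrightarrow> Nm n P \<in> polys V"
  unfolding Nm_def by (intro polys_prod Ap_V)

lemma Ap_wt: assumes "P \<in> polys (EF (Suc n))" "wt T L P" shows "wt T L (Ap n c P)"
  unfolding wt_def coeff_Ap using An_vge polysD[OF EF_QF_polys[OF assms(1)]] wtD[OF assms(2)] by blast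

lemma Ap_monic: assumes "lead_coeff P = 1" shows "degree (Ap n c P) = degree P" "lead_coeff (Ap n c P) = 1"
proof -
  have 1: "coeff (Ap n c P) (degree P) = 1" using assms by (simp add: coeff_Ap An_one)
  have "degree (Ap n c P) \<le> degree P" by (rule degree_le) (simp add: coeff_Ap coeff_eq_0 An_zero)
  moreover have "degree P \<le> degree (Ap n c P)" using 1 by (intro le_degree) simp
  ultimately show "degree (Ap n c P) = degree P" by simp
  then show "lead_coeff (Ap n c P) = 1" using 1 by simp
qed

lemma Nm_monic: assumes "lead_coeff P = 1" shows "degree (Nm n P) = q * degree P" "lead_coeff (Nm n P) = 1"
proof -
  have nz: "Ap n c P \<noteq> 0" for c using Ap_monic(2)[OF assms, of c] by auto
  then show "degree (Nm n P) = q * degree P" unfolding Nm_def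
    by (subst degree_prod_eq_sum_degree) (simp_all add: Ap_monic(1)[OF assms] card_R)
  show "lead_coeff (Nm n P) = 1" unfolding Nm_def lead_coeff_prod by (simp add: Ap_monic(2)[OF assms])
qed

lemma Ap_Xq: "Ap n c (Xq P) = Xq (Ap n c P)"
  by (intro poly_eqI) (simp add: coeff_Ap coeff_Xq An_zero)
lemma Nm_Xq: "Nm n (Xq P) = Xq (Nm n P)"
  by (simp add: Nm_def Ap_Xq pcompose_prod)

lemma bij_mult_mod_R: assumes "\<not> f dvd t" shows "bij_betw (\<lambda>c. (t * c) mod f) R R"
proof -
  have inj: "inj_on (\<lambda>c. (t * c) mod f) R"
  proof (rule inj_onI)
    fix a b assume ab: "a \<in> R" "b \<in> R" "(t * a) mod f = (t * b) mod f"
    then have "f dvd t * (a - b)" by (simp add: mod_eq_dvd_iff right_diff_distrib)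
    then have "f dvd a - b" using prime_f assms prime_elem_dvd_mult_iff by blast
    then show "a = b" using R_dvd_diff ab by auto
  qed
  have "(\<lambda>c. (t * c) mod f) ` R = R" using mod_R by (intro endo_inj_surj finite_R inj) auto
  then show ?thesis using inj by (simp add: bij_betw_def)
qed

text \<open>\<open>An n c\<close> translates the factor \<open>x a\<close> of
  \<open>vp (Suc n)\<close> by a torsion point, and as \<open>c\<close> varies all
  \<open>f\<close>-torsion points occur. By \<open>prod_torsion\<close> the product over
  \<open>c\<close> is \<open>carlitz_act f (x a)\<close>, a factor of \<open>vp n\<close>.\<close>

lemma Nm_vp: "(\<Prod>c\<in>R. An n c (vp (Suc n))) = vp n"
proof -
  let ?t = "\<theta> (Suc n)"
  define x where "x a = carlitz_act (teich (Suc n) a) ?t" for a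
  have An_x: "An n c (x a) = x a + carlitz_act (teich (Suc n) a * c) (\<theta> 1)" for a c
  proof -
    have "An n c (x a) = carlitz_act (teich (Suc n) a) (carlitz_act (1 + f ^ n * c) ?t)"
      unfolding An_def x_def using conj_act[OF n1 An_unit QF_theta] conj_theta[OF n1 An_unit] by simp
    also have "carlitz_act (1 + f ^ n * c) ?t = ?t + carlitz_act c (\<theta> 1)"
      using act_f_power_theta[of 1 n] by (simp add: carlitz_act_add carlitz_act_1 mult.commute[of "f ^ n"] act_mult)
    finally show ?thesis by (simp add: act_add act_mult x_def)
  qed
  have "(\<Prod>c\<in>R. An n c (vp (Suc n))) = (\<Prod>c\<in>R. \<Prod>a\<in>R1. An n c (x a))"
    unfolding vp_def x_def by (intro prod.cong refl An_prod) (simp add: QF_act QF_theta)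
  also have "\<dots> = (\<Prod>a\<in>R1. \<Prod>c\<in>R. x a + carlitz_act (teich (Suc n) a * c) (\<theta> 1))"
    by (subst prod.swap) (simp add: An_x)
  also have "\<dots> = (\<Prod>a\<in>R1. carlitz_act f (x a))"
  proof (rule prod.cong[OF refl])
    fix a assume a: "a \<in> R1"
    let ?s = "teich (Suc n) a"
    have e: "carlitz_act (?s * c) (\<theta> 1) = carlitz_act ((?s * c) mod f) (\<theta> 1)" for c
      using act_theta_eq_iff[of 1 "?s * c" "(?s * c) mod f"] dvd_mod_diff[of "?s * c"] by simp
    have "(\<Prod>c\<in>R. x a + carlitz_act (?s * c) (\<theta> 1)) = (\<Prod>c\<in>R. x a + carlitz_act ((?s * c) mod f) (\<theta> 1))"
      using e by simp
    also have "\<dots> = (\<Prod>c\<in>R. x a + carlitz_act c (\<theta> 1))"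
      by (rule prod.reindex_bij_betw[OF bij_mult_mod_R[OF teich_not_dvd[OF R1_not_dvd[OF a]]]])
    finally show "(\<Prod>c\<in>R. x a + carlitz_act (?s * c) (\<theta> 1)) = carlitz_act f (x a)" using prod_torsion by simp
  qed
  also have "\<dots> = vp n" unfolding vp_def x_def using act_f_teich[OF n] by simp
  finally show ?thesis .
qed

end

text \<open>The minimal polynomial of \<open>vp (n + t)\<close> over \<open>EF n\<close>.\<close>
fun Mp :: "nat \<Rightarrow> nat \<Rightarrow> 'k qbar poly" where
  "Mp n 0 = [:- vp n, 1:]"
| "Mp n (Suc t) = Nm n (Mp (Suc n) t)"

text \<open>The last conjunct is the Newton polygon bound for a polynomial all of whose roots have
  the value of \<open>vp (n + t)\<close>. The sign of the constant term survives the norm because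
  \<open>q\<close> is odd.\<close>

lemma Mp_props: "n \<ge> 1 \<Longrightarrow> Mp n t \<in> polys (EF n) \<and> Mp n t \<in> polys V \<and> degree (Mp n t) = q ^ t \<and>
   lead_coeff (Mp n t) = 1 \<and> poly (Mp n t) (vp (n + t)) = 0 \<and> coeff (Mp n t) 0 = - vp n
   \<and> wt (vp (n + t)) (int (q ^ t)) (Mp n t)"
proof (induction t arbitrary: n)
  case 0
  have "wt (vp n) 1 [:- vp n, 1:]" unfolding wt_def
    using vge_uminus[OF veq_imp_vge[OF vp_M[OF 0] vp_nz[OF 0] veq_self[OF vp_M[OF 0] vp_nz[OF 0]]]]
    by (auto simp: coeff_pCons vge_0_iff one_in split: nat.split)
  then show ?case using 0 vp_EF M_V[OF vp_M]
    by (auto intro!: subr.polys_pCons subr.polys_0 EF_subr polys_pCons polys_0 uminus_in one_in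
        subr.uminus_in[OF EF_subr] subr.one_in[OF EF_subr])
next
  case (Suc t)
  have n1: "Suc n \<ge> 1" by simp
  let ?P = "Mp (Suc n) t"
  note I = Suc.IH[OF n1]
  have P: "?P \<in> polys (EF (Suc n))" using I by blast
  have "poly (Nm n ?P) (vp (Suc n + t)) = 0"
  proof -
    have "poly (Ap n 0 ?P) (vp (Suc n + t)) = 0" using Ap_0[OF Suc.prems P] I by simp
    then show ?thesis unfolding Nm_def poly_prod using zero_R finite_R by (intro prod_zero) auto
  qed
  moreover have "coeff (Nm n ?P) 0 = - vp n"
  proof -
    have "coeff (Nm n ?P) 0 = (\<Prod>c\<in>R. An n c (- vp (Suc n)))"
      using I by (simp add: Nm_def poly_0_coeff_0[symmetric] poly_prod)
         (simp add: poly_0_coeff_0 coeff_Ap[OF Suc.prems])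
    also have "\<dots> = (\<Prod>c\<in>R. - 1 * An n c (vp (Suc n)))" using An_uminus[OF Suc.prems vp_QF] by simp
    also have "\<dots> = (- 1) ^ card R * vp n" unfolding prod.distrib Nm_vp[OF Suc.prems] by simp
    finally show ?thesis using odd_q by (simp add: card_R)
  qed
  moreover have "wt (vp (Suc n + t)) (int (q ^ Suc t)) (Nm n ?P)"
  proof -
    have m: "Suc n + t \<ge> 1" by simp
    have "wt (vp (Suc n + t)) (int (card R) * int (q ^ t)) (Nm n ?P)" unfolding Nm_def
      by (intro wt_prod vp_M vp_nz m finite_R Ap_wt[OF Suc.prems P]) (use I in blast)
    then show ?thesis by (simp add: card_R)
  qed
  ultimately show ?case using Nm_EF[OF Suc.prems P] Nm_V[OF Suc.prems P] Nm_monic[OF Suc.prems, of ?P] I by auto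
qed

lemma vp_top_EF: assumes n: "n \<ge> 1" and x: "x \<in> EF n" "x \<noteq> 0"
  obtains k where "veq (vp n) k x" "veq (vp (n + t)) (int (q ^ t) * k) x"
proof -
  obtain k where k: "veq (vp n) k x" using EF_veq[OF n x] .
  have m: "n + t \<ge> 1" using n by simp
  show ?thesis using that k veq_trans[OF vp_M[OF m] vp_nz[OF m] vp_top[OF n] k] by blast
qed

lemma Mp_lead: "n \<ge> 1 \<Longrightarrow> coeff (Mp n t) (q ^ t) = 1" using Mp_props[of n t] by metis

section \<open>The one-step polynomial and the trace\<close>

lemma Mp_1: assumes n: "n \<ge> 1" shows "Mp n 1 = (\<Prod>c\<in>R. [:- An n c (vp (Suc n)), 1:])"
  by (simp add: Nm_def Ap_linear[OF n vp_QF])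

text \<open>The equation for \<open>vp (Suc n)\<close> writes \<open>vp n - vp (Suc n) ^ q\<close>
  as a sum over \<open>1 \<le> j < q\<close> of terms whose values differ modulo \<open>q\<close>.
  The value \<open>q ^ n + q - 1\<close> of this sum is -1 modulo \<open>q\<close>, so it comes from
  the term \<open>j = q - 1\<close>; for smaller \<open>j\<close> the bound rounds up to the next
  multiple of \<open>q\<close>.\<close>

lemma Mp_1_values:
  assumes n: "n \<ge> 1"
  shows "j \<in> {1..<q} \<Longrightarrow> vge (vp (Suc n)) (int (q ^ n) + int q - 1 - int j) (coeff (Mp n 1) j)"
    and "j \<in> {1..<q - 1} \<Longrightarrow> vge (vp (Suc n)) (int (q ^ n) + int q) (coeff (Mp n 1) j)"
    and "veq (vp (Suc n)) (int (q ^ n)) (coeff (Mp n 1) (q - 1))"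
proof -
  let ?v = "vp (Suc n)" and ?a = "coeff (Mp n 1)" and ?L = "int (q ^ n) + int q - 1"
  have n1: "Suc n \<ge> 1" by simp
  note T = vp_M[OF n1] vp_nz[OF n1]
  note P = Mp_props[OF n, of 1]
  have aE: "?a j \<in> EF n" for j using P polysD by blast
  have "0 = (\<Sum>j\<le>q. ?a j * ?v ^ j)" using P poly_altdef[of "Mp n 1" ?v] by simp
  also have "\<dots> = ?a 0 + (\<Sum>j\<in>{1..<q}. ?a j * ?v ^ j) + ?a q * ?v ^ q"
  proof -
    have "{..q} = insert 0 (insert q {1..<q})" using q_pos by auto
    then show ?thesis using q_pos by simp
  qed
  finally have sm: "(\<Sum>j\<in>{1..<q}. ?a j * ?v ^ j) = vp n - ?v ^ q"
    using P Mp_lead[OF n, of 1] by (simp add: algebra_simps del: Mp.simps)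
  have "\<exists>k. ?a j \<noteq> 0 \<longrightarrow> veq ?v (int q * k) (?a j)" for j
    using vp_top_EF[OF n aE[of j], of 1] by (metis add.commute plus_1_eq_Suc power_one_right)
  then obtain k where k: "\<And>j. ?a j \<noteq> 0 \<Longrightarrow> veq ?v (int q * k j) (?a j)" by metis
  have v: "veq ?v (int q * k j + int j) (?a j * ?v ^ j)" if "?a j * ?v ^ j \<noteq> 0" for j
    using veq_mult[OF T k vp_power[OF n1]] that by auto
  have inj: "i = j" if "i \<in> {1..<q}" "j \<in> {1..<q}" "int q * k i + int i = int q * k j + int j" for i j
  proof -
    have "(int q * k i + int i) mod int q = int i" "(int q * k j + int j) mod int q = int j" using that(1,2) by auto
    then show ?thesis using that(3) by simp
  qed
  note cong = vp_congruence[OF n]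
  have vg: "vge ?v ?L (?a j * ?v ^ j)" if j: "j \<in> {1..<q}" for j
    by (rule distinct_values[OF T _ v _ _ j]) (use inj sm veq_imp_vge[OF T cong] in auto)
  have vg1: "vge ?v (?L - int j) (?a j)" if j: "j \<in> {1..<q}" for j
  proof -
    have "vge ?v (?L + - int j) ((?a j * ?v ^ j) * inverse (?v ^ j))"
      by (intro vge_mult T vg j veq_imp_vge veq_inverse vp_power n1)
    moreover have "(?a j * ?v ^ j) * inverse (?v ^ j) = ?a j" using T by (simp add: mult.assoc del: power_inverse)
    ultimately show ?thesis by (metis add_uminus_conv_diff)
  qed
  then show "j \<in> {1..<q} \<Longrightarrow> vge ?v (?L - int j) (?a j)" .
  show "vge ?v (int (q ^ n) + int q) (?a j)" if j: "j \<in> {1..<q - 1}"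
  proof (cases "?a j = 0")
    case False
    have jj: "j \<in> {1..<q}" using j by auto
    have "?L - int j \<le> int q * k j" using veq_vge_iff[OF T k[OF False]] vg1[OF jj] by blast
    moreover have "int (q ^ n) = int q * int (q ^ (n - 1))" using n by (cases n) auto
    moreover have "int j < int q - 1" using j by auto
    ultimately have "int q * int (q ^ (n - 1)) < int q * k j" by linarith
    then have "int (q ^ (n - 1)) + 1 \<le> k j" using q_pos by simp
    then have "int q * (int (q ^ (n - 1)) + 1) \<le> int q * k j" using q_pos by simp
    then have "int (q ^ n) + int q \<le> int q * k j" using \<open>int (q ^ n) = int q * int (q ^ (n - 1))\<close> by (simp add: distrib_left)
    then show ?thesis using veq_vge_iff[OF T k[OF False]] by blast
  qed simp
  have "vp n - ?v ^ q \<noteq> 0" using veq_nz[OF cong] .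
  then have nz: "(\<Sum>j\<in>{1..<q}. ?a j * ?v ^ j) \<noteq> 0" unfolding sm .
  show "veq ?v (int (q ^ n)) (?a (q - 1))"
  proof (rule veq_sum_distinct[OF T _ _ _ nz, where a = "\<lambda>j. int q * k j + int j"])
    fix j assume j: "j \<in> {1..<q}" "?a j * ?v ^ j \<noteq> 0"
      and "veq ?v (int q * k j + int j) (\<Sum>j\<in>{1..<q}. ?a j * ?v ^ j)"
    then have j3: "veq ?v (int q * k j + int j) (vp n - ?v ^ q)" unfolding sm by simp
    have e: "int q * k j + int j = int (q ^ n) + int q - 1" using veq_unique[OF T j3 cong] .
    have qn: "int (q ^ n) = int q * int (q ^ (n - 1))" using n by (cases n) auto
    have "(int q * k j + int j) mod int q = int j" using j(1) by auto
    moreover have "(int q - 1) mod int q = int q - 1" by (rule mod_pos_pos_trivial) (use q_pos in auto)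
    then have "(int q * int (q ^ (n - 1)) + (int q - 1)) mod int q = int q - 1" by (metis mod_mult_self4)
    moreover have "int q * k j + int j = int q * int (q ^ (n - 1)) + (int q - 1)" using e qn by linarith
    ultimately have "int j = int q - 1" by metis
    then have "j = q - 1" "int q * k j = int (q ^ n)" using e by auto
    then show ?thesis using k[of j] j(2) by auto
  qed (use v inj in auto)
qed

text \<open>In Newton's identities the term linear in the coefficients has the bound claimed, by
  \<open>Mp_1_values(1)\<close>; a coefficient times a lower trace even gains another
  \<open>q ^ n - 1\<close>.\<close>

lemma Tr_power: assumes n: "n \<ge> 1" and l: "l < q"
  shows "vge (vp (Suc n)) (int (q ^ n) + int l - 1) (Tr n (vp (Suc n) ^ l))"
  using l
proof (induction l rule: less_induct)
  case (less l)
  let ?v = "vp (Suc n)" and ?a = "coeff (Mp n 1)"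
  have n1: "Suc n \<ge> 1" by simp
  note T = vp_M[OF n1] vp_nz[OF n1]
  have p: "Tr n (?v ^ i) = (\<Sum>c\<in>R. An n c ?v ^ i)" for i by (simp add: Tr_def An_power[OF n vp_QF])
  have l': "l < card R" using less.prems by (simp add: card_R)
  have newton: "Tr n (?v ^ l) = of_nat (q - l) * ?a (q - l) - (\<Sum>i<l. ?a (q - l + i) * Tr n (?v ^ i))"
    unfolding p using newton_power_sums[OF finite_R Mp_1[OF n] l'] by (simp only: card_R)
  show ?case
  proof (cases "l = 0")
    \<comment> \<open>The trace of 1 is \<open>q\<close>, which is zero in the field.\<close>
    case True then show ?thesis using newton by simp
  next
    case False
    have 1: "vge ?v (0 + (int (q ^ n) + int l - 1)) (of_nat (q - l) * ?a (q - l))"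
    proof (rule vge_mult[OF T])
      show "vge ?v 0 (of_nat (q - l))" by (simp add: vge_0_iff of_nat_in del: of_nat_diff)
      have "q - l \<in> {1..<q}" using less.prems False by auto
      then show "vge ?v (int (q ^ n) + int l - 1) (?a (q - l))"
        using Mp_1_values(1)[OF n, of "q - l"] less.prems by (simp add: of_nat_diff algebra_simps)
    qed
    have 2: "vge ?v (int (q ^ n) + int l - 1) (?a (q - l + i) * Tr n (?v ^ i))" if i: "i < l" for i
    proof -
      have "q - l + i \<in> {1..<q}" using less.prems i by auto
      then have "vge ?v (int (q ^ n) + int q - 1 - int (q - l + i)) (?a (q - l + i))" by (rule Mp_1_values(1)[OF n])
      then have "vge ?v ((int (q ^ n) + int q - 1 - int (q - l + i)) + (int (q ^ n) + int i - 1)) (?a (q - l + i) * Tr n (?v ^ i))"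
        using less.IH[OF i] less.prems i by (intro vge_mult[OF T]) auto
      then show ?thesis
      proof (rule vge_mono[OF T])
        have "int (q ^ n) \<ge> 1" using q_pos by simp
        then show "int (q ^ n) + int l - 1 \<le> (int (q ^ n) + int q - 1 - int (q - l + i)) + (int (q ^ n) + int i - 1)"
          using less.prems by (simp add: of_nat_diff)
      qed
    qed
    show ?thesis unfolding newton using 1 2 by (intro vge_diff vge_sum) auto
  qed
qed

text \<open>The trace is linear over \<open>EF n\<close>, and the terms of \<open>b\<close> in the
  powers of \<open>vp (Suc n)\<close> have distinct values, so each of them satisfies the bound
  \<open>L\<close>. The gain \<open>q ^ n - 1\<close> is the value of
  \<open>f / vp (Suc n)\<close>.\<close>

lemma Tr_vge: assumes n: "n \<ge> 1" and b: "b \<in> EF (Suc n)" and L: "vge (vp (Suc n)) L b"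
  shows "vge (vp (Suc n)) (L + int (q ^ n) - 1) (Tr n b)"
proof -
  let ?v = "vp (Suc n)"
  have n1: "Suc n \<ge> 1" by simp
  note T = vp_M[OF n1] vp_nz[OF n1]
  obtain c where c: "\<And>l. c l \<in> EF n" "b = (\<Sum>l<q. c l * ?v ^ l)" using EF_Suc_span[OF n b] by blast
  have "\<exists>k. c l \<noteq> 0 \<longrightarrow> veq ?v (int q * k) (c l)" for l
    using vp_top_EF[OF n c(1)[of l], of 1] by (metis add.commute plus_1_eq_Suc power_one_right)
  then obtain k where k: "\<And>l. c l \<noteq> 0 \<Longrightarrow> veq ?v (int q * k l) (c l)" by metis
  have vt: "vge ?v L (c l * ?v ^ l)" if l: "l < q" for l
  proof (rule distinct_values[OF T, where K = "{..<q}" and a = "\<lambda>l. int q * k l + int l"])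
    show "veq ?v (int q * k l + int l) (c l * ?v ^ l)" if "c l * ?v ^ l \<noteq> 0" for l
      using veq_mult[OF T k vp_power[OF n1]] that by auto
    fix i j assume ij: "i \<in> {..<q}" "j \<in> {..<q}" "int q * k i + int i = int q * k j + int j"
    have "(int q * k i + int i) mod int q = int i" "(int q * k j + int j) mod int q = int j" using ij(1,2) by auto
    then show "i = j" using ij(3) by simp
  qed (use c L l in auto)
  have cF: "c l \<in> QF (Suc n)" "?v ^ l \<in> QF (Suc n)" for l
    using c(1)[of l] EF_QF[of n] QF_Suc[OF n] subr.power_in[OF QF_subr vp_QF] by auto
  have cf: "An n a (c l * ?v ^ l) = c l * An n a (?v ^ l)" for a l
    by (simp add: An_mult[OF n] cF An_fix[OF n c(1)])
  have "Tr n b = (\<Sum>a\<in>R. \<Sum>l<q. c l * An n a (?v ^ l))" unfolding c(2) Tr_def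
    by (subst An_sum[OF n]) (auto simp: cf cF subr.mult_in[OF QF_subr])
  also have "\<dots> = (\<Sum>l<q. c l * Tr n (?v ^ l))" unfolding Tr_def by (subst sum.swap) (simp add: sum_distrib_left)
  finally have tr: "Tr n b = (\<Sum>l<q. c l * Tr n (?v ^ l))" .
  show ?thesis unfolding tr
  proof (rule vge_sum)
    fix l assume "l \<in> {..<q}"
    then have l: "l < q" by simp
    have "vge ?v (L + - int l + (int (q ^ n) + int l - 1)) ((c l * ?v ^ l) * inverse (?v ^ l) * Tr n (?v ^ l))"
      by (intro vge_mult T vt l veq_imp_vge veq_inverse vp_power n1 Tr_power n)
    then show "vge ?v (L + int (q ^ n) - 1) (c l * Tr n (?v ^ l))" using T by (simp add: algebra_simps)
  qed
qed

text \<open>The same gain in units of \<open>vp (Suc n + t)\<close>, where \<open>f\<close> counts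
  \<open>q ^ (n + t)\<close> and \<open>vp (Suc n)\<close> counts \<open>q ^ t\<close>. Going
  through the exact value of \<open>b\<close> avoids rounding \<open>L\<close>.\<close>

lemma Tr_vge_top: assumes n: "n \<ge> 1" and b: "b \<in> EF (Suc n)" and L: "vge (vp (Suc n + t)) L b"
  shows "vge (vp (Suc n + t)) (L + int (q ^ (n + t)) - int (q ^ t)) (Tr n b)"
proof (cases "b = 0")
  case True
  then show ?thesis by (simp add: Tr_def An_zero[OF n])
next
  case False
  have n1: "Suc n \<ge> 1" and m: "Suc n + t \<ge> 1" by simp_all
  note T = vp_M[OF n1] vp_nz[OF n1] and W = vp_M[OF m] vp_nz[OF m]
  obtain k where k: "veq (vp (Suc n)) k b" "veq (vp (Suc n + t)) (int (q ^ t) * k) b" using vp_top_EF[OF n1 b False] .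
  have Lk: "L \<le> int (q ^ t) * k" using veq_vge_iff[OF W k(2)] L by blast
  have "vge (vp (Suc n)) (k + int (q ^ n) - 1) (Tr n b)"
    by (rule Tr_vge[OF n b veq_imp_vge[OF T k(1)]])
  then have "vge (vp (Suc n + t)) (int (q ^ t) * (k + int (q ^ n) - 1)) (Tr n b)" by (rule vge_trans[OF W vp_top[OF n1]])
  moreover have "int (q ^ t) * (k + int (q ^ n) - 1) = int (q ^ t) * k + int (q ^ (n + t)) - int (q ^ t)"
    by (simp add: algebra_simps power_add)
  ultimately show ?thesis using vge_mono[OF W] Lk by simp
qed

section \<open>Differences of consecutive minimal polynomials\<close>

definition D :: "nat \<Rightarrow> nat \<Rightarrow> 'k qbar poly" where "D n t = Mp n (Suc t) - Xq (Mp n t)"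
text \<open>The losses accumulated in \<open>D_wt\<close>, in units of the top element
  \<open>vp (n + Suc t)\<close>: 1 from the one-step case and \<open>q ^ s\<close> from the trace
  \<open>s\<close> levels further down.\<close>

definition dl :: "nat \<Rightarrow> nat" where "dl t = (\<Sum>s\<le>t. q ^ s)"

lemma dl_0: "dl 0 = 1" and dl_Suc: "dl (Suc t) = dl t + q ^ Suc t" by (simp_all add: dl_def)
lemma dl_eq: "(q - 1) * dl t + 1 = q ^ Suc t"
proof (induction t)
  case 0 then show ?case using q_pos by (simp add: dl_0)
next
  case (Suc t)
  have "(q - 1) * dl (Suc t) + 1 = q ^ Suc t + (q - 1) * q ^ Suc t" using Suc by (simp add: dl_Suc distrib_left)
  also have "\<dots> = q * q ^ Suc t" using q_pos by (cases q) auto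
  finally show ?case by simp
qed
lemma dl_less: "dl t < q ^ Suc t"
proof -
  have "1 * dl t \<le> (q - 1) * dl t" using q_ge_3 by (intro mult_le_mono1) simp
  then show ?thesis using dl_eq[of t] by linarith
qed
lemma dl_pos: "dl t \<ge> 1" by (cases t) (auto simp: dl_0 dl_Suc q_pos Suc_le_eq)
lemma D_EF: "n \<ge> 1 \<Longrightarrow> D n t \<in> polys (EF n)"
  unfolding D_def using Mp_props[of n] subr.one_in[OF EF_subr]
  by (intro subr.polys_diff subr.polys_pcompose subr.polys_monom EF_subr) (auto simp del: Mp.simps)

lemma coeff_D: "coeff (D n t) j = coeff (Mp n (Suc t)) j - (if q dvd j then coeff (Mp n t) (j div q) else 0)"
  by (simp add: D_def coeff_Xq del: Mp.simps)

lemma D_high: assumes n: "n \<ge> 1" and j: "j \<ge> q ^ Suc t" shows "coeff (D n t) j = 0"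
proof (cases "j = q ^ Suc t")
  case True
  then show ?thesis using Mp_lead[OF n, of "Suc t"] Mp_lead[OF n, of t] q_pos by (simp add: coeff_D del: Mp.simps)
next
  case False
  have "coeff (Mp n (Suc t)) j = 0" using Mp_props[OF n, of "Suc t"] False j by (intro coeff_eq_0) simp
  moreover have "coeff (Mp n t) (j div q) = 0" if qj: "q dvd j"
  proof -
    obtain i where i: "j = q * i" using qj by blast
    then have "q * q ^ t < q * i" using False j by simp
    then have "q ^ t < i" by simp
    then show ?thesis using Mp_props[OF n, of t] i q_pos by (intro coeff_eq_0) simp
  qed
  ultimately show ?thesis by (simp add: coeff_D del: Mp.simps)
qed

text \<open>\<open>vp n\<close> counts \<open>q\<close> in units of \<open>vp (Suc n)\<close>, and
  substituting X^q multiplies the index by \<open>q\<close> as well.\<close>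

lemma wt_Xq: assumes n: "n \<ge> 1" and P: "wt (vp n) L P" shows "wt (vp (Suc n)) (int q * L) (Xq P)"
  unfolding wt_def
proof
  fix j
  have n1: "Suc n \<ge> 1" by simp
  show "vge (vp (Suc n)) (int q * L - int j) (coeff (Xq P) j)"
  proof (cases "q dvd j")
    case True
    then obtain i where i: "j = q * i" by blast
    have "vge (vp (Suc n)) (int q * (L - int i)) (coeff P i)"
      by (rule vge_trans[OF vp_M[OF n1] vp_nz[OF n1] vp_Suc[OF n] wtD[OF P]])
    then show ?thesis using i q_pos by (simp add: coeff_Xq right_diff_distrib)
  qed (simp add: coeff_Xq)
qed

text \<open>The key estimate: in passing from \<open>n + 1\<close> down to \<open>n\<close> the norm of \<open>y + h\<close> differs from the norm of \<open>y\<close> by a trace,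
  which gains a factor \<open>f\<close> and loses at most one uniformizer, and by terms of higher order in \<open>h\<close>.\<close>
lemma D_wt: "n \<ge> 1 \<Longrightarrow> wt (vp (n + Suc t)) (int (Suc t * q ^ (n + t)) + int (q ^ Suc t) - int (dl t)) (D n t)"
proof (induction t arbitrary: n)
  case 0
  note n = 0
  show ?case unfolding wt_def
  proof
    fix j
    consider "j = 0" | "j \<in> {1..<q}" | "j \<ge> q" by force
    then show "vge (vp (n + Suc 0)) (int (Suc 0 * q ^ (n + 0)) + int (q ^ Suc 0) - int (dl 0) - int j) (coeff (D n 0) j)"
    proof cases
      case 1
      then have "coeff (D n 0) j = 0" using Mp_props[OF n, of 1] by (simp add: coeff_D del: Mp.simps(2))
      then show ?thesis by simp
    next
      case 2
      then have "\<not> q dvd j" by (auto dest: dvd_imp_le)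
      then have "coeff (D n 0) j = coeff (Mp n 1) j" by (simp add: coeff_D del: Mp.simps)
      then show ?thesis using Mp_1_values(1)[OF n 2] by (simp add: dl_0 del: Mp.simps)
    next
      case 3 then show ?thesis using D_high[OF n, of 0 j] by simp
    qed
  qed
next
  case (Suc t)
  note n = Suc.prems
  have n1: "Suc n \<ge> 1" by simp
  define N where "N = n + Suc (Suc t)"
  have N1: "N \<ge> 1" by (simp add: N_def)
  have N2: "Suc n + Suc t = N" by (simp add: N_def)
  let ?T = "vp N"
  note T = vp_M[OF N1] vp_nz[OF N1]
  define W where "W = int (q ^ Suc t)"
  define F where "F = int (q ^ (n + Suc t))"
  \<comment> \<open>The excess of \<open>h\<close> over \<open>y\<close>: the induction hypothesis
    gives \<open>h\<close> the weight \<open>W + e\<close>, while \<open>y\<close> has weight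
    \<open>W\<close>.\<close>
  define e where "e = int (Suc t) * F - int (dl t)"
  define x where "x = Mp (Suc n) (Suc t)"
  define y where "y = Xq (Mp (Suc n) t)"
  define h where "h = D (Suc n) t"
  have xyh: "x = y + h" by (simp add: x_def y_def h_def D_def del: Mp.simps)
  have yE: "y \<in> polys (EF (Suc n))"
    unfolding y_def using Mp_props[OF n1, of t] subr.one_in[OF EF_subr[OF n1]]
    by (intro subr.polys_pcompose subr.polys_monom EF_subr n1) auto
  have hE: "h \<in> polys (EF (Suc n))" unfolding h_def by (rule D_EF[OF n1])
  have wy: "wt ?T W y"
  proof -
    have "wt (vp (Suc n + t)) (int (q ^ t)) (Mp (Suc n) t)" using Mp_props[OF n1] by blast
    then have "wt (vp (Suc (Suc n + t))) (int q * int (q ^ t)) y" unfolding y_def by (intro wt_Xq) auto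
    then show ?thesis by (simp add: W_def N_def)
  qed
  have wh: "wt ?T (W + e) h"
  proof -
    have "wt (vp (Suc n + Suc t)) (int (Suc t * q ^ (Suc n + t)) + int (q ^ Suc t) - int (dl t)) h"
      unfolding h_def by (rule Suc.IH[OF n1])
    moreover have "int (Suc t * q ^ (Suc n + t)) + int (q ^ Suc t) - int (dl t) = W + e"
      by (simp add: W_def e_def F_def algebra_simps)
    ultimately show ?thesis unfolding N2 by metis
  qed
  have FW: "F \<ge> W" unfolding F_def W_def using q_pos by (simp add: power_increasing)
  have dW: "int (dl t) < W" using dl_less[of t] unfolding W_def by linarith
  \<comment> \<open>This makes the second-order error, of excess \<open>2 * e\<close>, no worse than
    the trace term, of excess \<open>e + F - W\<close>.\<close>
  have eF: "e \<ge> F - W"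
  proof -
    have "0 \<le> int t * F" by (simp add: F_def)
    then have "int (Suc t) * F \<ge> F" by (simp add: distrib_right)
    then show ?thesis using dW unfolding e_def by linarith
  qed
  then have e0: "e \<ge> 0" using FW by simp
  define L where "L = (\<Sum>c\<in>R. Ap n c h * (\<Prod>b\<in>R - {c}. Ap n b y))"
  have Ap_x: "Ap n c x = Ap n c y + Ap n c h" for c
    unfolding xyh using yE hE by (intro poly_eqI) (simp add: coeff_Ap[OF n] An_add[OF n] polysD[OF EF_QF_polys[OF n]])
  have w1: "wt ?T (int (card R) * W + 2 * e) (Nm n x - Nm n y - L)"
    unfolding Nm_def L_def Ap_x
    by (rule wt_prod_expand(1)[OF T finite_R e0]) (intro Ap_wt[OF n] yE hE wy wh)+
  \<comment> \<open>The linear part \<open>L\<close> is the trace of \<open>B\<close>, coefficient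
    by coefficient: applying \<open>Ap n c\<close> moves the omitted index from 0 to
    \<open>c\<close>.\<close>
  define B where "B = h * (\<Prod>b\<in>R - {0}. Ap n b y)"
  have BE: "B \<in> polys (EF (Suc n))" unfolding B_def
    by (intro subr.polys_mult subr.polys_prod EF_subr n1 hE Ap_polys[OF n] yE)
  have wB: "wt ?T (W + e + int (card (R - {0})) * W) B" unfolding B_def
    by (intro wt_mult T wh wt_prod Ap_wt[OF n] yE wy) (use finite_R in auto)
  have LB: "L = (\<Sum>c\<in>R. Ap n c B)"
    unfolding L_def
  proof (rule sum.cong[OF refl])
    fix c assume c: "c \<in> R"
    have "Ap n c B = Ap n c h * (\<Prod>b\<in>R - {0}. Ap n (b + c) y)"
      unfolding B_def using hE yE
      by (subst Ap_mult[OF n]) (auto simp: Ap_prod[OF n] Ap_Ap[OF n] EF_QF_polys[OF n] Ap_polys[OF n]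
          intro!: subr.polys_prod[OF QF_subr])
    also have "(\<Prod>b\<in>R - {0}. Ap n (b + c) y) = (\<Prod>b\<in>R - {c}. Ap n b y)"
      by (rule prod.reindex_bij_witness[of _ "\<lambda>b. b - c" "\<lambda>b. b + c"]) (use c R_add R_diff in auto)
    finally show "Ap n c h * (\<Prod>b\<in>R - {c}. Ap n b y) = Ap n c B" by simp
  qed
  have wL: "wt ?T (W + e + int (card (R - {0})) * W + F - W) L"
    unfolding wt_def
  proof
    fix j
    have "coeff L j = Tr n (coeff B j)" by (simp add: LB coeff_sum coeff_Ap[OF n] Tr_def)
    moreover have "vge (vp (Suc n + Suc t)) ((W + e + int (card (R - {0})) * W - int j) + int (q ^ (n + Suc t)) - int (q ^ Suc t)) (Tr n (coeff B j))"
      unfolding N2 by (rule Tr_vge_top[OF n polysD[OF BE], of "Suc t", unfolded N2]) (rule wtD[OF wB])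
    ultimately show "vge ?T (W + e + int (card (R - {0})) * W + F - W - int j) (coeff L j)"
      unfolding N2 F_def[symmetric] W_def[symmetric] by (simp add: algebra_simps)
  qed
  define G where "G = int q * W + e + F - W"
  have "int (card (R - {0})) = int q - 1" using card_R1 q_pos by (simp add: R1_def of_nat_diff)
  then have GL: "W + e + int (card (R - {0})) * W + F - W = G"
    unfolding G_def by (simp only:) (simp add: algebra_simps)
  have "wt ?T G ((Nm n x - Nm n y - L) + L)"
    by (intro wt_add wt_mono[OF T w1]) (use wL GL eF in \<open>auto simp: G_def card_R\<close>)
  then have w: "wt ?T G (Nm n x - Nm n y)" by simp
  have "D n (Suc t) = Nm n x - Nm n y" by (simp add: D_def x_def y_def Nm_Xq[OF n])
  moreover have "int (Suc (Suc t) * q ^ (n + Suc t)) + int (q ^ Suc (Suc t)) - int (dl (Suc t)) = G"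
    unfolding G_def e_def F_def W_def dl_Suc by (simp add: algebra_simps)
  ultimately show ?case using w unfolding N_def by simp
qed

end

section \<open>Derivatives, the different and sharpness\<close>

lemma poly_pderiv_prod_at_root:
  fixes g :: "'b \<Rightarrow> 'a::field poly"
  assumes "finite A" "a \<in> A" "poly (g a) w = 0"
  shows "poly (pderiv (\<Prod>b\<in>A. g b)) w = poly (pderiv (g a)) w * (\<Prod>b\<in>A - {a}. poly (g b) w)"
  using assms by (simp add: prod.remove[OF assms(1,2)] pderiv_mult poly_prod)

context carlitz_tower
begin

text \<open>Integral elements of \<open>EF (Suc n)\<close> are polynomials in
  \<open>vp (Suc n)\<close> with integral coefficients in the base field, and a difference of two
  arguments divides the difference of the values of a polynomial.\<close>

lemma An_diff_dvd: assumes n: "n \<ge> 1" and a: "a \<in> EF (Suc n)" "a \<in> V"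
  shows "\<exists>z\<in>V. An n c a - a = (An n c (vp (Suc n)) - vp (Suc n)) * z"
proof -
  let ?v = "vp (Suc n)" and ?w = "An n c (vp (Suc n))"
  have n1: "Suc n \<ge> 1" by simp
  obtain d where d0: "\<forall>k. d k \<in> baseQ \<inter> V" "a = (\<Sum>k<q ^ (Suc n - 1). d k * ?v ^ k)"
    using EF_span_V[OF n1 a] by blast
  have d: "d k \<in> baseQ" "d k \<in> V" "a = (\<Sum>k<q ^ n. d k * ?v ^ k)" for k
    using d0 by auto
  have dF: "d k \<in> QF (Suc n)" "?v ^ k \<in> QF (Suc n)" for k
    using d(1) QF_baseQ[of "Suc n"] subr.power_in[OF QF_subr vp_QF] by auto
  have wV: "?w \<in> V" using An_V[OF n vp_QF M_V[OF vp_M[OF n1]]] .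
  have "An n c a = (\<Sum>k<q ^ n. d k * ?w ^ k)" unfolding d(3)
    by (subst An_sum[OF n]) (auto simp: An_mult[OF n] dF An_base[OF n] d(1) An_power[OF n vp_QF] subr.mult_in[OF QF_subr])
  then have "An n c a - a = (\<Sum>k<q ^ n. d k * (?w ^ k - ?v ^ k))"
    by (simp add: d(3) sum_subtractf right_diff_distrib)
  also have "\<dots> = (\<Sum>k<q ^ n. d k * ((?w - ?v) * (\<Sum>i<k. ?v ^ (k - Suc i) * ?w ^ i)))"
    by (simp only: power_diff_sumr2)
  also have "\<dots> = (?w - ?v) * (\<Sum>k<q ^ n. d k * (\<Sum>i<k. ?v ^ (k - Suc i) * ?w ^ i))"
    by (simp add: sum_distrib_left mult_ac)
  finally have "An n c a - a = (?w - ?v) * (\<Sum>k<q ^ n. d k * (\<Sum>i<k. ?v ^ (k - Suc i) * ?w ^ i))" .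
  moreover have "(\<Sum>k<q ^ n. d k * (\<Sum>i<k. ?v ^ (k - Suc i) * ?w ^ i)) \<in> V"
    by (intro sum_in mult_in power_in d wV M_V vp_M n1)
  ultimately show ?thesis by blast
qed

lemma vge_of_nat: "vge T 0 (of_nat k)" by (simp only: vge_0_iff of_nat_in)

lemma poly_pderiv_sum: assumes "degree P \<le> m"
  shows "poly (pderiv P) x = (\<Sum>j<m. of_nat (Suc j) * coeff P (Suc j) * x ^ j)"
proof (cases "m = 0")
  case True
  then obtain a where "P = [:a:]" using assms degree_eq_zeroE[of P] by auto
  then show ?thesis using True by (simp add: pderiv_pCons)
next
  case False
  then have "degree (pderiv P) < m"
    by (intro degree_lessI) (use assms in \<open>auto simp: coeff_pderiv coeff_eq_0\<close>)
  then show ?thesis using poly_conv_sum[of "pderiv P" m x] by (simp add: coeff_pderiv)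
qed

text \<open>The derivative of X^q vanishes. The coefficient at \<open>q - 1\<close> has a known
  exact value and picks up the factor q - 1 = -1; by the rounded bounds all other terms have larger
  value.\<close>

lemma pderiv_Mp_1: assumes n: "n \<ge> 1"
  shows "veq (vp (Suc n)) (int (q ^ n) + int q - 2) (poly (pderiv (Mp n 1)) (vp (Suc n)))"
proof -
  let ?v = "vp (Suc n)" and ?a = "coeff (Mp n 1)"
  have n1: "Suc n \<ge> 1" by simp
  note T = vp_M[OF n1] vp_nz[OF n1]
  define g where "g j = of_nat (Suc j) * ?a (Suc j) * ?v ^ j" for j
  have "poly (pderiv (Mp n 1)) ?v = (\<Sum>j<q. g j)" unfolding g_def
    using Mp_props[OF n, of 1] by (intro poly_pderiv_sum) simp
  also have "{..<q} = insert (q - 1) (insert (q - 2) {..<q - 2})" using q_ge_3 by auto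
  also have "(\<Sum>j\<in>insert (q - 1) (insert (q - 2) {..<q - 2}). g j) = g (q - 1) + (g (q - 2) + (\<Sum>j<q - 2. g j))"
    using q_ge_3 by (subst sum.insert) auto
  also have "g (q - 1) = 0" using q_ge_3 by (simp add: g_def)
  finally have s: "poly (pderiv (Mp n 1)) ?v = g (q - 2) + (\<Sum>j<q - 2. g j)" by simp
  have Sq: "Suc (q - 2) = q - 1" using q_ge_3 by simp
  have q1: "of_nat (q - 1) = (-1 :: 'k qbar)"
  proof -
    have "q = Suc (q - 1)" using q_ge_3 by simp
    then have "of_nat q = (of_nat (q - 1) + 1 :: 'k qbar)" by (metis of_nat_Suc add.commute)
    then show ?thesis by (simp add: eq_neg_iff_add_eq_0)
  qed
  have "g (q - 2) = - (?a (q - 1) * ?v ^ (q - 2))" unfolding g_def Sq q1 by simp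
  moreover have "veq ?v (int (q ^ n) + int (q - 2)) (- (?a (q - 1) * ?v ^ (q - 2)))"
    by (intro veq_uminus veq_mult T Mp_1_values(3) n vp_power n1)
  ultimately have m: "veq ?v (int (q ^ n) + int q - 2) (g (q - 2))"
    using q_ge_3 by (simp add: of_nat_diff add_diff_eq)
  have "vge ?v (int (q ^ n) + int q - 2 + 1) (\<Sum>j<q - 2. g j)"
  proof (rule vge_sum)
    fix j assume j: "j \<in> {..<q - 2}"
    then have "Suc j \<in> {1..<q - 1}" by auto
    then have "vge ?v (0 + (int (q ^ n) + int q) + int j) (of_nat (Suc j) * ?a (Suc j) * ?v ^ j)"
      by (intro vge_mult T vge_of_nat Mp_1_values(2) n veq_imp_vge vp_power n1)
    then show "vge ?v (int (q ^ n) + int q - 2 + 1) (g j)" unfolding g_def by (rule vge_mono[OF T]) simp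
  qed
  then show ?thesis unfolding s using veq_cong[OF T m, of "g (q - 2) + (\<Sum>j<q - 2. g j)"] by simp
qed

lemma An_diff_prod: assumes n: "n \<ge> 1"
  shows "veq (vp (Suc n)) (int (q ^ n) + int q - 2) (\<Prod>c\<in>R - {0}. An n c (vp (Suc n)) - vp (Suc n))"
proof -
  let ?v = "vp (Suc n)"
  have n1: "Suc n \<ge> 1" by simp
  have "poly (pderiv (Mp n 1)) ?v = (\<Prod>c\<in>R - {0}. ?v - An n c ?v)"
    unfolding Mp_1[OF n]
    by (subst poly_pderiv_prod_at_root[OF finite_R zero_R]) (auto simp: An_0[OF n vp_QF] pderiv_pCons)
  also have "\<dots> = (\<Prod>c\<in>R - {0}. - 1 * (An n c ?v - ?v))" by simp
  also have "\<dots> = (- 1) ^ card (R - {0}) * (\<Prod>c\<in>R - {0}. An n c ?v - ?v)" unfolding prod.distrib by simp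
  finally have e: "poly (pderiv (Mp n 1)) ?v = (- 1) ^ card (R - {0}) * (\<Prod>c\<in>R - {0}. An n c ?v - ?v)" .
  have "(-1 :: 'k qbar) ^ k = 1 \<or> (-1 :: 'k qbar) ^ k = -1" for k by (induction k) auto
  then show ?thesis using pderiv_Mp_1[OF n] veq_uminus[of ?v _ "poly (pderiv (Mp n 1)) ?v"] unfolding e
    by (metis mult_1 mult_minus1 minus_minus)
qed

text \<open>The value on the left generates the different of \<open>EF (n + t)\<close> over \<open>EF n\<close>.\<close>
lemma pderiv_Mp: "n \<ge> 1 \<Longrightarrow> veq (vp (n + t)) (int (t * q ^ (n + t - 1)) + (int q - 2) * (\<Sum>s<t. int (q ^ s)))
    (poly (pderiv (Mp n t)) (vp (n + t)))"
proof (induction t arbitrary: n)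
  case 0
  then show ?case using veq_one[OF vp_M[OF 0] vp_nz[OF 0]] by (simp add: pderiv_pCons)
next
  case (Suc t)
  note n = Suc.prems
  have n1: "Suc n \<ge> 1" by simp
  define m where "m = Suc n + t"
  have m1: "m \<ge> 1" by (simp add: m_def)
  have nm: "n + Suc t = m" by (simp add: m_def)
  let ?w = "vp m" and ?P = "Mp (Suc n) t" and ?v = "vp (Suc n)"
  note T = vp_M[OF m1] vp_nz[OF m1]
  note P = Mp_props[OF n1, of t, folded m_def]
  have PE: "?P \<in> polys (EF (Suc n))" using P by blast
  \<comment> \<open>Every coefficient of \<open>?P\<close> moves by a multiple of
    \<open>An n c ?v - ?v\<close>, and the constant one, which is \<open>- ?v\<close>, by exactly
    minus this difference. The other terms carry a positive power of \<open>?w\<close>, so the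
    cofactor is a unit.\<close>
  have fac: "\<exists>u\<in>U. poly (Ap n c ?P) ?w = (An n c ?v - ?v) * u" for c
  proof -
    have aE: "coeff ?P j \<in> EF (Suc n)" "coeff ?P j \<in> V" for j using P polysD by blast+
    obtain z where z: "\<And>j. z j \<in> V" "\<And>j. An n c (coeff ?P j) - coeff ?P j = (An n c ?v - ?v) * z j"
      using An_diff_dvd[OF n aE] by metis
    have dg: "degree (Ap n c ?P) < Suc (q ^ t)" "degree ?P < Suc (q ^ t)" using Ap_monic(1)[OF n, of ?P c] P by auto
    have "poly (Ap n c ?P) ?w = poly (Ap n c ?P) ?w - poly ?P ?w" using P by simp
    also have "\<dots> = (\<Sum>j<Suc (q ^ t). (An n c (coeff ?P j) - coeff ?P j) * ?w ^ j)"
      unfolding poly_conv_sum[OF dg(1)] poly_conv_sum[OF dg(2)] by (simp only: coeff_Ap[OF n] sum_subtractf left_diff_distrib)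
    also have "\<dots> = (An n c (coeff ?P 0) - coeff ?P 0) + (\<Sum>j<q ^ t. (An n c (coeff ?P (Suc j)) - coeff ?P (Suc j)) * ?w ^ Suc j)"
      by (subst sum.lessThan_Suc_shift) simp
    also have "An n c (coeff ?P 0) - coeff ?P 0 = (An n c ?v - ?v) * (- 1)"
      using P by (simp add: An_uminus[OF n vp_QF])
    also have "(\<Sum>j<q ^ t. (An n c (coeff ?P (Suc j)) - coeff ?P (Suc j)) * ?w ^ Suc j)
        = (An n c ?v - ?v) * (\<Sum>j<q ^ t. z (Suc j) * ?w ^ Suc j)"
      unfolding z(2) sum_distrib_left by (simp only: mult.assoc)
    finally have "poly (Ap n c ?P) ?w = (An n c ?v - ?v) * (- 1 + (\<Sum>j<q ^ t. z (Suc j) * ?w ^ Suc j))"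
      by (simp only: distrib_left)
    moreover have "- 1 + (\<Sum>j<q ^ t. z (Suc j) * ?w ^ Suc j) \<in> U"
      by (intro U_add_M U_uminus one_U M_sum V_mult_M M_power T z) auto
    ultimately show ?thesis by blast
  qed
  then obtain u where u: "\<And>c. u c \<in> U" "\<And>c. poly (Ap n c ?P) ?w = (An n c ?v - ?v) * u c" by metis
  have "poly (pderiv (Mp n (Suc t))) ?w = poly (pderiv ?P) ?w * ((\<Prod>c\<in>R - {0}. An n c ?v - ?v) * (\<Prod>c\<in>R - {0}. u c))"
    using poly_pderiv_prod_at_root[OF finite_R zero_R, of "\<lambda>c. Ap n c ?P" ?w] P Ap_0[OF n PE]
    by (simp add: Nm_def u(2) prod.distrib)
  moreover have "veq ?w ((int (t * q ^ (m - 1)) + (int q - 2) * (\<Sum>s<t. int (q ^ s))) + (int (q ^ t) * (int (q ^ n) + int q - 2) + 0))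
      (poly (pderiv ?P) ?w * ((\<Prod>c\<in>R - {0}. An n c ?v - ?v) * (\<Prod>c\<in>R - {0}. u c)))"
  proof (intro veq_mult T)
    show "veq ?w (int (t * q ^ (m - 1)) + (int q - 2) * (\<Sum>s<t. int (q ^ s))) (poly (pderiv ?P) ?w)"
      using Suc.IH[OF n1] by (simp only: m_def)
    show "veq ?w (int (q ^ t) * (int (q ^ n) + int q - 2)) (\<Prod>c\<in>R - {0}. An n c ?v - ?v)"
      using veq_trans[OF T _ An_diff_prod[OF n], of "int (q ^ t)"] vp_top[OF n1, of t] by (simp only: m_def)
    show "veq ?w 0 (\<Prod>c\<in>R - {0}. u c)" using U_prod[of "R - {0}" u] u(1) by (simp add: veq_0_iff)
  qed
  moreover have "(int (t * q ^ (m - 1)) + (int q - 2) * (\<Sum>s<t. int (q ^ s))) + (int (q ^ t) * (int (q ^ n) + int q - 2) + 0)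
      = int (Suc t * q ^ (m - 1)) + (int q - 2) * (\<Sum>s<Suc t. int (q ^ s))"
    by (simp add: m_def power_add algebra_simps)
  ultimately show ?case unfolding nm by metis
qed

text \<open>Suppose the bound of \<open>D_wt\<close> is not attained at J = q^(t+1) - dl t. Values
  of coefficients are multiples of q^(t+1), and among the indices below q^(t+1) the bound is such a
  multiple only at J; so it is attained nowhere. Then the derivative of \<open>D n t\<close> at the
  root has larger value than that of \<open>Mp n (Suc t)\<close>, although the two derivatives agree
  because X^q has derivative 0.\<close>

lemma D_exact: assumes n: "n \<ge> 1"
  shows "veq (vp (n + Suc t)) (int (Suc t * q ^ (n + t))) (coeff (D n t) (q ^ Suc t - dl t))"
proof (rule ccontr)
  define m where "m = n + Suc t"
  have m1: "m \<ge> 1" by (simp add: m_def)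
  let ?w = "vp m"
  define Q where "Q = int (q ^ Suc t)"
  define J where "J = q ^ Suc t - dl t"
  define F where "F = int (Suc t * q ^ (n + t))"
  note T = vp_M[OF m1] vp_nz[OF m1]
  assume "\<not> veq (vp (n + Suc t)) (int (Suc t * q ^ (n + t))) (coeff (D n t) (q ^ Suc t - dl t))"
  then have nv: "\<not> veq ?w F (coeff (D n t) J)" by (simp add: m_def F_def J_def)
  have J: "int J = Q - int (dl t)" using dl_less[of t] by (simp add: J_def Q_def of_nat_diff)
  have Qpos: "Q > 0" using q_pos by (simp add: Q_def)
  have J1: "int J < Q" "int J > 0" using J dl_pos[of t] dl_less[of t] unfolding Q_def by linarith+
  obtain F' where F': "F = Q * F'"
  proof -
    have "n + t = Suc t + (n - 1)" using n by simp
    then have "q ^ (n + t) = q ^ Suc t * q ^ (n - 1)" by (metis power_add)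
    then have "F = Q * int (Suc t * q ^ (n - 1))" unfolding F_def Q_def by (simp only: of_nat_mult mult_ac)
    then show ?thesis using that by blast
  qed
  have st: "vge ?w (F + int J - int j + 1) (coeff (D n t) j)" for j
  proof (cases "coeff (D n t) j = 0")
    case False
    then have jlt: "int j < Q" using D_high[OF n] unfolding Q_def by (metis not_le of_nat_less_iff)
    obtain k where k: "veq ?w (Q * k) (coeff (D n t) j)"
      using vp_top_EF[OF n polysD[OF D_EF[OF n]] False, of "Suc t"] unfolding Q_def m_def by metis
    have "vge ?w (F + int J - int j) (coeff (D n t) j)"
      using wtD[OF D_wt[OF n, of t], of j] unfolding J by (simp add: m_def F_def Q_def algebra_simps)
    then have le: "F + int J - int j \<le> Q * k" using veq_vge_iff[OF T k] by blast
    have "F + int J - int j \<noteq> Q * k"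
    proof
      assume e: "F + int J - int j = Q * k"
      then have eq: "int J - int j = Q * (k - F')" using F' by (simp add: right_diff_distrib)
      have "\<bar>int J - int j\<bar> < Q" using J1 jlt by linarith
      then have "\<bar>Q * (k - F')\<bar> < Q * 1" unfolding eq by simp
      then have "\<bar>k - F'\<bar> < 1" using Qpos by (simp add: abs_mult)
      then have "k = F'" by simp
      then have "j = J" using eq by simp
      then show False using nv k F' \<open>k = F'\<close> by simp
    qed
    then show ?thesis using le veq_vge_iff[OF T k] by simp
  qed simp
  have dD: "degree (D n t) \<le> q ^ Suc t" by (rule degree_le) (use D_high[OF n] in auto)
  have "vge ?w (F + int J) (poly (pderiv (D n t)) ?w)"
    unfolding poly_pderiv_sum[OF dD]
  proof (rule vge_sum)
    fix j
    have "vge ?w (0 + (F + int J - int (Suc j) + 1) + int j) (of_nat (Suc j) * coeff (D n t) (Suc j) * ?w ^ j)"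
      by (intro vge_mult T vge_of_nat st veq_imp_vge vp_power m1)
    then show "vge ?w (F + int J) (of_nat (Suc j) * coeff (D n t) (Suc j) * ?w ^ j)" by simp
  qed
  moreover have "pderiv (D n t) = pderiv (Mp n (Suc t))"
  proof -
    have "pderiv (Xq (Mp n t)) = 0"
    proof (rule poly_eqI)
      fix j show "coeff (pderiv (Xq (Mp n t))) j = coeff 0 j"
      proof (cases "q dvd Suc j")
        case True
        then obtain i where "Suc j = q * i" by blast
        then have "of_nat (Suc j) = (0 :: 'k qbar)" by (simp only: of_nat_mult of_nat_q mult_zero_left)
        then show ?thesis unfolding coeff_pderiv by simp
      qed (simp add: coeff_pderiv coeff_Xq)
    qed
    then show ?thesis by (simp add: D_def pderiv_diff del: Mp.simps)
  qed
  moreover have "veq ?w (F + int J - 1) (poly (pderiv (Mp n (Suc t))) ?w)"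
  proof -
    have "veq ?w (F + (int q - 2) * (\<Sum>s<Suc t. int (q ^ s))) (poly (pderiv (Mp n (Suc t))) ?w)"
      using pderiv_Mp[OF n, of "Suc t"] by (simp only: m_def F_def add_Suc_right diff_Suc_1)
    moreover have "(\<Sum>s<Suc t. int (q ^ s)) = int (dl t)" by (simp add: dl_def lessThan_Suc_atMost)
    \<comment> \<open>A consequence of \<open>dl_eq\<close>. It makes the exact value one less than
      the bound just derived from the assumption.\<close>
    moreover have "(int q - 2) * int (dl t) = int J - 1"
    proof -
      have "int (q - 1) * int (dl t) + 1 = Q" using dl_eq[of t] unfolding Q_def
        by (metis of_nat_1 of_nat_add of_nat_mult)
      then show ?thesis using q_ge_3 unfolding J by (simp add: of_nat_diff algebra_simps)
    qed
    ultimately show ?thesis by (simp only: add_diff_eq)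
  qed
  ultimately show False using veq_vge_iff[OF T, of "F + int J - 1" _ "F + int J"] by simp
qed

section \<open>Divisibility of the coefficients\<close>

lemma EF_divide: "n \<ge> 1 \<Longrightarrow> x \<in> EF n \<Longrightarrow> y \<in> EF n \<Longrightarrow> x / y \<in> EF n"
  unfolding divide_inverse by (intro subr.mult_in[OF EF_subr] EF_inverse)

text \<open>In units of \<open>vp (n + t)\<close> a nonzero element of \<open>EF n\<close> has value
  divisible by \<open>q ^ t\<close>, so a bound exceeding \<open>q ^ t * (k - 1)\<close> improves to
  \<open>q ^ t * k\<close>.\<close>

lemma EF_divide_V:
  assumes n: "n \<ge> 1" and x: "x \<in> EF n" "vge (vp (n + t)) L x" and y: "veq (vp n) k y" and L: "L > int (q ^ t) * (k - 1)"
  shows "x / y \<in> V"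
proof (cases "x = 0")
  case False
  have m: "n + t \<ge> 1" using n by simp
  note T = vp_M[OF n] vp_nz[OF n]
  obtain l where l: "veq (vp n) l x" "veq (vp (n + t)) (int (q ^ t) * l) x" using vp_top_EF[OF n x(1) False] .
  have "L \<le> int (q ^ t) * l" using veq_vge_iff[OF vp_M[OF m] vp_nz[OF m] l(2)] x(2) by blast
  then have "int (q ^ t) * (k - 1) < int (q ^ t) * l" using L by linarith
  moreover have "int (q ^ t) > 0" using q_pos by simp
  ultimately have "k - 1 < l" using mult_less_cancel_left_pos by blast
  moreover have "veq (vp n) (l - k) (x / y)" by (intro veq_divide T l y)
  ultimately have "vge (vp n) 0 (x / y)" using veq_vge_iff[OF T] by force
  then show ?thesis by (simp add: vge_0_iff)
qed simp

lemma f_power_vp: "n \<ge> 1 \<Longrightarrow> veq (vp n) (int k * int (q ^ (n - 1))) (emb f ^ k)"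
  by (intro veq_power vp_M vp_nz vp_f)

lemma D_divide: assumes n: "n \<ge> 1" shows "coeff (D n t) j / emb f ^ Suc t \<in> V"
proof (cases "j \<ge> q ^ Suc t")
  case True then show ?thesis using D_high[OF n] by simp
next
  case False
  have e: "int (q ^ Suc t) * (int (Suc t) * int (q ^ (n - 1)) - 1) = int (Suc t * q ^ (n + t)) - int (q ^ Suc t)"
  proof -
    have "n + t = Suc t + (n - 1)" using n by simp
    then have "q ^ (n + t) = q ^ Suc t * q ^ (n - 1)" by (metis power_add)
    then show ?thesis by (simp only: of_nat_mult) (simp add: algebra_simps)
  qed
  show ?thesis
    by (rule EF_divide_V[OF n polysD[OF D_EF[OF n]] wtD[OF D_wt[OF n]] f_power_vp[OF n]])
       (unfold e, use False dl_less[of t] in linarith)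
qed

text \<open>Multiply by \<open>q - 1\<close> and use \<open>dl_eq\<close>. The restriction on
  \<open>j\<close> in (i') and (ii') is there to leave room for the loss
  \<open>dl t\<close>.\<close>

lemma small_index: assumes "j * (q - 1) < q ^ Suc t * (q - 2)" shows "j + dl t < q ^ Suc t"
proof (rule ccontr)
  assume "\<not> j + dl t < q ^ Suc t"
  then have "(q - 1) * q ^ Suc t \<le> (q - 1) * (j + dl t)" by (intro mult_le_mono2) simp
  also have "\<dots> = j * (q - 1) + (q - 1) * dl t" by (simp add: distrib_left mult.commute)
  finally have a: "(q - 1) * q ^ Suc t \<le> j * (q - 1) + (q - 1) * dl t" .
  have "q - 1 = Suc (q - 2)" using q_ge_3 by simp
  then have "(q - 1) * q ^ Suc t = q ^ Suc t * (q - 2) + q ^ Suc t" by (metis mult_Suc add.commute mult.commute)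
  then show False using a assms dl_eq[of t] by linarith
qed

lemma D_divide_vp: assumes n: "n \<ge> 1" and j: "j * (q - 1) < q ^ Suc t * (q - 2)"
  shows "coeff (D n t) j / (emb f ^ Suc t * vp n) \<in> V"
proof -
  have e: "int (q ^ Suc t) * (int (Suc t) * int (q ^ (n - 1)) + 1 - 1) = int (Suc t * q ^ (n + t))"
  proof -
    have "n + t = Suc t + (n - 1)" using n by simp
    then have "q ^ (n + t) = q ^ Suc t * q ^ (n - 1)" by (metis power_add)
    then show ?thesis by (simp only: of_nat_mult) (simp add: algebra_simps)
  qed
  have v: "veq (vp n) (int (Suc t) * int (q ^ (n - 1)) + 1) (emb f ^ Suc t * vp n)"
    by (intro veq_mult vp_M vp_nz n f_power_vp veq_self)
  show ?thesis
    by (rule EF_divide_V[OF n polysD[OF D_EF[OF n]] wtD[OF D_wt[OF n]] v])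
       (unfold e, use small_index[OF j] in linarith)
qed

lemma f_V: "emb f \<in> V" by (rule emb_V)

lemma V_divide_power: assumes "x / emb f ^ a \<in> V" "b \<le> a" shows "x / emb f ^ b \<in> V"
proof -
  have "x / emb f ^ b = (x / emb f ^ a) * emb f ^ (a - b)" using assms(2) emb_f_nz by (simp add: power_diff field_simps)
  then show ?thesis using mult_in[OF assms(1) power_in[OF f_V]] by simp
qed

lemma V_divide_power_vp: assumes "x / (emb f ^ a * y) \<in> V" "b \<le> a" shows "x / (emb f ^ b * y) \<in> V"
proof -
  have "(x / y) / emb f ^ a \<in> V" using assms(1) by (simp add: divide_divide_eq_left mult.commute)
  then have "(x / y) / emb f ^ b \<in> V" using V_divide_power assms(2) by blast
  then show ?thesis by (simp add: divide_divide_eq_left mult.commute)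
qed

lemma multiplicity_q_times: "j > 0 \<Longrightarrow> multiplicity q (q * j) = Suc (multiplicity q j)"
  using q_ge_3 by (intro multiplicity_times_same) auto

text \<open>Passing from \<open>i\<close> to \<open>Suc i\<close> adds coefficients of
  \<open>D n i\<close>, divisible by \<open>f ^ Suc i\<close>, while the old coefficient at
  \<open>k\<close> reappears at \<open>q * k\<close>, where \<open>i\<close> and the multiplicity
  have both grown by one.\<close>

lemma coeff_Mp_divide: assumes n: "n \<ge> 1" shows "j \<in> {1..q ^ i} \<Longrightarrow> coeff (Mp n i) j / emb f ^ (i - multiplicity q j) \<in> V"
proof (induction i arbitrary: j)
  case 0 then show ?case using one_in by auto
next
  case (Suc i)
  show ?case
  proof (cases "q dvd j")
    case False
    then have "coeff (Mp n (Suc i)) j = coeff (D n i) j" by (simp add: coeff_D del: Mp.simps)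
    then show ?thesis using V_divide_power[OF D_divide[OF n]] by simp
  next
    case True
    then obtain k where k: "j = q * k" by blast
    then have kr: "k \<in> {1..q ^ i}" using Suc.prems q_pos by auto
    have "coeff (Mp n (Suc i)) j = coeff (D n i) j + coeff (Mp n i) k" using k q_pos by (simp add: coeff_D del: Mp.simps)
    moreover have "Suc i - multiplicity q j = i - multiplicity q k" using k kr multiplicity_q_times by simp
    moreover have "coeff (D n i) j / emb f ^ (i - multiplicity q k) \<in> V" by (rule V_divide_power[OF D_divide[OF n]]) simp
    ultimately show ?thesis using add_in[OF _ Suc.IH[OF kr]] by (metis add_divide_distrib)
  qed
qed

lemma coeff_Mp_divide_vp: assumes n: "n \<ge> 1"
  shows "j \<ge> 1 \<Longrightarrow> j * (q - 1) < q ^ i * (q - 2) \<Longrightarrow> coeff (Mp n i) j / (emb f ^ (i - multiplicity q j) * vp n) \<in> V"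
proof (induction i arbitrary: j)
  case 0
  have "1 * (q - 1) \<le> j * (q - 1)" using 0 by (intro mult_le_mono1)
  moreover have "j * (q - 1) < q - 2" using 0 by simp
  ultimately have False by linarith
  then show ?case ..
next
  case (Suc i)
  note Dd = D_divide_vp[OF n Suc.prems(2)]
  show ?case
  proof (cases "q dvd j")
    case False
    then have "coeff (Mp n (Suc i)) j = coeff (D n i) j" by (simp add: coeff_D del: Mp.simps)
    then show ?thesis using V_divide_power_vp[OF Dd] by simp
  next
    case True
    then obtain k where k: "j = q * k" by blast
    then have k1: "k \<ge> 1" using Suc.prems by (cases k) auto
    have k2: "k * (q - 1) < q ^ i * (q - 2)" using Suc.prems(2) q_pos unfolding k by (simp add: mult.assoc)
    have "coeff (Mp n (Suc i)) j = coeff (D n i) j + coeff (Mp n i) k" using k q_pos by (simp add: coeff_D del: Mp.simps)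
    moreover have "Suc i - multiplicity q j = i - multiplicity q k" using k k1 multiplicity_q_times by simp
    moreover have "coeff (D n i) j / (emb f ^ (i - multiplicity q k) * vp n) \<in> V" by (rule V_divide_power_vp[OF Dd]) simp
    ultimately show ?thesis using add_in[OF _ Suc.IH[OF k1 k2]] by (metis add_divide_distrib)
  qed
qed

lemma coeff_Mp_step: "coeff (Mp n (Suc i)) (q * j) - coeff (Mp n i) j = coeff (D n i) (q * j)"
  using q_pos by (simp add: coeff_D del: Mp.simps)

text \<open>Telescoping: the step from \<open>i + b\<close> contributes a coefficient of
  \<open>D n (i + b)\<close>, divisible by \<open>f ^ Suc (i + b)\<close>.\<close>

lemma coeff_Mp_cong: assumes n: "n \<ge> 1"
  shows "(coeff (Mp n i) j - coeff (Mp n (i + b)) (q ^ b * j)) / emb f ^ Suc i \<in> V"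
proof (induction b)
  case (Suc b)
  have "coeff (Mp n i) j - coeff (Mp n (i + Suc b)) (q ^ Suc b * j)
      = (coeff (Mp n i) j - coeff (Mp n (i + b)) (q ^ b * j)) - coeff (D n (i + b)) (q * (q ^ b * j))"
    by (simp add: coeff_Mp_step[symmetric] mult.assoc del: Mp.simps)
  moreover have "coeff (D n (i + b)) (q * (q ^ b * j)) / emb f ^ Suc i \<in> V"
    by (rule V_divide_power[OF D_divide[OF n]]) simp
  ultimately show ?case using diff_in[OF Suc] by (metis diff_divide_distrib)
qed simp

lemma coeff_Mp_cong_vp: assumes n: "n \<ge> 1" and j: "j * (q - 1) < q ^ i * (q - 2)"
  shows "(coeff (Mp n i) j - coeff (Mp n (i + b)) (q ^ b * j)) / (emb f ^ Suc i * vp n) \<in> V"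
proof (induction b)
  case (Suc b)
  have "coeff (Mp n i) j - coeff (Mp n (i + Suc b)) (q ^ Suc b * j)
      = (coeff (Mp n i) j - coeff (Mp n (i + b)) (q ^ b * j)) - coeff (D n (i + b)) (q * (q ^ b * j))"
    by (simp add: coeff_Mp_step[symmetric] mult.assoc del: Mp.simps)
  moreover have "coeff (D n (i + b)) (q * (q ^ b * j)) / (emb f ^ Suc i * vp n) \<in> V"
  proof (rule V_divide_power_vp[OF D_divide_vp[OF n]])
    have "q ^ Suc b * (j * (q - 1)) < q ^ Suc b * (q ^ i * (q - 2))" using j q_pos by simp
    then show "q * (q ^ b * j) * (q - 1) < q ^ Suc (i + b) * (q - 2)" by (simp add: power_add mult_ac)
  qed simp
  ultimately show ?case using diff_in[OF Suc] by (metis diff_divide_distrib)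
qed simp

text \<open>Needed so that at this index the coefficients of \<open>Mp n (Suc t)\<close> and
  \<open>D n t\<close> coincide. By \<open>dl_eq\<close>, a common factor \<open>q\<close> would
  divide 1.\<close>

lemma not_dvd_exact_index: "\<not> q dvd q ^ Suc t - dl t"
proof
  assume a: "q dvd q ^ Suc t - dl t"
  have "q dvd q ^ Suc t - (q ^ Suc t - dl t)" by (rule dvd_diff_nat[OF _ a]) simp
  moreover have "q ^ Suc t - (q ^ Suc t - dl t) = dl t" using dl_less[of t] by (intro diff_diff_cancel) simp
  ultimately have d: "q dvd dl t" by metis
  have "q dvd (q - 1) * dl t + 1" unfolding dl_eq by simp
  then have "q dvd 1" using d by (metis dvd_add_right_iff dvd_mult)
  then show False using q_ge_3 by simp
qed

text \<open>The index is \<open>q ^ b * J\<close> with \<open>J = q ^ Suc t - dl t\<close> and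
  \<open>i = Suc t + b\<close>. For \<open>Suc t\<close> the coefficient at \<open>J\<close> is a
  unit times \<open>f ^ Suc t\<close> by \<open>D_exact\<close>, and the congruence modulo
  \<open>f ^ Suc (Suc t)\<close> carries this over to \<open>i\<close>.\<close>

lemma coeff_Mp_unit: assumes n: "n \<ge> 1" and b: "b < i"
  shows "coeff (Mp n i) (q ^ i - (q ^ i - q ^ b) div (q - 1)) / emb f ^ (i - b) \<in> U"
proof -
  define t where "t = i - b - 1"
  have i: "i = Suc t + b" using b by (simp add: t_def)
  define J where "J = q ^ Suc t - dl t"
  have e: "q ^ i - q ^ b = (q - 1) * (q ^ b * dl t)"
  proof -
    have "q ^ i = q ^ b * ((q - 1) * dl t + 1)" unfolding dl_eq i by (simp add: power_add mult.commute)
    then show ?thesis by (simp add: distrib_left mult_ac)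
  qed
  have "(q ^ i - q ^ b) div (q - 1) = q ^ b * dl t" unfolding e using q_ge_3 by (intro nonzero_mult_div_cancel_left) simp
  then have idx: "q ^ i - (q ^ i - q ^ b) div (q - 1) = q ^ b * J"
    by (simp add: i J_def power_add right_diff_distrib' mult_ac)
  have cD: "coeff (Mp n (Suc t)) J = coeff (D n t) J" using not_dvd_exact_index[of t] by (simp add: coeff_D J_def del: Mp.simps)
  have m: "n + Suc t \<ge> 1" by simp
  note T = vp_M[OF m] vp_nz[OF m]
  have "veq (vp (n + Suc t)) (int (q ^ (n + t))) (emb f)" using vp_f[OF m] by simp
  then have "veq (vp (n + Suc t)) (int (Suc t) * int (q ^ (n + t))) (emb f ^ Suc t)" by (rule veq_power[OF T])
  then have "veq (vp (n + Suc t)) (int (Suc t * q ^ (n + t)) - int (Suc t) * int (q ^ (n + t))) (coeff (D n t) J / emb f ^ Suc t)"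
    unfolding J_def by (intro veq_divide T D_exact n)
  moreover have "int (Suc t * q ^ (n + t)) - int (Suc t) * int (q ^ (n + t)) = 0" by (simp only: of_nat_mult diff_self)
  ultimately have u: "coeff (Mp n (Suc t)) J / emb f ^ Suc t \<in> U" unfolding cD by (metis veq_0_iff)
  have "(coeff (Mp n (Suc t)) J - coeff (Mp n (Suc t + b)) (q ^ b * J)) / emb f ^ Suc (Suc t) \<in> V"
    by (rule coeff_Mp_cong[OF n])
  then have "(coeff (Mp n (Suc t)) J - coeff (Mp n i) (q ^ b * J)) / emb f ^ Suc (Suc t) * emb f \<in> M"
    unfolding i by (rule V_mult_M[OF _ f_M])
  moreover have "x / emb f ^ Suc (Suc t) * emb f = x / emb f ^ Suc t" for x using emb_f_nz by simp
  ultimately have "(coeff (Mp n (Suc t)) J - coeff (Mp n i) (q ^ b * J)) / emb f ^ Suc t \<in> M" by metis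
  from U_diff_M[OF u this] have "coeff (Mp n i) (q ^ b * J) / emb f ^ Suc t \<in> U"
    by (simp add: diff_divide_distrib del: Mp.simps)
  moreover have "i - b = Suc t" by (simp add: i)
  ultimately show ?thesis unfolding idx by simp
qed

end

section \<open>Minimal polynomials\<close>

lemma rta_eval: "ring.eval (ring_of_type_algebra :: 'a::field ring) xs x = poly (Poly (rev xs)) x"
proof -
  interpret A: ring "ring_of_type_algebra :: 'a ring" by (rule ring_from_type_algebra)
  have pow: "x [^]\<^bsub>ring_of_type_algebra\<^esub> (n::nat) = x ^ n" for n
    by (induction n) (auto simp: mult.commute)
  show ?thesis
    by (induction xs) (auto simp: pow Poly_snoc poly_monom)
qed

text \<open>\<open>Irr\<close> divides every polynomial over \<open>K\<close> that vanishes at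
  \<open>x\<close>, so its degree is at most that of \<open>h\<close>; minimality gives equality,
  and two monic polynomials of least degree agree.\<close>

lemma min_poly_eqI:
  fixes K :: "'a::field set"
  assumes K: "subr K" "\<And>x. x \<in> K \<Longrightarrow> inverse x \<in> K"
    and h: "h \<in> polys K" "lead_coeff h = 1" "poly h x = 0"
    and min: "\<And>g. g \<in> polys K \<Longrightarrow> degree g < degree h \<Longrightarrow> poly g x = 0 \<Longrightarrow> g = 0"
  shows "min_poly K x = h"
proof -
  let ?R = "ring_of_type_algebra :: 'a ring"
  interpret F: field ?R by (rule field_from_type_algebra)
  interpret K: subr K by (rule K)
  have sr: "subring K ?R"
    by (rule F.subringI) (auto simp: K.one_in K.uminus_in K.mult_in K.add_in)
  have sf: "subfield K ?R"
    by (rule F.subfieldI'[OF sr]) (auto simp: rta_m_inv K)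
  have h0: "h \<noteq> 0" using h(2) by auto
  define L where "L = rev (coeffs h)"
  have "set (coeffs h) \<subseteq> range (coeff h)" unfolding range_coeff by (rule subset_insertI)
  then have "set (coeffs h) \<subseteq> K" using polysD[OF h(1)] by auto
  moreover have "hd (rev (coeffs h)) = 1" using h(2) h0 by (simp add: hd_rev last_coeffs_eq_coeff_degree)
  ultimately have Lc: "L \<in> carrier (univ_poly ?R K)" by (simp add: univ_poly_def polynomial_def L_def)
  have L0: "L \<noteq> []" using h0 by (simp add: L_def)
  have Le: "ring.eval ?R L x = \<zero>\<^bsub>?R\<^esub>" using h(3) by (simp add: rta_eval L_def)
  have alg: "(F.algebraic over K) x" by (rule F.algebraicI[OF Lc L0 Le])
  define I where "I = ring.Irr ?R K x"
  note irr = F.IrrE[OF sf _ alg, folded I_def, simplified]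
  define g where "g = Poly (rev I)"
  have I0: "I \<noteq> []" using irr(3) irr(2) by (auto simp: ring_irreducible_def univ_poly_def)
  have len: "length I \<le> length L"
  proof -
    have "length I - 1 \<le> length L - 1"
      using F.pdivides_imp_degree_le[OF sr irr(1) Lc L0] F.Irr_minimal[OF sf _ alg Lc Le, folded I_def] by simp
    then show ?thesis using L0 by (cases L) auto
  qed
  have cg: "coeff g j = nth_default 0 (rev I) j" for j by (simp add: g_def)
  have IK: "set I \<subseteq> K" using irr(1) by (auto simp: univ_poly_def polynomial_def)
  have gK: "g \<in> polys K"
  proof (rule polysI)
    fix j show "coeff g j \<in> K" unfolding cg nth_default_def using IK nth_mem[of j "rev I"] by auto
  qed
  have gl: "coeff g (length I - 1) = 1" using I0 irr(3) by (simp add: cg nth_default_def rev_nth hd_conv_nth)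
  have gx: "poly g x = 0" using irr(4) by (simp add: g_def rta_eval)
  have dh: "length L - 1 = degree h" using h0 by (simp add: L_def length_coeffs_degree)
  have dg: "degree g \<le> length I - 1" by (rule degree_le) (auto simp: cg nth_default_def)
  have dgh: "degree g \<le> degree h" using dg len dh by linarith
  have "\<not> degree g < degree h" using min[OF gK _ gx] gl by auto
  then have deq: "degree g = degree h" using dgh by simp
  then have "length I - 1 = degree h" using dg len dh by linarith
  then have "coeff g (degree h) = 1" using gl by simp
  have "g - h = 0"
  proof (rule ccontr)
    assume nz: "g - h \<noteq> 0"
    have "coeff (g - h) (degree h) = 0" using \<open>coeff g (degree h) = 1\<close> h(2) by simp
    moreover have "degree (g - h) \<le> degree h" by (rule degree_diff_le) (simp_all add: deq)
    ultimately have "degree (g - h) < degree h" using nz by (metis leading_coeff_0_iff le_neq_implies_less)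
    then show False using min[OF K.polys_diff[OF gK h(1)]] gx h(3) nz by simp
  qed
  then show ?thesis by (simp add: min_poly_def g_def I_def)
qed

context carlitz_tower
begin

text \<open>In units of \<open>vp (n + t)\<close> the coefficients have values divisible by
  \<open>q ^ t\<close>, so the terms of the vanishing sum have values that differ modulo
  \<open>q ^ t\<close>.\<close>

lemma Mp_minimal: assumes n: "n \<ge> 1" and g: "g \<in> polys (EF n)" "degree g < q ^ t" "poly g (vp (n + t)) = 0"
  shows "g = 0"
proof -
  have m: "n + t \<ge> 1" using n by simp
  note T = vp_M[OF m] vp_nz[OF m]
  let ?w = "vp (n + t)"
  have "\<exists>k. coeff g j \<noteq> 0 \<longrightarrow> veq ?w (int (q ^ t) * k) (coeff g j)" for j
    using vp_top_EF[OF n polysD[OF g(1)], of j t] by metis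
  then obtain k where k: "\<And>j. coeff g j \<noteq> 0 \<Longrightarrow> veq ?w (int (q ^ t) * k j) (coeff g j)" by metis
  have s: "(\<Sum>j<q ^ t. coeff g j * ?w ^ j) = 0" using poly_conv_sum[OF g(2), of ?w] g(3) by simp
  have "coeff g j * ?w ^ j = 0" if "j \<in> {..<q ^ t}" for j
  proof (rule distinct_values_zero[OF T _ _ _ s that, where a = "\<lambda>j. int (q ^ t) * k j + int j"])
    show "veq ?w (int (q ^ t) * k l + int l) (coeff g l * ?w ^ l)" if "coeff g l * ?w ^ l \<noteq> 0" for l
      using veq_mult[OF T k vp_power[OF m]] that by auto
    fix i j assume ij: "i \<in> {..<q ^ t}" "j \<in> {..<q ^ t}" "int (q ^ t) * k i + int i = int (q ^ t) * k j + int j"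
    have "(int (q ^ t) * k i + int i) mod int (q ^ t) = int i" "(int (q ^ t) * k j + int j) mod int (q ^ t) = int j"
      using ij(1,2) by (simp_all del: of_nat_power)
    then show "i = j" using ij(3) by (metis of_nat_eq_iff)
  qed auto
  then have "coeff g j = 0" for j using T g(2) by (cases "j < q ^ t") (auto simp: coeff_eq_0)
  then show ?thesis by (intro poly_eqI) simp
qed

lemma Mp_unique:
  assumes n: "n \<ge> 1" and P: "P \<in> polys (EF n)" "degree P = q ^ t" "lead_coeff P = 1" "poly P (vp (n + t)) = 0"
  shows "P = Mp n t"
proof (rule ccontr)
  assume ne: "P \<noteq> Mp n t"
  note Q = Mp_props[OF n, of t]
  have "coeff (P - Mp n t) (q ^ t) = 0" using P Mp_lead[OF n, of t] by (metis coeff_diff diff_self)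
  moreover have "degree (P - Mp n t) \<le> q ^ t" by (rule degree_diff_le) (use P Q in auto)
  ultimately have "degree (P - Mp n t) < q ^ t" using ne
    by (metis eq_iff_diff_eq_0 leading_coeff_0_iff le_neq_implies_less)
  then have "P - Mp n t = 0" by (intro Mp_minimal[OF n]) (use P Q subr.polys_diff[OF EF_subr[OF n]] in auto)
  then show False using ne by simp
qed

lemma mu_eq: assumes n: "n \<ge> 1" shows "mu f \<theta> n t = Mp n t"
proof -
  have m: "n + t \<ge> 1" using n by simp
  note Q = Mp_props[OF n, of t]
  show ?thesis unfolding mu_def cycE_eq[OF n] varpi_eq[OF m]
  proof (rule min_poly_eqI)
    show "g = 0" if "g \<in> polys (EF n)" "degree g < degree (Mp n t)" "poly g (vp (n + t)) = 0" for g
      using Mp_minimal[OF n that(1) _ that(3)] that(2) Q by simp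
  qed (use Q EF_subr[OF n] EF_inverse[OF n] in auto)
qed

section \<open>The ring of integers\<close>

text \<open>Once the powers of \<open>f\<close> are split off from numerator and denominator,
  membership in \<open>V\<close> says that the numerator has at least as many.\<close>

lemma baseQ_V_localized: assumes "c \<in> baseQ" "c \<in> V" shows "c \<in> localized f"
proof (cases "c = 0")
  case True
  then have "c = emb 0 / emb 1" by simp
  then show ?thesis unfolding localized_def using not_f_dvd_1 by blast
next
  case False
  obtain a b where ab: "b \<noteq> 0" "c = emb a / emb b" using baseQ_cases assms(1) by blast
  then have "a \<noteq> 0" using False by auto
  obtain i a' where a': "a = f ^ i * a'" "\<not> f dvd a'" using f_power_decompose[OF \<open>a \<noteq> 0\<close>] by blast
  obtain j b' where b': "b = f ^ j * b'" "\<not> f dvd b'" using f_power_decompose[OF ab(1)] by blast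
  have "veq (emb f) (int i - int j) c" unfolding ab(2)
    using veq_divide[OF f_M emb_f_nz emb_veq[OF a'(2), of i] emb_veq[OF b'(2), of j]] a'(1) b'(1) by simp
  then have "0 \<le> int i - int j" using veq_vge_iff[OF f_M emb_f_nz] assms(2) vge_0_iff by blast
  then have "f ^ i = f ^ (i - j) * f ^ j" by (simp flip: power_add)
  then have "emb a = emb (f ^ (i - j) * a') * emb f ^ j" unfolding a'(1) by (simp add: mult_ac)
  then have "c = emb (f ^ (i - j) * a') / emb b'" unfolding ab(2) b'(1) using emb_f_nz by simp
  then show ?thesis unfolding localized_def using b'(2) by blast
qed

abbreviation SS :: "nat \<Rightarrow> 'k qbar ring" where "SS n \<equiv> localized_adjoin f (vp n)"

text \<open>Integral elements of \<open>EF n\<close> have integral coordinates in the powers of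
  \<open>vp n\<close>. Hence divisibility in the ring of the statement can be checked as membership
  of a quotient in \<open>V\<close>.\<close>

lemma SS_carrier: assumes n: "n \<ge> 1" and x: "x \<in> EF n" "x \<in> V" shows "x \<in> carrier (SS n)"
proof -
  let ?G = "generate_ring ring_of_type_algebra (insert (vp n) (localized f))"
  interpret G: subr ?G
  proof
    show "1 \<in> ?G" using generate_ring.one[of "ring_of_type_algebra :: 'k qbar ring"] by simp
    show "x - y \<in> ?G" if "x \<in> ?G" "y \<in> ?G" for x y
      using generate_ring.eng_add[OF that(1) generate_ring.a_inv[OF that(2)]] by simp
    show "x * y \<in> ?G" if "x \<in> ?G" "y \<in> ?G" for x y
      using generate_ring.eng_mult[OF that] by simp
  qed
  obtain c where c: "\<forall>k. c k \<in> baseQ \<inter> V" "x = (\<Sum>k<q ^ (n - 1). c k * vp n ^ k)" using EF_span_V[OF n x] by blast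
  have "c k \<in> ?G" for k using c(1) baseQ_V_localized by (intro generate_ring.incl) auto
  moreover have "vp n \<in> ?G" by (intro generate_ring.incl) simp
  ultimately have "x \<in> ?G" unfolding c(2) by (intro G.sum_in G.mult_in G.power_in)
  then show ?thesis by (simp add: localized_adjoin_def)
qed

lemma SS_mult: "x \<otimes>\<^bsub>SS n\<^esub> y = x * y" and SS_one: "\<one>\<^bsub>SS n\<^esub> = 1"
  by (simp_all add: localized_adjoin_def)

lemma SS_divides: assumes n: "n \<ge> 1" and "x \<in> EF n" "y \<in> EF n" "y \<noteq> 0" "x / y \<in> V"
  shows "y divides\<^bsub>SS n\<^esub> x"
  unfolding factor_def
  by (rule bexI[of _ "x / y"]) (use assms SS_carrier[OF n EF_divide[OF n]] in \<open>auto simp: SS_mult\<close>)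

lemma SS_Units: assumes n: "n \<ge> 1" and x: "x \<in> EF n" "x \<in> U" shows "x \<in> Units (SS n)"
proof -
  have "x \<in> carrier (SS n)" "inverse x \<in> carrier (SS n)"
    using SS_carrier[OF n] x EF_inverse[OF n] by (auto simp: U_def)
  then show ?thesis using U_nz[OF x(2)] by (auto simp: Units_def SS_mult SS_one intro!: bexI[of _ "inverse x"])
qed

lemma emb_EF: "n \<ge> 1 \<Longrightarrow> emb a \<in> EF n" using EF_baseQ emb_baseQ by blast
lemma f_power_EF: "n \<ge> 1 \<Longrightarrow> emb f ^ k \<in> EF n" using subr.power_in[OF EF_subr emb_EF] .
lemma f_power_vp_EF: "n \<ge> 1 \<Longrightarrow> emb f ^ k * vp n \<in> EF n" using subr.mult_in[OF EF_subr f_power_EF vp_EF] .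

section \<open>The case f = Y\<close>

lemma vp_1: "vp 1 = emb f"
proof -
  have "emb f = poly Pf 0" by (simp add: poly_0_coeff_0 Pf_0)
  also have "\<dots> = (\<Prod>c\<in>R1. - 1 * carlitz_act c (\<theta> 1))" by (simp add: Pf_prod poly_prod R1_def)
  also have "\<dots> = (- 1) ^ (q - 1) * vp 1" unfolding prod.distrib by (simp add: vp_def teich_def card_R1)
  finally show ?thesis using odd_q by simp
qed

text \<open>For f = Y the representatives in \<open>R1\<close> are constants, equal to their own
  lifts and acting by multiplication; so \<open>vp m\<close> is a constant \<open>w\<close> times
  \<open>\<theta> m ^ (q - 1)\<close>, and level 1, where \<open>vp 1\<close> is \<open>f\<close>,
  shows that \<open>w\<close> is -1.\<close>

lemma vp_relation_Y: assumes fY: "f = [:0, 1:]" and n: "n \<ge> 1"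
  shows "vp (Suc n) * (vp (Suc n) - emb f) ^ (q - 1) = vp n"
proof -
  have qk: "q = CARD('k)" using q_def fY by simp
  have act: "carlitz_act f x = x * (emb f + x ^ (q - 1))" for x
  proof -
    have "carlitz_act f x = carlitz_Y x" by (simp add: carlitz_act_def fY one_pCons[symmetric])
    also have "\<dots> = emb f * x + x ^ q" by (simp add: carlitz_Y_def fY qk)
    also have "x ^ q = x * x ^ (q - 1)" using q_pos by (simp flip: power_Suc)
    finally show ?thesis by (simp add: algebra_simps)
  qed
  define w where "w = (\<Prod>c\<in>R1. emb c)"
  have vpw: "vp m = w * \<theta> m ^ (q - 1)" for m
  proof -
    have "carlitz_act (teich m c) (\<theta> m) = emb c * \<theta> m" if "c \<in> R1" for c
    proof -
      have "degree f = 1" using fY by simp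
      then have "degree c = 0" using that by (simp add: R1_def R_def)
      then obtain a where a: "c = [:a:]" by (rule degree_eq_zeroE)
      have "[:a:] ^ k = [:a ^ k:]" for k by (induction k) (auto simp: one_pCons)
      then have "c ^ q = c" using finite_field_power_card[of a] by (simp add: a qk)
      then have "c ^ (q ^ k) = c" for k by (induction k) (auto simp: power_mult)
      then show ?thesis by (simp add: teich_def a carlitz_act_const)
    qed
    then show ?thesis by (simp add: vp_def w_def prod.distrib card_R1)
  qed
  have "\<theta> 1 * (emb f + \<theta> 1 ^ (q - 1)) = 0" using act_f_theta_1 act by simp
  then have t1: "\<theta> 1 ^ (q - 1) = - emb f" using theta_1_nz by (simp add: eq_neg_iff_add_eq_0 add.commute)
  have "w * (- emb f) = emb f" using vp_1 vpw[of 1] t1 by simp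
  then have w: "w = -1" using emb_f_nz by (metis mult_cancel_right mult_minus_left mult_minus_right mult_1 minus_minus)
  have "\<theta> n = \<theta> (Suc n) * (emb f - vp (Suc n))" using act_f_theta[OF n] act[of "\<theta> (Suc n)"] by (simp add: vpw w)
  then have "vp n = vp (Suc n) * (emb f - vp (Suc n)) ^ (q - 1)" by (simp add: vpw w power_mult_distrib)
  also have "(emb f - vp (Suc n)) ^ (q - 1) = (vp (Suc n) - emb f) ^ (q - 1)"
  proof -
    have "even (q - 1)" using odd_q by simp
    then have "(- (vp (Suc n) - emb f)) ^ (q - 1) = (vp (Suc n) - emb f) ^ (q - 1)" by (rule power_minus_even)
    then show ?thesis by simp
  qed
  finally show ?thesis by simp
qed

lemma linear_power_expand: assumes y: "y \<in> V"
  shows "\<exists>s\<in>polys V. [:- y, 1:] ^ m = monom 1 m - monom (of_nat m * y) (m - 1) + Polynomial.smult (y ^ 2) s"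
proof (induction m)
  case 0
  show ?case by (intro bexI[of _ 0]) (auto simp: polys_0 monom_eq_1)
next
  case (Suc m)
  then obtain s where s: "s \<in> polys V" "[:- y, 1:] ^ m = monom 1 m - monom (of_nat m * y) (m - 1) + Polynomial.smult (y ^ 2) s" by blast
  define s' where "s' = monom (of_nat m) (m - 1) + [:- y, 1:] * s"
  have sh: "pCons 0 (monom (of_nat m * y) (m - 1)) = monom (of_nat m * y) m"
    by (cases m) (simp_all add: monom_Suc)
  have "[:- y, 1:] ^ Suc m = [:- y, 1:] * (monom 1 m - monom (of_nat m * y) (m - 1) + Polynomial.smult (y ^ 2) s)"
    using s(2) by simp
  also have "\<dots> = (pCons 0 (monom 1 m) - pCons 0 (monom (of_nat m * y) (m - 1)))
      - (Polynomial.smult y (monom 1 m) - Polynomial.smult y (monom (of_nat m * y) (m - 1))) + Polynomial.smult (y ^ 2) ([:- y, 1:] * s)"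
    by (simp add: algebra_simps smult_add_right smult_diff_right)
  also have "\<dots> = monom 1 (Suc m) - monom (of_nat (Suc m) * y) m + Polynomial.smult (y ^ 2) s'"
    unfolding sh s'_def
    by (rule poly_eqI) (auto simp: smult_add_right algebra_simps power2_eq_square coeff_pCons split: nat.split)
  finally have "[:- y, 1:] ^ Suc m = monom 1 (Suc m) - monom (of_nat (Suc m) * y) (Suc m - 1) + Polynomial.smult (y ^ 2) s'" by simp
  moreover have "s' \<in> polys V" unfolding s'_def
    by (intro polys_add polys_monom polys_mult polys_pCons polys_0 s of_nat_in uminus_in y one_in)
  ultimately show ?case by blast
qed

text \<open>Modulo f^2 the power of X - f contributes only its linear term - (q - 1) f X^(q-2), and
  q - 1 is -1 in the field.\<close>

lemma Mp_1_Y: assumes fY: "f = [:0, 1:]" and n: "n \<ge> 1"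
  shows "coeff (Mp n 1 - (monom 1 q + monom (emb f) (q - 1) - [:vp n:])) j / emb f ^ 2 \<in> V"
proof -
  define P where "P = pCons 0 ([:- emb f, 1:] ^ (q - 1)) - [:vp n:]"
  interpret E: subr "EF n" by (rule EF_subr[OF n])
  have "P \<in> polys (EF n)" unfolding P_def
    by (intro E.polys_diff E.polys_pCons E.polys_power E.polys_0 E.zero_in E.uminus_in E.one_in emb_EF n vp_EF)
  moreover have d: "degree P = q ^ 1" and "lead_coeff P = 1"
  proof -
    have nz: "[:- emb f, 1:] ^ (q - 1) \<noteq> 0" by simp
    have dp: "degree (pCons 0 ([:- emb f, 1:] ^ (q - 1))) = q" using q_pos nz
      by (simp add: degree_power_eq del: power_eq_0_iff)
    have lp: "coeff (pCons 0 ([:- emb f, 1:] ^ (q - 1))) q = 1"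
    proof -
      have "lead_coeff (pCons 0 ([:- emb f, 1:] ^ (q - 1))) = 1" using nz by (simp add: lead_coeff_power)
      then show ?thesis unfolding dp .
    qed
    have "degree P = degree (pCons 0 ([:- emb f, 1:] ^ (q - 1)))"
      unfolding P_def diff_conv_add_uminus by (rule degree_add_eq_left) (use dp q_pos in simp)
    then show "degree P = q ^ 1" using dp by simp
    then show "lead_coeff P = 1" using lp q_pos by (simp add: P_def coeff_pCons split: nat.split nat.split_asm)
  qed
  moreover have "poly P (vp (n + 1)) = 0" using vp_relation_Y[OF fY n] by (simp add: P_def poly_power)
  ultimately have MP: "Mp n 1 = P" using Mp_unique[OF n] by metis
  obtain s where s: "s \<in> polys V" "[:- emb f, 1:] ^ (q - 1)
      = monom 1 (q - 1) - monom (of_nat (q - 1) * emb f) (q - 1 - 1) + Polynomial.smult (emb f ^ 2) s"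
    using linear_power_expand[OF f_V] by blast
  have q1: "of_nat (q - 1) = (-1 :: 'k qbar)"
  proof -
    have "q = Suc (q - 1)" using q_ge_3 by simp
    then have "of_nat q = (of_nat (q - 1) + 1 :: 'k qbar)" by (metis of_nat_Suc add.commute)
    then show ?thesis by (simp add: eq_neg_iff_add_eq_0)
  qed
  have m1: "pCons 0 (monom 1 (q - 1)) = (monom 1 q :: 'k qbar poly)" using q_pos by (simp add: monom_Suc[symmetric])
  have m2: "pCons 0 (monom c (q - 1 - 1)) = (monom c (q - 1) :: 'k qbar poly)" for c
    using q_ge_3 by (simp add: monom_Suc[symmetric] Suc_diff_Suc)
  have "pCons 0 ([:- emb f, 1:] ^ (q - 1)) = pCons 0 (monom 1 (q - 1)) - pCons 0 (monom (of_nat (q - 1) * emb f) (q - 1 - 1))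
     + Polynomial.smult (emb f ^ 2) (pCons 0 s)"
    unfolding s(2) by simp
  then have "Mp n 1 - (monom 1 q + monom (emb f) (q - 1) - [:vp n:]) = Polynomial.smult (emb f ^ 2) (pCons 0 s)"
    unfolding MP P_def m1 m2 q1 by (simp add: minus_monom[symmetric])
  moreover have "pCons 0 s \<in> polys V" using s(1) by (intro polys_pCons zero_in)
  ultimately show ?thesis using polysD[of "pCons 0 s" V j] emb_f_nz by (simp only: coeff_smult) simp
qed

text \<open>At multiples of \<open>q ^ b\<close> the coefficient is compared with the one-step
  polynomial through \<open>coeff_Mp_cong\<close> for \<open>i = 1\<close>. At all other indices up
  to the degree the multiplicity is below \<open>b\<close>, so \<open>coeff_Mp_divide\<close>
  already yields the factor \<open>f ^ 2\<close>.\<close>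

lemma Mp_Y: assumes fY: "f = [:0, 1:]" and n: "n \<ge> 1"
  shows "coeff (Mp n (Suc b) - (monom 1 (q ^ Suc b) + monom (emb f) ((q - 1) * q ^ b) - [:vp n:])) k / emb f ^ 2 \<in> V"
proof (cases "q ^ b dvd k")
  case True
  then obtain j where k: "k = q ^ b * j" by blast
  have qb: "q ^ b > 0" using q_pos by simp
  have "coeff (monom 1 (q ^ Suc b) + monom (emb f) ((q - 1) * q ^ b) - [:vp n:]) k
      = coeff (monom 1 q + monom (emb f) (q - 1) - [:vp n:]) j"
  proof -
    have "(q ^ Suc b = q ^ b * j) = (q = j)" "((q - 1) * q ^ b = q ^ b * j) = (q - 1 = j)"
      using q_pos by (auto simp: mult.commute[of _ "q ^ b"])
    moreover have "coeff [:vp n:] (q ^ b * j) = coeff [:vp n:] j" using qb by (cases j) (auto simp: coeff_pCons split: nat.split)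
    ultimately show ?thesis unfolding k by (simp only: coeff_add coeff_diff coeff_monom)
  qed
  then have "coeff (Mp n (Suc b) - (monom 1 (q ^ Suc b) + monom (emb f) ((q - 1) * q ^ b) - [:vp n:])) k
     = coeff (Mp n 1 - (monom 1 q + monom (emb f) (q - 1) - [:vp n:])) j - (coeff (Mp n 1) j - coeff (Mp n (1 + b)) (q ^ b * j))"
    unfolding coeff_diff k by simp
  moreover have "(coeff (Mp n 1) j - coeff (Mp n (1 + b)) (q ^ b * j)) / emb f ^ 2 \<in> V"
    using coeff_Mp_cong[OF n, of 1 j b] by (simp add: numeral_2_eq_2)
  ultimately show ?thesis using diff_in[OF Mp_1_Y[OF fY n, of j]] by (simp only: diff_divide_distrib)
next
  case False
  have "coeff (monom 1 (q ^ Suc b) + monom (emb f) ((q - 1) * q ^ b) - [:vp n:]) k = 0"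
  proof -
    have "k \<noteq> q ^ Suc b" "k \<noteq> (q - 1) * q ^ b" using False by auto
    moreover have "k \<noteq> 0" using False by (metis dvd_0_right)
    ultimately show ?thesis by (auto simp: coeff_pCons split: nat.split)
  qed
  then have e: "coeff (Mp n (Suc b) - (monom 1 (q ^ Suc b) + monom (emb f) ((q - 1) * q ^ b) - [:vp n:])) k = coeff (Mp n (Suc b)) k"
    unfolding coeff_diff by simp
  show ?thesis
  proof (cases "k \<le> q ^ Suc b")
    case True
    have "k \<noteq> 0" using False by (metis dvd_0_right)
    then have k: "k \<in> {1..q ^ Suc b}" using True by auto
    have "multiplicity q k < b"
    proof (rule ccontr)
      assume "\<not> multiplicity q k < b"
      then have "q ^ b dvd q ^ multiplicity q k" by (intro le_imp_power_dvd) simp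
      then show False using False multiplicity_dvd dvd_trans by blast
    qed
    then have "2 \<le> Suc b - multiplicity q k" by simp
    then show ?thesis unfolding e using V_divide_power[OF coeff_Mp_divide[OF n k]] by blast
  next
    case gt: False
    then have "coeff (Mp n (Suc b)) k = 0" using Mp_props[OF n, of "Suc b"] by (intro coeff_eq_0) simp
    then show ?thesis unfolding e by simp
  qed
qed

lemma mu_sum_monom: assumes n: "n \<ge> 1"
  shows "Mp n i = (\<Sum>j=0..q ^ i. monom (coeff (Mp n i) j) j)"
  using poly_as_sum_of_monoms[of "Mp n i"] Mp_props[OF n, of i] by (simp add: atMost_atLeast0)

lemma mu_sum_monom_middle: assumes n: "n \<ge> 1"
  shows "Mp n i = monom 1 (q ^ i) + (\<Sum>j=1..q ^ i - 1. monom (coeff (Mp n i) j) j) - [:vp n:]"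
proof -
  have "{0..N} = insert 0 (insert N {1..N - 1})" "N \<notin> {1..N - 1}" "0 \<notin> insert N {1..N - 1}" if "N > 0" for N :: nat
    using that by auto
  from this[of "q ^ i"] have "{0..q ^ i} = insert 0 (insert (q ^ i) {1..q ^ i - 1})" "q ^ i \<notin> {1..q ^ i - 1}" "0 \<notin> insert (q ^ i) {1..q ^ i - 1}"
    using q_pos by auto
  moreover have "coeff (Mp n i) (q ^ i) = 1" "coeff (Mp n i) 0 = - vp n"
    using Mp_props[OF n, of i] Mp_lead[OF n, of i] by auto
  ultimately show ?thesis by (subst mu_sum_monom[OF n]) (simp add: monom_0)
qed

lemma lt_threshold_nat: assumes "real j < real q ^ i * (real q - 2) / (real q - 1)"
  shows "j * (q - 1) < q ^ i * (q - 2)"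
proof -
  have "real j * (real q - 1) < real q ^ i * (real q - 2)"
    using assms q_ge_3 by (simp add: pos_less_divide_eq)
  moreover have "real (q - 1) = real q - 1" "real (q - 2) = real q - 2" using q_ge_3 by auto
  ultimately have "real (j * (q - 1)) < real (q ^ i * (q - 2))" by simp
  then show ?thesis by (simp only: of_nat_less_iff)
qed

lemma coeff_Mp_EF: "n \<ge> 1 \<Longrightarrow> coeff (Mp n i) j \<in> EF n" using Mp_props polysD by blast

lemma SS_divides_vp: assumes n: "n \<ge> 1" and x: "x \<in> EF n" "x / (emb f ^ k * vp n) \<in> V"
  shows "(emb f ^ k * vp n) divides\<^bsub>SS n\<^esub> x"
  by (rule SS_divides[OF n x(1) f_power_vp_EF[OF n] _ x(2)]) (use vp_nz[OF n] emb_f_nz in simp)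

lemma SS_divides_f: assumes n: "n \<ge> 1" and x: "x \<in> EF n" "x / emb f ^ k \<in> V"
  shows "emb f ^ k divides\<^bsub>SS n\<^esub> x"
  by (rule SS_divides[OF n x(1) f_power_EF[OF n] _ x(2)]) (use emb_f_nz in simp)

lemma EF_diff: "n \<ge> 1 \<Longrightarrow> x \<in> EF n \<Longrightarrow> y \<in> EF n \<Longrightarrow> x - y \<in> EF n" by (rule subr.diff_in[OF EF_subr])

lemma mu_properties:
  assumes n: "n \<ge> 1" and i: "i \<ge> 1" and S: "S = SS n" and a: "a = (\<lambda>i. coeff (Mp n i))"
  shows "\<forall>j. a i j \<in> carrier S"
    and "\<forall>j\<in>{1..q ^ i}. emb f ^ (i - multiplicity q j) divides\<^bsub>S\<^esub> a i j"
    and "\<forall>j\<in>{1..q ^ i}. real j < real q ^ i * (real q - 2) / (real q - 1) \<longrightarrow>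
        (emb f ^ (i - multiplicity q j) * vp n) divides\<^bsub>S\<^esub> a i j"
    and "\<forall>j\<in>{0..q ^ i}. \<forall>\<beta>\<ge>1.
        emb f ^ (i + 1) divides\<^bsub>S\<^esub> (a i j - a (i + \<beta>) (q ^ \<beta> * j))"
    and "\<forall>j\<in>{0..q ^ i}. real j < real q ^ i * (real q - 2) / (real q - 1) \<longrightarrow>
        (\<forall>\<beta>\<ge>1. (emb f ^ (i + 1) * vp n) divides\<^bsub>S\<^esub>
                  (a i j - a (i + \<beta>) (q ^ \<beta> * j)))"
    and "\<forall>\<beta>\<in>{0..i - 1}.
        a i (q ^ i - (q ^ i - q ^ \<beta>) div (q - 1)) / emb f ^ (i - \<beta>) \<in> Units S"
    and "f = [:0, 1:] \<longrightarrow> (\<forall>k. emb [:0, 1:] ^ 2 divides\<^bsub>S\<^esub>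
           coeff (Mp n i - (monom 1 (q ^ i) + monom (emb [:0, 1:]) ((q - 1) * q ^ (i - 1)) - [:vp n:])) k)"
proof -
  note E = coeff_Mp_EF[OF n] EF_diff[OF n]
  show "\<forall>j. a i j \<in> carrier S"
    unfolding S a using SS_carrier[OF n E(1)] Mp_props[OF n, of i] polysD by blast
  show "\<forall>j\<in>{1..q ^ i}. emb f ^ (i - multiplicity q j) divides\<^bsub>S\<^esub> a i j"
    unfolding S a using SS_divides_f[OF n E(1) coeff_Mp_divide[OF n]] by blast
  show "\<forall>j\<in>{1..q ^ i}. real j < real q ^ i * (real q - 2) / (real q - 1) \<longrightarrow>
        (emb f ^ (i - multiplicity q j) * vp n) divides\<^bsub>S\<^esub> a i j"
    unfolding S a using SS_divides_vp[OF n E(1) coeff_Mp_divide_vp[OF n _ lt_threshold_nat]] by simp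
  show "\<forall>j\<in>{0..q ^ i}. \<forall>\<beta>\<ge>1.
        emb f ^ (i + 1) divides\<^bsub>S\<^esub> (a i j - a (i + \<beta>) (q ^ \<beta> * j))"
    unfolding S a Suc_eq_plus1[symmetric] using SS_divides_f[OF n E(2)[OF E(1) E(1)] coeff_Mp_cong[OF n]] by blast
  show "\<forall>j\<in>{0..q ^ i}. real j < real q ^ i * (real q - 2) / (real q - 1) \<longrightarrow>
        (\<forall>\<beta>\<ge>1. (emb f ^ (i + 1) * vp n) divides\<^bsub>S\<^esub>
                  (a i j - a (i + \<beta>) (q ^ \<beta> * j)))"
    unfolding S a Suc_eq_plus1[symmetric]
    using SS_divides_vp[OF n E(2)[OF E(1) E(1)] coeff_Mp_cong_vp[OF n lt_threshold_nat]] by blast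
  show "\<forall>\<beta>\<in>{0..i - 1}.
        a i (q ^ i - (q ^ i - q ^ \<beta>) div (q - 1)) / emb f ^ (i - \<beta>) \<in> Units S"
  proof
    fix \<beta> assume "\<beta> \<in> {0..i - 1}"
    then have "\<beta> < i" using i by auto
    then show "a i (q ^ i - (q ^ i - q ^ \<beta>) div (q - 1)) / emb f ^ (i - \<beta>) \<in> Units S"
      unfolding S a by (intro SS_Units[OF n] EF_divide[OF n] E(1) f_power_EF[OF n] coeff_Mp_unit[OF n])
  qed
  show "f = [:0, 1:] \<longrightarrow> (\<forall>k. emb [:0, 1:] ^ 2 divides\<^bsub>S\<^esub>
           coeff (Mp n i - (monom 1 (q ^ i) + monom (emb [:0, 1:]) ((q - 1) * q ^ (i - 1)) - [:vp n:])) k)"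
  proof (intro impI allI)
    fix k assume f: "f = [:0, 1:]"
    obtain b where b: "i = Suc b" using i by (cases i) auto
    interpret E: subr "EF n" by (rule EF_subr[OF n])
    let ?h = "Mp n (Suc b) - (monom 1 (q ^ Suc b) + monom (emb f) ((q - 1) * q ^ b) - [:vp n:])"
    have "?h \<in> polys (EF n)"
      using Mp_props[OF n, of "Suc b"]
      by (intro E.polys_diff E.polys_add E.polys_monom E.polys_pCons E.polys_0 E.one_in emb_EF n vp_EF) auto
    then have "emb f ^ 2 divides\<^bsub>SS n\<^esub> coeff ?h k"
      by (intro SS_divides_f[OF n] Mp_Y[OF f n] polysD)
    then show "emb [:0, 1:] ^ 2 divides\<^bsub>S\<^esub>
           coeff (Mp n i - (monom 1 (q ^ i) + monom (emb [:0, 1:]) ((q - 1) * q ^ (i - 1)) - [:vp n:])) k"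
      unfolding S b diff_Suc_1 f .
  qed
qed

end

lemma subr_localized: fixes f :: "'k::{field,finite} poly"
  assumes "prime_elem f" shows "subr (localized f)"
proof
  have nd: "\<not> f dvd b * d" if "\<not> f dvd b" "\<not> f dvd d" for b d
    using that assms prime_elem_dvd_mult_iff by blast
  have nz: "emb b \<noteq> 0" if "\<not> f dvd b" for b using that by auto
  have "\<not> f dvd 1" using assms prime_elem_not_unit by blast
  moreover have "1 = emb 1 / emb (1 :: 'k poly)" by (simp add: emb_1)
  ultimately show "1 \<in> localized f" unfolding localized_def by blast
  fix x y assume "x \<in> localized f" "y \<in> localized f"
  then obtain a b c d where ab: "x = emb a / emb b" "\<not> f dvd b" and cd: "y = emb c / emb d" "\<not> f dvd d"
    unfolding localized_def by blast
  have "x - y = emb (a * d - c * b) / emb (b * d)"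
    unfolding ab(1) cd(1) using nz[OF ab(2)] nz[OF cd(2)] by (simp add: diff_frac_eq)
  then show "x - y \<in> localized f" unfolding localized_def using nd[OF ab(2) cd(2)] by blast
  have "x * y = emb (a * c) / emb (b * d)" unfolding ab(1) cd(1) by simp
  then show "x * y \<in> localized f" unfolding localized_def using nd[OF ab(2) cd(2)] by blast
qed

lemma exists_carlitz_valring: fixes f :: "'k::{field,finite} poly"
  assumes "prime_elem f" shows "\<exists>V. valring V \<and> localized f \<subseteq> V \<and> inverse (emb f) \<notin> V"
proof (rule subr.exists_dominating_valring[OF subr_localized[OF assms]])
  have "\<not> f dvd 1" using assms prime_elem_not_unit by blast
  moreover have "emb f = emb f / emb 1" by (simp add: emb_1)
  ultimately show "emb f \<in> localized f" unfolding localized_def by blast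
  show "inverse (emb f) \<notin> localized f"
  proof
    assume "inverse (emb f) \<in> localized f"
    then obtain a b where ab: "inverse (emb f) = emb a / emb b" "\<not> f dvd b" unfolding localized_def by blast
    have "emb f \<noteq> 0" "emb b \<noteq> 0" using ab(2) assms by auto
    then have "emb b = emb (f * a)" using ab(1) by (simp add: field_simps)
    then have "b = f * a" by (simp only: emb_eq_iff)
    then show False using ab(2) by simp
  qed
qed

theorem mainTheorem2:
  fixes p \<rho> r q m i :: nat
    and f :: "'k::{field,finite} poly"
    and \<theta> :: "nat \<Rightarrow> 'k qbar"
    and S :: "'k qbar ring"
    and a :: "nat \<Rightarrow> nat \<Rightarrow> 'k qbar"
  assumes "Factorial_Ring.prime p" and "p \<ge> 3" and "\<rho> \<ge> 1" and "r = p ^ \<rho>"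
    and "CARD('k) = r"
    and "Factorial_Ring.irreducible f" and "Polynomial.lead_coeff f = 1"
    and "q = r ^ Polynomial.degree f"
    and "compatible_generators f \<theta>"
    and "m \<ge> 1" and "i \<ge> 1"
    and "S = localized_adjoin f (varpi f \<theta> m)"
    and "a = (\<lambda>i j. Polynomial.coeff (mu f \<theta> m i) j)"
  shows
    "(\<forall>j. a i j \<in> carrier S) \<and>
     mu f \<theta> m i = (\<Sum>j=0..q ^ i. Polynomial.monom (a i j) j) \<and>
     mu f \<theta> m i = Polynomial.monom 1 (q ^ i)
                  + (\<Sum>j=1..q ^ i - 1. Polynomial.monom (a i j) j) - [:varpi f \<theta> m:] \<and>
     \<comment> \<open>(i)\<close>
     (\<forall>j\<in>{1..q ^ i}. emb f ^ (i - multiplicity q j) divides\<^bsub>S\<^esub> a i j) \<and>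
     \<comment> \<open>(i')\<close>
     (\<forall>j\<in>{1..q ^ i}. real j < real q ^ i * (real q - 2) / (real q - 1) \<longrightarrow>
        (emb f ^ (i - multiplicity q j) * varpi f \<theta> m) divides\<^bsub>S\<^esub> a i j) \<and>
     \<comment> \<open>(ii)\<close>
     (\<forall>j\<in>{0..q ^ i}. \<forall>\<beta>\<ge>1.
        emb f ^ (i + 1) divides\<^bsub>S\<^esub> (a i j - a (i + \<beta>) (q ^ \<beta> * j))) \<and>
     \<comment> \<open>(ii')\<close>
     (\<forall>j\<in>{0..q ^ i}. real j < real q ^ i * (real q - 2) / (real q - 1) \<longrightarrow>
        (\<forall>\<beta>\<ge>1. (emb f ^ (i + 1) * varpi f \<theta> m) divides\<^bsub>S\<^esub>
                  (a i j - a (i + \<beta>) (q ^ \<beta> * j)))) \<and>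
     \<comment> \<open>(iii)\<close>
     (\<forall>\<beta>\<in>{0..i - 1}.
        a i (q ^ i - (q ^ i - q ^ \<beta>) div (q - 1)) / emb f ^ (i - \<beta>) \<in> Units S) \<and>
     \<comment> \<open>(iv)\<close>
     (f = [:0, 1:] \<longrightarrow>
        (\<forall>k. emb [:0, 1:] ^ 2 divides\<^bsub>S\<^esub>
           Polynomial.coeff
             (mu f \<theta> m i
              - (Polynomial.monom 1 (q ^ i)
                 + Polynomial.monom (emb [:0, 1:]) ((q - 1) * q ^ (i - 1))
                 - [:varpi f \<theta> m:])) k))"
proof -
  \<comment> \<open>The statement does not mention \<open>V\<close>, so any such choice may be used
    to enter the locale.\<close>
  obtain V where V: "valring V" "localized f \<subseteq> V" "inverse (emb f) \<notin> V"
    using exists_carlitz_valring[OF field_poly_irreducible_imp_prime[OF assms(6)]] by blast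
  interpret carlitz_tower p \<rho> V f \<theta> q
  proof (intro carlitz_tower.intro finite_char.intro carlitz_tower_axioms.intro)
  qed (use assms V in simp_all)
  have mu: "mu f \<theta> m i = Mp m i" for i using mu_eq[OF assms(10)] .
  have vp: "varpi f \<theta> m = vp m" using varpi_eq[OF assms(10)] .
  have a: "a = (\<lambda>i. coeff (Mp m i))" unfolding assms(13) mu ..
  show ?thesis
    using mu_properties[OF assms(10,11) assms(12)[unfolded vp] a]
      mu_sum_monom[OF assms(10), of i] mu_sum_monom_middle[OF assms(10), of i]
    unfolding mu vp a by (intro conjI)
qed

end
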